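(* Let $(W,S)$ be a Coxeter system with $S$ finite. Then the set $L(W)$ of low elements of $W$ is a Garside shadow in $(W,S)$.
   Context: Let $\ell$ be the length function of $(W,S)$. For $w=uv$ in $W$ with $\ell(w)=\ell(u)+\ell(v)$, $u$ is called a prefix of $w$ and $v$ a suffix of $w$. The (right) weak order on $W$ is $u\leq_R w$ iff $u$ is a prefix of $w$. A subset $X\subseteq W$ is bounded if there is $g\in W$ with $x\leq_R g$ for all $x\in X$; every bounded $X$ has a least upper bound $\bigvee X$ for $\leq_R$, called its join. A Garside shadow in $(W,S)$ is a subset $A\subseteq W$ containing $S$ such that (i) if $X\subseteq A$ is bounded then $\bigvee X\in A$, and (ii) every suffix of an element of $A$ is in $A$. Geometric representation and roots. Fix a geometric representation of $(W,S)$: a real vector space $V$ with a symmetric bilinear form $B$, and a simple system $\Delta=\{\alpha_s : s\in S\}\subseteq V$ (finite, indexed bijectively by $S$) such that: $\sum_{\alpha\in\Delta}a_\alpha\alpha=0$ with all $a_\alpha\ge 0$ implies all $a_\alpha=0$; $B(\alpha,\beta)\in\,]-\infty,-1]\cup\{-\cos(\pi/k): k\in\mathbb N, k\geq 2\}$ for distinct $\alpha,\beta\in\Delta$; $B(\alpha,\alpha)=1$ for $\alpha\in\Delta$; and $W$ is faithfully represented in the group of linear maps preserving $B$, with $s\in S$ acting by $v\mapsto v-2B(\alpha_s,v)\alpha_s$. (So $B(\alpha_s,\alpha_t)=-\cos(\pi/m_{st})$ if the order $m_{st}$ of $st$ is finite, and $B(\alpha_s,\alpha_t)\le -1$ iff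 $m_{st}=\infty$.) For $A\subseteq V$, $\operatorname{cone}(A)$ is the set of non-negative linear combinations of vectors of $A$. The root system is $\Phi=W(\Delta)$, with positive roots $\Phi^+=\operatorname{cone}(\Delta)\cap\Phi$ and negative roots $\Phi^-=-\Phi^+$; $\Phi=\Phi^+\sqcup\Phi^-$. Put $\operatorname{cone}_\Phi(A)=\operatorname{cone}(A)\cap\Phi$. The (left) inversion set of $w\in W$ is $N(w)=\Phi^+\cap w(\Phi^-)$. Small roots and low elements. For $\alpha,\beta\in\Phi^+$, $\beta$ dominates $\alpha$ (written $\alpha\preceq\beta$) if for all $w\in W$, $\beta\in N(w)$ implies $\alpha\in N(w)$. A positive root is small if it dominates no positive root other than itself; $\Sigma$ is the set of small roots. An element $w\in W$ is low if $N(w)=\operatorname{cone}_\Phi(A)$ for some $A\subseteq\Sigma$. *)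

theory Defs
  imports "HOL-Analysis.Linear_Algebra" "HOL-Algebra.Multiplicative_Group"
    "HOL-Algebra.Generated_Groups" "HOL-Algebra.Lattice"
begin

section \<open>Coxeter systems\<close>

definition word_prod :: "('w, 'b) monoid_scheme \<Rightarrow> 'w list \<Rightarrow> 'w"
  where "word_prod W ws = foldr (\<lambda>x y. x \<otimes>\<^bsub>W\<^esub> y) ws \<one>\<^bsub>W\<^esub>"

text \<open>
  The least congruence on the free monoid of words over \<open>S\<close> that identifies every relator
  \<open>(s t)^m(s,t)\<close> with the empty word.  Here \<open>m(s,t) = 0\<close> encodes an infinite order, and then
  the relator is itself empty.  When \<open>m(s,s) = 1\<close> the relators \<open>s s\<close> make all letters
  invertible, so that the quotient monoid is the group presented by the generators \<open>S\<close> and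
  these relators.
\<close>

inductive word_cong :: "'w set \<Rightarrow> ('w \<Rightarrow> 'w \<Rightarrow> nat) \<Rightarrow> 'w list \<Rightarrow> 'w list \<Rightarrow> bool"
  for S :: "'w set" and m :: "'w \<Rightarrow> 'w \<Rightarrow> nat"
  where
    relator: "\<lbrakk>s \<in> S; t \<in> S; set xs \<subseteq> S; set ys \<subseteq> S\<rbrakk>
      \<Longrightarrow> word_cong S m (xs @ concat (replicate (m s t) [s, t]) @ ys) (xs @ ys)"
  | refl: "set xs \<subseteq> S \<Longrightarrow> word_cong S m xs xs"
  | sym: "word_cong S m xs ys \<Longrightarrow> word_cong S m ys xs"
  | trans: "\<lbrakk>word_cong S m xs ys; word_cong S m ys zs\<rbrakk> \<Longrightarrow> word_cong S m xs zs"

text \<open>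
  The generators have order 2, and all relations between them follow from the relations
  \<open>(s t)^m(s,t) = 1\<close>, where \<open>m(s,t)\<close> is the order of \<open>s t\<close> in \<open>W\<close>; the library function
  \<open>ord\<close> is 0 on elements of infinite order.  The set \<open>S\<close> may be infinite.
\<close>

locale coxeter_system = group W for W :: "('w, 'b) monoid_scheme" (structure) +
  fixes S :: "'w set"
  assumes gens_closed: "S \<subseteq> carrier W"
    and gens_generate: "generate W S = carrier W"
    and gens_order: "s \<in> S \<Longrightarrow> ord s = 2"
    and presentation: "\<lbrakk>set xs \<subseteq> S; set ys \<subseteq> S; word_prod W xs = word_prod W ys\<rbrakk>
      \<Longrightarrow> word_cong S (\<lambda>s t. ord (s \<otimes> t)) xs ys"
begin

definition len :: "'w \<Rightarrow> nat"
  where "len w = (LEAST n. \<exists>ws. set ws \<subseteq> S \<and> length ws = n \<and> word_prod W ws = w)"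

definition reduced_prod :: "'w \<Rightarrow> 'w \<Rightarrow> 'w \<Rightarrow> bool"
  where "reduced_prod w u v \<longleftrightarrow>
    u \<in> carrier W \<and> v \<in> carrier W \<and> w = u \<otimes> v \<and> len w = len u + len v"

definition is_prefix :: "'w \<Rightarrow> 'w \<Rightarrow> bool"
  where "is_prefix u w \<longleftrightarrow> (\<exists>v. reduced_prod w u v)"

definition is_suffix :: "'w \<Rightarrow> 'w \<Rightarrow> bool"
  where "is_suffix v w \<longleftrightarrow> (\<exists>u. reduced_prod w u v)"

definition weak_order :: "'w gorder"
  where "weak_order = \<lparr>carrier = carrier W, eq = (=), le = is_prefix\<rparr>"

definition bounded_in_weak_order :: "'w set \<Rightarrow> bool"
  where "bounded_in_weak_order Y \<longleftrightarrow> (\<exists>g\<in>carrier W. \<forall>x\<in>Y. is_prefix x g)"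

text \<open>The empty set is bounded, and its join is \<open>\<one>\<close>.\<close>

definition is_join :: "'w \<Rightarrow> 'w set \<Rightarrow> bool"
  where "is_join g Y \<longleftrightarrow> least weak_order g (Upper weak_order Y)"

definition garside_shadow :: "'w set \<Rightarrow> bool"
  where "garside_shadow A \<longleftrightarrow>
    S \<subseteq> A \<and> A \<subseteq> carrier W \<and>
    (\<forall>Y. Y \<subseteq> A \<longrightarrow> bounded_in_weak_order Y \<longrightarrow> (\<exists>g. is_join g Y \<and> g \<in> A)) \<and>
    (\<forall>w v. w \<in> A \<longrightarrow> is_suffix v w \<longrightarrow> v \<in> A)"

end

section \<open>Geometric representations\<close>

definition isometry_group :: "('v::real_vector \<Rightarrow> 'v \<Rightarrow> real) \<Rightarrow> ('v \<Rightarrow> 'v) monoid"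
  where "isometry_group B =
    \<lparr>carrier = {f. linear f \<and> bij f \<and> (\<forall>x y. B (f x) (f y) = B x y)}, mult = (\<circ>), one = id\<rparr>"

definition cone_of :: "'v::real_vector set \<Rightarrow> 'v set"
  where "cone_of A = {v. \<exists>F c. finite F \<and> F \<subseteq> A \<and> (\<forall>a\<in>F. 0 \<le> c a) \<and>
                            v = (\<Sum>a\<in>F. (c a :: real) *\<^sub>R a)}"

text \<open>
  The vector space \<open>V\<close> is the type \<open>'v\<close>, of arbitrary dimension; \<open>\<rho>\<close> is the action of \<open>W\<close>
  on \<open>V\<close>, and \<open>\<alpha> s\<close> is the simple root of \<open>s\<close>.
\<close>

locale geometric_representation = coxeter_system W S
  for W :: "('w, 'b) monoid_scheme" (structure) and S :: "'w set" +
  fixes B :: "'v::real_vector \<Rightarrow> 'v \<Rightarrow> real"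
    and \<alpha> :: "'w \<Rightarrow> 'v"
    and \<rho> :: "'w \<Rightarrow> 'v \<Rightarrow> 'v"
  assumes form_bilinear: "bilinear B"
    and form_symmetric: "B x y = B y x"
    and finite_simple: "finite (\<alpha> ` S)"
    and simple_inj: "inj_on \<alpha> S"
    and simple_pos_independent:
      "\<lbrakk>\<And>\<delta>. \<delta> \<in> \<alpha> ` S \<Longrightarrow> 0 \<le> a \<delta>; (\<Sum>\<delta>\<in>\<alpha> ` S. (a \<delta> :: real) *\<^sub>R \<delta>) = 0; \<delta>' \<in> \<alpha> ` S\<rbrakk> \<Longrightarrow> a \<delta>' = 0"
    and simple_distinct: "\<lbrakk>\<delta> \<in> \<alpha> ` S; \<delta>' \<in> \<alpha> ` S; \<delta> \<noteq> \<delta>'\<rbrakk>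
      \<Longrightarrow> B \<delta> \<delta>' \<in> {..-1} \<union> {- cos (pi / real k) | k :: nat. 2 \<le> k}"
    and simple_norm: "\<delta> \<in> \<alpha> ` S \<Longrightarrow> B \<delta> \<delta> = 1"
    and rep_hom: "\<rho> \<in> hom W (isometry_group B)"
    and rep_faithful: "inj_on \<rho> (carrier W)"
    and rep_gens: "s \<in> S \<Longrightarrow> \<rho> s v = v - (2 * B (\<alpha> s) v) *\<^sub>R \<alpha> s"
begin

definition roots :: "'v set"
  where "roots = {\<rho> w \<delta> | w \<delta>. w \<in> carrier W \<and> \<delta> \<in> \<alpha> ` S}"

definition pos_roots :: "'v set"
  where "pos_roots = cone_of (\<alpha> ` S) \<inter> roots"

definition neg_roots :: "'v set"
  where "neg_roots = uminus ` pos_roots"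

definition root_cone :: "'v set \<Rightarrow> 'v set"
  where "root_cone A = cone_of A \<inter> roots"

definition inversions :: "'w \<Rightarrow> 'v set"
  where "inversions w = pos_roots \<inter> \<rho> w ` neg_roots"

definition dominates :: "'v \<Rightarrow> 'v \<Rightarrow> bool"
  where "dominates \<beta> \<gamma> \<longleftrightarrow> (\<forall>w\<in>carrier W. \<beta> \<in> inversions w \<longrightarrow> \<gamma> \<in> inversions w)"

definition small_roots :: "'v set"
  where "small_roots = {\<beta> \<in> pos_roots. \<forall>\<gamma>\<in>pos_roots. dominates \<beta> \<gamma> \<longrightarrow> \<gamma> = \<beta>}"

definition low_elements :: "'w set"
  where "low_elements = {w \<in> carrier W. \<exists>A. A \<subseteq> small_roots \<and> inversions w = root_cone A}"

end

end

theory Submission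
  imports Defs
begin

text \<open>
  Write \<open>N(w)\<close> for the set of inversions of \<open>w\<close>.  Its cardinality is the length of \<open>w\<close>
  (\<open>len_card\<close>), and the weak order is inclusion of inversion sets (\<open>prefix_iff\<close>).  An element is
  low if \<open>N(w)\<close> contains small roots whose cone contains \<open>N(w)\<close> (\<open>low_iff\<close>).  The generators
  are low because simple roots are small.

  \<^emph>\<open>Joins.\<close>  If \<open>Y\<close> is bounded, then its join \<open>w\<close> has \<open>N(w)\<close> equal to the set of roots in the
  cone of \<open>\<Union>y\<in>Y. N(y)\<close> (\<open>join_inversions\<close>).  So if small roots generate each \<open>N(y)\<close>, then the same
  roots together generate \<open>N(w)\<close>.  To find \<open>w\<close>, take an element with the largest inversion set
  inside the cone.  If it missed part of some \<open>N(y)\<close>, then it could be multiplied by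
  a further generator without leaving the cone (\<open>extend_in_closed\<close>).

  \<^emph>\<open>Suffixes.\<close>  It suffices to cancel one generator: if \<open>r w\<close> is low and longer than \<open>w\<close>, then
  \<open>w\<close> is low (\<open>low_cancel_left\<close>, from \<open>low_suffix\<close>).  Let \<open>a\<close> be the simple root of \<open>r\<close>.  The set
  \<open>N(w)\<close> is generated by its extremal members, those \<open>\<beta>\<close> for which deleting the reflection in \<open>\<beta>\<close>
  shortens \<open>w\<close> by exactly one.  Suppose that one of them, \<open>b\<close>, is not small.  Consider the roots
  \<open>b = d 1\<close>, \<open>d 2 = s b a\<close>, \<open>d 3\<close>, ... met when turning from \<open>b\<close> towards \<open>a\<close> in the plane of these two
  roots.  As \<open>r w\<close> is low, the non-small root \<open>s a b\<close> is not extremal in \<open>N(r w)\<close>, and this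
  forces \<open>d 2\<close> into \<open>N(w)\<close>.  Let \<open>\<gamma>\<close> be the last of the roots \<open>d 1, d 2, d 3, ...\<close> before the first one
  outside \<open>N(w)\<close>.  Comparing lengths shows that \<open>s a \<gamma>\<close> is extremal in \<open>N(r w)\<close>; hence \<open>s a \<gamma>\<close>
  is small, and so is \<open>\<gamma>\<close>.  This is impossible.  If the plane contains infinitely many roots, then
  \<open>\<gamma>\<close> dominates \<open>b\<close>.  If it contains finitely many, then \<open>\<gamma>\<close> lies strictly between \<open>b\<close> and \<open>a\<close>,
  and a root interior to a finite dihedral subsystem that has a non-small canonical generator is itself
  not small (\<open>interior_not_small\<close>).

  \<^emph>\<open>Interior roots.\<close>  Dominance between two positive roots means that their pairing is at least 1,
  the higher one dominating (\<open>dom_by_height\<close>, \<open>dom_imp_B\<close>).  Let \<open>\<phi>\<close> be the average of the height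
  over the finite dihedral group; it vanishes on the plane of \<open>a\<close> and \<open>b\<close>.  Let \<open>M\<close> be the finite
  set of positive roots on which \<open>\<phi>\<close> is negative.  A positive root of the plane fails to be small
  exactly when some member of \<open>M\<close> has pairing at least 1 with it (\<open>phi_neg_of_dominated\<close>,
  \<open>above_M_not_small\<close>).  This condition can be carried along the roots of the plane by the
  reflections in \<open>a\<close> and \<open>b\<close>.  The one step that requires work leads from \<open>b\<close> to \<open>s b a\<close>; it is an argument
  in the three-dimensional space spanned by \<open>a\<close>, \<open>b\<close> and a root of \<open>M\<close> (\<open>above_M_d2\<close>).

  The arguments on dominance use a linear height that is positive on the simple roots.  It exists by
  Gordan's theorem (\<open>exists_positive_functional\<close>), even if the simple roots are linearly dependent.
  That every root is positive or negative follows from the classical induction on length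
  (\<open>simple_image_positive\<close>).
\<close>

section \<open>Reflections and three-term recurrences\<close>

definition refl :: "('v::real_vector \<Rightarrow> 'v \<Rightarrow> real) \<Rightarrow> 'v \<Rightarrow> 'v \<Rightarrow> 'v"
  where "refl B b v = v - (2 * B b v) *\<^sub>R b"

text \<open>
  The roots met when turning from \<open>a\<close> over \<open>b\<close> in the plane of two roots \<open>a\<close> and \<open>b\<close>:
  each one is the negative of the reflection of the last but one in the last one.
\<close>

fun chain :: "('v::real_vector \<Rightarrow> 'v \<Rightarrow> real) \<Rightarrow> 'v \<Rightarrow> 'v \<Rightarrow> nat \<Rightarrow> 'v"
  where
    "chain B a b 0 = a"
  | "chain B a b (Suc 0) = b"
  | "chain B a b (Suc (Suc n)) = (2 * B a b) *\<^sub>R chain B a b (Suc n) - chain B a b n"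

text \<open>
  Linear functionals evaluated along a chain satisfy this recurrence with \<open>b\<close> the pairing of two
  successive roots.  For \<open>b \<ge> 1\<close> the sequence is convex as long as it is positive, so that it keeps
  growing; for \<open>b < 1\<close> it is concave.
\<close>

lemma recurrence_mono:
  fixes x :: "nat \<Rightarrow> real"
  assumes "\<And>n. x (Suc (Suc n)) = 2 * b * x (Suc n) - x n"
    and "1 \<le> b" and "x 0 \<le> x (Suc 0)" and "0 < x (Suc 0)"
  shows "x n \<le> x (Suc n) \<and> 0 < x (Suc n)"
proof (induction n)
  case (Suc n)
  have "1 * x (Suc n) \<le> b * x (Suc n)"
    using assms(2) Suc by (intro mult_right_mono) auto
  then show ?case
      using Suc assms(1)[of n] mult.assoc[of 2 b "x (Suc n)"] by (intro conjI; linarith)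
qed (use assms in auto)

lemma recurrence_strict_mono:
  fixes x :: "nat \<Rightarrow> real"
  assumes rec: "\<And>n. x (Suc (Suc n)) = 2 * b * x (Suc n) - x n"
    and "1 \<le> b" and "x 0 < x (Suc 0)" and "0 < x (Suc 0)"
  shows "strict_mono x" and "0 < x (Suc n)"
proof -
  have *: "x n < x (Suc n) \<and> 0 < x (Suc n)" for n
  proof (induction n)
    case (Suc n)
    have "1 * x (Suc n) \<le> b * x (Suc n)"
      using assms(2) Suc by (intro mult_right_mono) auto
    then show ?case
      using Suc assms(1)[of n] mult.assoc[of 2 b "x (Suc n)"] by (intro conjI; linarith)
  qed (use assms in auto)
  show "strict_mono x" using * by (simp add: strict_mono_Suc_iff)
  show "0 < x (Suc n)" using * by blast
qed

text \<open>
  A concave sequence of positive numbers does not decrease; but then its increments drop by at least a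
  fixed amount in every step.
\<close>

lemma recurrence_not_pos:
  fixes x :: "nat \<Rightarrow> real"
  assumes rec: "\<And>n. x (Suc (Suc n)) = 2 * b * x (Suc n) - x n"
    and b: "b < 1" and pos: "\<And>n. 0 < x n"
  shows False
proof -
  define d where "d n = x (Suc n) - x n" for n
  have step: "d (Suc n) = d n - (2 - 2 * b) * x (Suc n)" for n
    unfolding d_def rec by (simp add: algebra_simps)
  have dec: "d (Suc n) < d n" for n
    using step[of n] b pos[of "Suc n"] by simp
  have nonneg: "0 \<le> d N" for N
  proof (rule ccontr)
    assume neg: "\<not> 0 \<le> d N"
    have "x (N + k) \<le> x N + real k * d N" for k
    proof (induction k)
      case (Suc k)
      have "d (N + k) \<le> d N" by (induction k) (use dec in \<open>auto intro: order.trans less_imp_le\<close>)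
      then show ?case using Suc by (simp add: d_def algebra_simps)
    qed simp
    moreover obtain k where "x N < real k * (- d N)"
      using neg reals_Archimedean3[of "- d N"] by auto
    ultimately show False using pos[of "N + k"] by (smt (verit) mult_minus_right)
  qed
  have ge: "x 0 \<le> x n" for n
    by (induction n) (use nonneg in \<open>auto simp: d_def intro: order.trans\<close>)
  define c where "c = (2 - 2 * b) * x 0"
  have c: "0 < c" using b pos[of 0] by (simp add: c_def)
  have "d n \<le> d 0 - real n * c" for n
  proof (induction n)
    case (Suc n)
    have "c \<le> (2 - 2 * b) * x (Suc n)"
      unfolding c_def using b ge[of "Suc n"] by (intro mult_left_mono) auto
    then show ?case using Suc step[of n] by (simp add: algebra_simps)
  qed simp
  moreover obtain k where "d 0 < real k * c"
    using c reals_Archimedean3[of c] by auto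
  ultimately show False using nonneg[of k] by (smt (verit))
qed

section \<open>Root systems with a height\<close>

lemmas bilinear_simps = bilinear_ladd bilinear_radd bilinear_lmul bilinear_rmul
  bilinear_lsub bilinear_rsub bilinear_lneg bilinear_rneg bilinear_lzero bilinear_rzero

text \<open>
  The arguments on dominance and small roots use only a group of isometries that acts on roots
  and a linear height \<open>ht\<close> that tells positive roots from negative ones.  The simple roots enter
  through one property: a simple reflection permutes the positive roots other than its own.
\<close>

locale root_system =
  fixes B :: "'v::real_vector \<Rightarrow> 'v \<Rightarrow> real" and G :: "('v \<Rightarrow> 'v) set"
    and \<Phi> :: "'v set" and \<Delta> :: "'v set" and ht :: "'v \<Rightarrow> real"
  assumes bilinear_B: "bilinear B"
    and sym_B: "B x y = B y x"
    and G_linear: "g \<in> G \<Longrightarrow> linear g"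
    and G_isometry: "g \<in> G \<Longrightarrow> B (g x) (g y) = B x y"
    and G_id: "id \<in> G"
    and G_comp: "\<lbrakk>g \<in> G; g' \<in> G\<rbrakk> \<Longrightarrow> g \<circ> g' \<in> G"
    and G_root: "\<lbrakk>g \<in> G; \<beta> \<in> \<Phi>\<rbrakk> \<Longrightarrow> g \<beta> \<in> \<Phi>"
    and root_norm: "\<beta> \<in> \<Phi> \<Longrightarrow> B \<beta> \<beta> = 1"
    and refl_G: "\<beta> \<in> \<Phi> \<Longrightarrow> refl B \<beta> \<in> G"
    and ht_linear: "linear ht"
    and ht_nonzero: "\<beta> \<in> \<Phi> \<Longrightarrow> ht \<beta> \<noteq> 0"
    and finite_neg: "g \<in> G \<Longrightarrow> finite {\<beta> \<in> \<Phi>. 0 < ht \<beta> \<and> ht (g \<beta>) < 0}"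
    and simple_root: "a \<in> \<Delta> \<Longrightarrow> a \<in> \<Phi>"
    and simple_pos: "a \<in> \<Delta> \<Longrightarrow> 0 < ht a"
    and simple_permutes: "\<lbrakk>a \<in> \<Delta>; \<beta> \<in> \<Phi>; 0 < ht \<beta>; \<beta> \<noteq> a\<rbrakk> \<Longrightarrow> 0 < ht (refl B a \<beta>)"
    and G_inj: "g \<in> G \<Longrightarrow> inj g"
    and root_conj_simple: "\<beta> \<in> \<Phi> \<Longrightarrow> \<exists>g\<in>G. g \<beta> \<in> \<Delta>"
begin

lemmas B_simps = bilinear_simps[OF bilinear_B]

lemmas ht_simps = linear_add[OF ht_linear] linear_diff[OF ht_linear] linear_scale[OF ht_linear]
  linear_neg[OF ht_linear] linear_0[OF ht_linear]

lemma G_simps: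
  assumes "g \<in> G"
  shows "g (x + y) = g x + g y" "g (x - y) = g x - g y" "g (- x) = - g x" "g (c *\<^sub>R x) = c *\<^sub>R g x"
  using G_linear[OF assms] by (simp_all add: linear_add linear_diff linear_neg linear_scale)

abbreviation s :: "'v \<Rightarrow> 'v \<Rightarrow> 'v" where "s \<equiv> refl B"

definition pos :: "'v set" where "pos = {\<beta> \<in> \<Phi>. 0 < ht \<beta>}"

text \<open>
  For \<open>g\<close> representing \<open>w\<close>, this is the inversion set of the inverse of \<open>w\<close>.
\<close>

definition neg_set :: "('v \<Rightarrow> 'v) \<Rightarrow> 'v set"
  where "neg_set g = {\<beta> \<in> pos. ht (g \<beta>) < 0}"

text \<open>
  Dominance, extended from positive roots to all roots, which makes it invariant under \<open>G\<close>.
\<close>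

definition dom :: "'v \<Rightarrow> 'v \<Rightarrow> bool"
  where "dom \<beta> \<gamma> \<longleftrightarrow> (\<forall>g\<in>G. ht (g \<beta>) < 0 \<longrightarrow> ht (g \<gamma>) < 0)"

definition small :: "'v set"
  where "small = {\<beta> \<in> pos. \<forall>\<gamma>\<in>pos. dom \<beta> \<gamma> \<longrightarrow> \<gamma> = \<beta>}"

lemma posD: "\<beta> \<in> pos \<Longrightarrow> \<beta> \<in> \<Phi>" "\<beta> \<in> pos \<Longrightarrow> 0 < ht \<beta>"
  by (auto simp: pos_def)

lemma posI: "\<beta> \<in> \<Phi> \<Longrightarrow> 0 < ht \<beta> \<Longrightarrow> \<beta> \<in> pos"
  by (simp add: pos_def)

lemma finite_neg_set: "g \<in> G \<Longrightarrow> finite (neg_set g)"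
  using finite_neg by (simp add: neg_set_def pos_def)

lemma refl_self: "\<beta> \<in> \<Phi> \<Longrightarrow> s \<beta> \<beta> = - \<beta>"
  by (simp add: refl_def root_norm) (metis add.inverse_inverse diff_minus_eq_add minus_diff_eq scaleR_2 add_diff_cancel_left')

lemma refl_refl: "\<beta> \<in> \<Phi> \<Longrightarrow> s \<beta> (s \<beta> v) = v"
  by (simp add: refl_def B_simps root_norm algebra_simps flip: scaleR_add_left)

lemma uminus_root: "\<beta> \<in> \<Phi> \<Longrightarrow> - \<beta> \<in> \<Phi>"
  using G_root[OF refl_G] refl_self by metis

lemma refl_root: "\<beta> \<in> \<Phi> \<Longrightarrow> \<gamma> \<in> \<Phi> \<Longrightarrow> s \<beta> \<gamma> \<in> \<Phi>"
  using G_root[OF refl_G] .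

lemma refl_conj:
  assumes "g \<in> G"
  shows "g (s \<beta> v) = s (g \<beta>) (g v)"
  by (simp add: refl_def G_simps[OF assms] G_isometry[OF assms])

lemma root_neg_or_pos: "\<beta> \<in> \<Phi> \<Longrightarrow> ht \<beta> < 0 \<or> 0 < ht \<beta>"
  using ht_nonzero by force

lemma ht_uminus: "ht (- \<beta>) = - ht \<beta>"
  by (simp add: ht_simps)

text \<open>
  A simple root spans an extreme ray of the cone of positive roots: apply the height to a
  relation that expresses a multiple of \<open>a\<close> by positive roots, before and after reflecting it in \<open>a\<close>.
\<close>

lemma simple_extreme:
  assumes "a \<in> \<Delta>" and "\<beta> \<in> pos" "\<gamma> \<in> pos" "\<delta> \<in> pos" and "0 < x" "0 \<le> y" "0 \<le> z"
    and eq: "x *\<^sub>R \<beta> + y *\<^sub>R \<gamma> + z *\<^sub>R \<delta> = c *\<^sub>R a"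
  shows "\<beta> = a"
proof (rule ccontr)
  assume "\<beta> \<noteq> a"
  \<comment> \<open>Summands equal to \<open>a\<close> are moved to the right. The reflection in \<open>a\<close> then keeps the height of the
    left side positive and changes the sign of the right side.\<close>
  define y' where "y' = (if \<gamma> = a then 0 else y)"
  define z' where "z' = (if \<delta> = a then 0 else z)"
  define c' where "c' = c - (if \<gamma> = a then y else 0) - (if \<delta> = a then z else 0)"
  have eq': "x *\<^sub>R \<beta> + y' *\<^sub>R \<gamma> + z' *\<^sub>R \<delta> = c' *\<^sub>R a"
    using eq by (auto simp: y'_def z'_def c'_def algebra_simps)
  have "x *\<^sub>R s a \<beta> + y' *\<^sub>R s a \<gamma> + z' *\<^sub>R s a \<delta> = s a (c' *\<^sub>R a)"
    unfolding eq'[symmetric] by (simp add: refl_def B_simps algebra_simps)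
  also have "\<dots> = - c' *\<^sub>R a"
    using G_simps[OF refl_G[OF simple_root[OF assms(1)]]] refl_self[OF simple_root[OF assms(1)]] by simp
  finally have *: "x * ht (s a \<beta>) + y' * ht (s a \<gamma>) + z' * ht (s a \<delta>) = - c' * ht a"
    by (metis ht_simps(1,3) real_scaleR_def)
  have **: "x * ht \<beta> + y' * ht \<gamma> + z' * ht \<delta> = c' * ht a"
    using eq' by (metis ht_simps(1,3) real_scaleR_def)
  have "0 < ht (s a \<beta>)" "y' = 0 \<or> 0 < ht (s a \<gamma>)" "z' = 0 \<or> 0 < ht (s a \<delta>)"
    using simple_permutes[OF assms(1)] assms(2-4) \<open>\<beta> \<noteq> a\<close> by (auto simp: pos_def y'_def z'_def)
  then have "0 < x * ht (s a \<beta>) + y' * ht (s a \<gamma>) + z' * ht (s a \<delta>)"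
    using assms(5-7) by (intro add_pos_nonneg) (auto simp: y'_def z'_def)
  moreover have "0 < x * ht \<beta> + y' * ht \<gamma> + z' * ht \<delta>"
    using assms by (intro add_pos_nonneg) (auto simp: y'_def z'_def pos_def)
  ultimately show False using * ** by simp
qed

lemma simple_extreme2:
  assumes "a \<in> \<Delta>" and "\<beta> \<in> pos" "\<gamma> \<in> pos" and "0 < x" "0 \<le> y"
    and "x *\<^sub>R \<beta> + y *\<^sub>R \<gamma> = c *\<^sub>R a"
  shows "\<beta> = a"
  using simple_extreme[OF assms(1-3,3) assms(4,5), of 0 c] assms(6) by simp

section \<open>Dominance\<close>

lemma dom_refl: "dom \<beta> \<beta>" by (simp add: dom_def)

lemma dom_trans: "dom \<beta> \<gamma> \<Longrightarrow> dom \<gamma> \<delta> \<Longrightarrow> dom \<beta> \<delta>" by (simp add: dom_def)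

lemma dom_act: "g \<in> G \<Longrightarrow> dom \<beta> \<gamma> \<Longrightarrow> dom (g \<beta>) (g \<gamma>)"
  unfolding dom_def using G_comp by fastforce

lemma dom_uminus:
  assumes "\<beta> \<in> \<Phi>" "\<gamma> \<in> \<Phi>" "dom \<beta> \<gamma>"
  shows "dom (- \<gamma>) (- \<beta>)"
  unfolding dom_def
proof (intro ballI impI)
  fix g assume g: "g \<in> G" and "ht (g (- \<gamma>)) < 0"
  then have "\<not> ht (g \<gamma>) < 0" by (simp add: G_simps[OF g] ht_uminus)
  then have "\<not> ht (g \<beta>) < 0" using assms(3) g by (auto simp: dom_def)
  then show "ht (g (- \<beta>)) < 0"
    using root_neg_or_pos[OF G_root[OF g assms(1)]] by (simp add: G_simps[OF g] ht_uminus)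
qed

lemma dom_pos: "dom \<beta> \<gamma> \<Longrightarrow> \<beta> \<in> \<Phi> \<Longrightarrow> 0 < ht \<gamma> \<Longrightarrow> 0 < ht \<beta>"
  using root_neg_or_pos[of \<beta>] G_id unfolding dom_def by fastforce

text \<open>
  After a conjugation, \<open>\<gamma>\<close> is simple. The reflection in it makes no other positive root negative, so it
  can dominate no other positive root.
\<close>

lemma dom_antisym:
  assumes "\<beta> \<in> \<Phi>" "\<gamma> \<in> \<Phi>" "dom \<beta> \<gamma>" "dom \<gamma> \<beta>"
  shows "\<beta> = \<gamma>"
proof -
  obtain g where g: "g \<in> G" "g \<gamma> \<in> \<Delta>" using root_conj_simple assms(2) by blast
  have "dom (g \<beta>) (g \<gamma>)" "dom (g \<gamma>) (g \<beta>)" using dom_act g assms by auto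
  then have "0 < ht (g \<beta>)" using dom_pos[OF _ G_root[OF g(1) assms(1)] simple_pos[OF g(2)]] by blast
  moreover have "ht (s (g \<gamma>) (g \<gamma>)) < 0"
    using refl_self simple_root simple_pos g(2) by (simp add: ht_uminus)
  then have "ht (s (g \<gamma>) (g \<beta>)) < 0"
    using \<open>dom (g \<gamma>) (g \<beta>)\<close> refl_G simple_root g(2) by (auto simp: dom_def)
  ultimately have "g \<beta> = g \<gamma>"
    using simple_permutes[OF g(2) G_root[OF g(1) assms(1)]] by fastforce
  then show ?thesis using G_inj[OF g(1)] by (simp add: inj_eq)
qed

lemma chain_root:
  assumes "a \<in> \<Phi>" "b \<in> \<Phi>"
  shows "chain B a b n \<in> \<Phi> \<and> chain B a b (Suc n) \<in> \<Phi>
    \<and> B (chain B a b n) (chain B a b (Suc n)) = B a b"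
proof (induction n)
  case (Suc n)
  let ?c = "chain B a b"
  have eq: "?c (Suc (Suc n)) = - s (?c (Suc n)) (?c n)"
    using Suc by (simp add: refl_def sym_B)
  have "?c (Suc (Suc n)) \<in> \<Phi>" unfolding eq using Suc refl_root uminus_root by blast
  moreover have "B (?c (Suc n)) (?c (Suc (Suc n))) = B a b"
    using Suc by (simp add: B_simps root_norm sym_B[of "?c (Suc n)" "?c n"])
  ultimately show ?case using Suc by blast
qed (use assms in simp)

lemma chain_refl:
  assumes "a \<in> \<Phi>" "b \<in> \<Phi>"
  shows "chain B a b (Suc (Suc n)) = - s (chain B a b (Suc n)) (chain B a b n)"
  using chain_root[OF assms, of n] by (simp add: refl_def sym_B)

text \<open>
  Dominance moves along a chain: apply the reflection in the higher root, which maps the pair to the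
  negatives of the next pair in reverse order.
\<close>

lemma chain_dom:
  assumes "a \<in> \<Phi>" "b \<in> \<Phi>" "dom b a"
  shows "dom (chain B a b (Suc n)) (chain B a b n)"
proof (induction n)
  case (Suc n)
  let ?c = "chain B a b"
  have r: "?c n \<in> \<Phi>" "?c (Suc n) \<in> \<Phi>" using chain_root[OF assms(1,2)] by blast+
  have "dom (s (?c (Suc n)) (?c (Suc n))) (s (?c (Suc n)) (?c n))"
    using dom_act[OF refl_G] r Suc by blast
  then have "dom (- ?c (Suc n)) (- ?c (Suc (Suc n)))"
    using refl_self[OF r(2)] chain_refl[OF assms(1,2), of n] by simp
  then show ?case using dom_uminus r uminus_root chain_root[OF assms(1,2)] by (metis add.inverse_inverse)
qed (use assms in simp)

lemma chain_map:
  assumes "linear f"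
  shows "f (chain B a b (Suc (Suc n))) = (2 * B a b) *\<^sub>R f (chain B a b (Suc n)) - f (chain B a b n)"
  using assms by (simp add: linear_diff linear_scale)

lemma ht_comp_linear: "g \<in> G \<Longrightarrow> linear (\<lambda>v. ht (g v))"
  using linear_compose[OF G_linear ht_linear] by (simp add: o_def)

lemma ht_chain:
  assumes "g \<in> G"
  shows "ht (g (chain B a b (Suc (Suc n)))) = 2 * B a b * ht (g (chain B a b (Suc n))) - ht (g (chain B a b n))"
  using chain_map[OF ht_comp_linear[OF assms]] by simp

lemma ht_chain_id:
  "ht (chain B a b (Suc (Suc n))) = 2 * B a b * ht (chain B a b (Suc n)) - ht (chain B a b n)"
  using ht_chain[OF G_id] by simp

text \<open>
  If \<open>g\<close> makes \<open>\<beta>\<close> negative but not \<open>\<gamma>\<close>, then along the chain starting with \<open>\<gamma>\<close>, \<open>\<beta>\<close> the height stays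
  positive, while the height of the images under \<open>g\<close> stays negative and strictly decreases.
  Thus \<open>g\<close> would make infinitely many positive roots negative.
\<close>

lemma dom_by_height:
  assumes "\<beta> \<in> pos" "\<gamma> \<in> pos" "1 \<le> B \<beta> \<gamma>" "ht \<gamma> \<le> ht \<beta>"
  shows "dom \<beta> \<gamma>"
proof (rule ccontr)
  assume "\<not> dom \<beta> \<gamma>"
  then obtain g where g: "g \<in> G" "ht (g \<beta>) < 0" "\<not> ht (g \<gamma>) < 0" by (auto simp: dom_def)
  let ?c = "chain B \<gamma> \<beta>"
  have B: "1 \<le> B \<gamma> \<beta>" using assms(3) sym_B by simp
  have r: "?c n \<in> \<Phi>" for n using chain_root posD assms by blast
  have up: "0 < ht (?c (Suc n))" for n
    using recurrence_mono[where x = "\<lambda>n. ht (?c n)", OF ht_chain_id B] assms posD by auto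
  have down: "strict_mono (\<lambda>n. - ht (g (?c n)))" "0 < - ht (g (?c (Suc n)))" for n
    using recurrence_strict_mono[where x = "\<lambda>n. - ht (g (?c n))" and b = "B \<gamma> \<beta>"] ht_chain[OF g(1), of \<gamma> \<beta>] B g(2,3)
    by auto
  have "inj (\<lambda>n. ?c (Suc n))"
    using strict_mono_eq[OF down(1)] by (intro injI) (metis nat.inject)
  moreover have "range (\<lambda>n. ?c (Suc n)) \<subseteq> neg_set g"
    using up down(2) r posI by (force simp: neg_set_def)
  ultimately show False
    using finite_neg_set[OF g(1)] range_inj_infinite finite_subset by blast
qed

text \<open>
  By dominance, positivity of one root of the chain starting with \<open>\<gamma>\<close>, \<open>\<beta>\<close> implies positivity of the
  next one; for a pairing below 1 the heights cannot remain positive.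
\<close>

lemma dom_imp_B:
  assumes "\<beta> \<in> pos" "\<gamma> \<in> pos" "dom \<beta> \<gamma>"
  shows "1 \<le> B \<beta> \<gamma>"
proof (rule ccontr)
  assume "\<not> 1 \<le> B \<beta> \<gamma>"
  then have lt: "B \<gamma> \<beta> < 1" using sym_B by simp
  let ?c = "chain B \<gamma> \<beta>"
  have "0 < ht (?c n)" for n
  proof (induction n)
    case (Suc n)
    then show ?case
      using chain_dom[of \<gamma> \<beta> n] chain_root[of \<gamma> \<beta> n] dom_pos assms posD by metis
  qed (use assms posD in simp)
  then show False using recurrence_not_pos[where x = "\<lambda>n. ht (?c n)", OF ht_chain_id lt] by blast
qed

lemma dom_total:
  assumes "\<beta> \<in> pos" "\<gamma> \<in> pos" "1 \<le> B \<beta> \<gamma>"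
  shows "dom \<beta> \<gamma> \<or> dom \<gamma> \<beta>"
  using dom_by_height[of \<beta> \<gamma>] dom_by_height[of \<gamma> \<beta>] assms sym_B by (metis linear)

lemma dom_ht_less:
  assumes "\<beta> \<in> pos" "\<gamma> \<in> pos" "dom \<beta> \<gamma>" "\<beta> \<noteq> \<gamma>"
  shows "ht \<gamma> < ht \<beta>"
proof (rule ccontr)
  assume "\<not> ht \<gamma> < ht \<beta>"
  then have "dom \<gamma> \<beta>"
    using dom_by_height[of \<gamma> \<beta>] dom_imp_B[OF assms(1-3)] assms sym_B by auto
  then show False using dom_antisym assms posD by blast
qed

text \<open>
  The root that precedes \<open>\<gamma>\<close>, \<open>\<beta>\<close> in their chain is dominated by \<open>\<gamma>\<close>, hence lower than \<open>\<gamma>\<close>; the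
  recurrence turns this into a lower bound for the height of \<open>\<beta>\<close>.
\<close>

lemma dom_ht_bound:
  assumes "\<beta> \<in> pos" "\<gamma> \<in> pos" "dom \<beta> \<gamma>" "\<beta> \<noteq> \<gamma>"
  shows "B \<beta> \<gamma> * ht \<gamma> < ht \<beta>"
proof -
  let ?b = "B \<beta> \<gamma>" and ?\<eta> = "- s \<gamma> \<beta>"
  have b: "1 \<le> ?b" using dom_imp_B assms by blast
  have \<beta>: "\<beta> \<in> \<Phi>" and \<gamma>: "\<gamma> \<in> \<Phi>" "0 < ht \<gamma>" using assms posD by auto
  have \<eta>: "?\<eta> \<in> \<Phi>" using \<beta> \<gamma> refl_root uminus_root by blast
  have ht\<eta>: "ht ?\<eta> = 2 * ?b * ht \<gamma> - ht \<beta>" by (simp add: refl_def ht_simps sym_B)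
  have "dom (s \<gamma> \<beta>) (- \<gamma>)" using dom_act[OF refl_G[OF \<gamma>(1)] assms(3)] refl_self[OF \<gamma>(1)] by simp
  then have d: "dom \<gamma> ?\<eta>" using dom_uminus \<beta> \<gamma> refl_root uminus_root by (metis add.inverse_inverse)
  have "ht ?\<eta> < ht \<gamma>"
  proof (cases "0 < ht ?\<eta>")
    case True
    have "\<gamma> \<noteq> ?\<eta>"
    proof
      assume "\<gamma> = ?\<eta>"
      then have "- \<gamma> = s \<gamma> \<beta>" by (metis add.inverse_inverse)
      then have "s \<gamma> \<gamma> = s \<gamma> \<beta>" using refl_self[OF \<gamma>(1)] by simp
      then show False using refl_refl[OF \<gamma>(1)] assms(4) by metis
    qed
    then show ?thesis using dom_ht_less[OF assms(2) posI[OF \<eta> True] d] by simp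
  qed (use \<gamma> in simp)
  moreover have "1 * ht \<gamma> \<le> ?b * ht \<gamma>" using b \<gamma> by (intro mult_right_mono) auto
  ultimately show ?thesis using ht\<eta> by simp
qed

text \<open>
  The sum of the heights of \<open>g \<gamma>\<close> and \<open>g (s \<beta> \<gamma>)\<close> does not change when \<open>g\<close> is replaced by its composite
  with the reflection in \<open>\<beta>\<close>; one of the two choices makes \<open>\<beta>\<close> positive. The next two lemmas determine
  the sign of this sum from the direction of dominance. They are applied to averages of the
  height over a group of isometries.
\<close>

lemma pair_sum_wlog:
  assumes "\<beta> \<in> \<Phi>" "g \<in> G"
  obtains g' where "g' \<in> G" "0 < ht (g' \<beta>)"
    "ht (g \<gamma>) + ht (g (s \<beta> \<gamma>)) = 2 * (ht (g' \<gamma>) - B \<beta> \<gamma> * ht (g' \<beta>))"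
proof -
  have sum: "ht (g (s \<beta> \<gamma>)) = ht (g \<gamma>) - 2 * (B \<beta> \<gamma> * ht (g \<beta>))"
    by (simp add: refl_def G_simps[OF assms(2)] ht_simps)
  show ?thesis
  proof (cases "0 < ht (g \<beta>)")
    case True
    then show ?thesis using that[OF assms(2)] sum by simp
  next
    case False
    have "g \<circ> s \<beta> \<in> G" using assms refl_G G_comp by blast
    moreover have e: "ht ((g \<circ> s \<beta>) \<beta>) = - ht (g \<beta>)"
      using refl_self[OF assms(1)] by (simp add: G_simps[OF assms(2)] ht_uminus)
    moreover have "0 < - ht (g \<beta>)" using False root_neg_or_pos[OF G_root[OF assms(2,1)]] by simp
    ultimately show ?thesis using that[of "g \<circ> s \<beta>"] sum by simp
  qed
qed

lemma dominated_pair_sum_neg: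
  assumes "\<beta> \<in> pos" "\<gamma> \<in> pos" "dom \<beta> \<gamma>" "\<beta> \<noteq> \<gamma>" and "g \<in> G"
  shows "ht (g \<gamma>) + ht (g (s \<beta> \<gamma>)) < 0"
proof -
  have b: "1 \<le> B \<beta> \<gamma>" using dom_imp_B assms by blast
  have r: "\<beta> \<in> \<Phi>" "\<gamma> \<in> \<Phi>" using assms posD by auto
  obtain g' where g: "g' \<in> G" and p: "0 < ht (g' \<beta>)"
    and sum: "ht (g \<gamma>) + ht (g (s \<beta> \<gamma>)) = 2 * (ht (g' \<gamma>) - B \<beta> \<gamma> * ht (g' \<beta>))"
    using pair_sum_wlog[OF r(1) assms(5)] .
  have "1 * ht (g' \<beta>) \<le> B \<beta> \<gamma> * ht (g' \<beta>)" using b p by (intro mult_right_mono) auto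
  moreover have "ht (g' \<gamma>) < ht (g' \<beta>)"
  proof (cases "0 < ht (g' \<gamma>)")
    case True
    then show ?thesis
      using dom_ht_less[OF posI posI dom_act] p g r assms G_root G_inj[OF g] by (metis inj_eq)
  qed (use p in simp)
  ultimately show ?thesis using sum by simp
qed

lemma dominating_pair_sum_pos:
  assumes "\<beta> \<in> pos" "\<gamma> \<in> pos" "dom \<gamma> \<beta>" "\<beta> \<noteq> \<gamma>" and "g \<in> G"
  shows "0 < ht (g \<gamma>) + ht (g (s \<beta> \<gamma>))"
proof -
  have r: "\<beta> \<in> \<Phi>" "\<gamma> \<in> \<Phi>" using assms posD by auto
  obtain g' where g: "g' \<in> G" and p: "0 < ht (g' \<beta>)"
    and sum: "ht (g \<gamma>) + ht (g (s \<beta> \<gamma>)) = 2 * (ht (g' \<gamma>) - B \<beta> \<gamma> * ht (g' \<beta>))"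
    using pair_sum_wlog[OF r(1) assms(5)] .
  have d: "dom (g' \<gamma>) (g' \<beta>)" using dom_act g assms by blast
  then have "0 < ht (g' \<gamma>)" using dom_pos p G_root[OF g r(2)] by blast
  then have "B (g' \<gamma>) (g' \<beta>) * ht (g' \<beta>) < ht (g' \<gamma>)"
    using dom_ht_bound[OF posI posI d] p G_root[OF g] r assms(4) G_inj[OF g] by (metis inj_eq)
  moreover have "B (g' \<gamma>) (g' \<beta>) = B \<beta> \<gamma>" using G_isometry[OF g] sym_B by metis
  ultimately show ?thesis using sum by simp
qed

end

section \<open>Finite dihedral subsystems\<close>

text \<open>
  The Chebyshev polynomials of the second kind, shifted by one index: \<open>cheb (cos \<theta>) n\<close> is
  \<open>sin (n \<theta>) / sin \<theta>\<close>.  They are the coordinates of the roots of a dihedral subsystem.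
\<close>

fun cheb :: "real \<Rightarrow> nat \<Rightarrow> real"
  where
    "cheb \<kappa> 0 = 0"
  | "cheb \<kappa> (Suc 0) = 1"
  | "cheb \<kappa> (Suc (Suc n)) = 2 * \<kappa> * cheb \<kappa> (Suc n) - cheb \<kappa> n"

lemma chain_cheb:
  "chain B (- a) b (Suc n) = cheb (B (- a) b) (Suc n) *\<^sub>R b + cheb (B (- a) b) n *\<^sub>R a"
proof -
  let ?k = "B (- a) b"
  have "chain B (- a) b (Suc n) = cheb ?k (Suc n) *\<^sub>R b + cheb ?k n *\<^sub>R a
    \<and> chain B (- a) b (Suc (Suc n)) = cheb ?k (Suc (Suc n)) *\<^sub>R b + cheb ?k (Suc n) *\<^sub>R a"
  proof (induction n)
    case (Suc n)
    have "chain B (- a) b (Suc (Suc (Suc n))) = (2 * ?k) *\<^sub>R chain B (- a) b (Suc (Suc n)) - chain B (- a) b (Suc n)"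
      by simp
    also have "\<dots> = (2 * ?k) *\<^sub>R (cheb ?k (Suc (Suc n)) *\<^sub>R b + cheb ?k (Suc n) *\<^sub>R a)
        - (cheb ?k (Suc n) *\<^sub>R b + cheb ?k n *\<^sub>R a)"
      using Suc by (simp only:)
    also have "\<dots> = cheb ?k (Suc (Suc (Suc n))) *\<^sub>R b + cheb ?k (Suc (Suc n)) *\<^sub>R a"
      by (simp add: algebra_simps)
    finally show ?case using Suc by blast
  qed simp
  then show ?thesis by blast
qed

text \<open>
  The assumptions on \<open>cheb\<close> say that \<open>\<kappa> = cos (\<pi> / m)\<close>.  Then \<open>a\<close> and \<open>b\<close> are the canonical generators of
  a dihedral subsystem with \<open>m\<close> positive roots.  In angular order they are \<open>d 1 = b\<close>, ..., \<open>d m = a\<close>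
  for the chain \<open>d\<close> below.
\<close>

locale finite_dihedral = root_system +
  fixes a b :: 'a and \<kappa> :: real and m :: nat
  assumes a: "a \<in> \<Delta>" and b: "b \<in> pos"
    and kappa: "B a b = - \<kappa>" "0 < \<kappa>" "\<kappa> < 1"
    and cheb_pos: "\<And>j. 0 < j \<Longrightarrow> j < m \<Longrightarrow> 0 < cheb \<kappa> j"
    and cheb_m: "cheb \<kappa> m = 0" and m_pos: "0 < m"
begin

text \<open>
  The chain starts with \<open>- a\<close> in order that \<open>b\<close> is followed by the roots between \<open>b\<close> and \<open>a\<close>.
\<close>

abbreviation d :: "nat \<Rightarrow> 'a" where "d \<equiv> chain B (- a) b"

lemma roots: "a \<in> \<Phi>" "b \<in> \<Phi>" "a \<in> pos" "0 < ht a" "0 < ht b"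
  using a b simple_root simple_pos posD posI by auto

lemma Bvals: "B a b = - \<kappa>" "B b a = - \<kappa>" "B a a = 1" "B b b = 1" "B (- a) b = \<kappa>"
  using kappa sym_B[of b a] roots root_norm by (simp_all add: B_simps)

lemma d_Suc: "d (Suc n) = cheb \<kappa> (Suc n) *\<^sub>R b + cheb \<kappa> n *\<^sub>R a"
  using chain_cheb[of B a b n] Bvals by simp

lemma d_rec: "d (Suc (Suc n)) = (2 * \<kappa>) *\<^sub>R d (Suc n) - d n"
  by (simp add: Bvals)

declare chain.simps(3) [simp del]

lemma d_root: "d n \<in> \<Phi>"
  using chain_root[of "- a" b] roots uminus_root by blast

lemma m_ge_3: "3 \<le> m"
proof -
  have "m \<noteq> 1" "m \<noteq> 2" using cheb_m kappa by (auto simp: numeral_2_eq_2)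
  then show ?thesis using m_pos by linarith
qed

lemma cheb_m_minus: "cheb \<kappa> (m - 1) = 1"
proof -
  obtain n where m: "m = Suc n" using m_pos gr0_conv_Suc by blast
  then have n: "m = Suc n" "0 < n" using m_ge_3 by auto
  have "d m = cheb \<kappa> n *\<^sub>R a" using d_Suc[of n] cheb_m n by simp
  then have "(cheb \<kappa> n)\<^sup>2 = 1" using root_norm[OF d_root[of m]] by (simp add: B_simps Bvals power2_eq_square)
  moreover have "0 < cheb \<kappa> n" using cheb_pos n by simp
  ultimately show ?thesis using n by (simp add: power2_eq_1_iff)
qed

lemma d_m: "d m = a"
proof -
  obtain n where n: "m = Suc n" using m_pos gr0_conv_Suc by blast
  then show ?thesis using d_Suc[of n] cheb_m cheb_m_minus by simp
qed

lemma d_Suc_m: "d (Suc m) = - b"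
proof -
  obtain n where n: "m = Suc n" using m_pos gr0_conv_Suc by blast
  then show ?thesis using d_Suc[of m] cheb_m cheb_m_minus by simp
qed

lemma d_add_m: "d (m + j) = - d j \<and> d (m + Suc j) = - d (Suc j)"
proof (induction j)
  case 0
  then show ?case using d_m d_Suc_m by simp
next
  case (Suc j)
  then show ?case using d_rec[of "m + j"] d_rec[of j] by simp
qed

lemma d_period: "d (j + 2 * m) = d j"
proof -
  have eq: "j + 2 * m = m + (m + j)" by simp
  have "d (m + (m + j)) = - d (m + j)" "d (m + j) = - d j" using d_add_m by blast+
  then show ?thesis unfolding eq by simp
qed

lemma sa_linear: "linear (s a)" and sb_linear: "linear (s b)"
  using G_linear refl_G roots by blast+

lemmas s_simps = linear_add[OF sa_linear] linear_diff[OF sa_linear] linear_scale[OF sa_linear] linear_neg[OF sa_linear]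
  linear_add[OF sb_linear] linear_diff[OF sb_linear] linear_scale[OF sb_linear] linear_neg[OF sb_linear]

lemma s_vals: "s a a = - a" "s b b = - b" "s a b = b + (2 * \<kappa>) *\<^sub>R a" "s b a = a + (2 * \<kappa>) *\<^sub>R b"
  using refl_self[OF roots(1)] refl_self[OF roots(2)] by (simp_all only: refl_def Bvals) simp_all

lemma d_2: "d (Suc (Suc 0)) = s b a"
  by (simp add: d_rec s_vals)

lemma d_below_m: "d (m - 1) = s a b"
proof -
  obtain n where n: "m = Suc n" using m_pos gr0_conv_Suc by blast
  then have "d (Suc m) = (2 * \<kappa>) *\<^sub>R d m - d n" using d_rec[of n] by simp
  then show ?thesis using d_m d_Suc_m n by (simp add: s_vals algebra_simps)
qed

text \<open>
  The two reflections reverse the angular order of the roots of the plane.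
\<close>

lemma sa_d: "Suc j \<le> m \<Longrightarrow> s a (d j) = d (m - j) \<and> s a (d (Suc j)) = d (m - Suc j)"
proof (induction j)
  case 0
  then show ?case using d_m d_below_m by (simp add: s_simps s_vals)
next
  case (Suc j)
  then have eq: "m - j = Suc (Suc (m - Suc (Suc j)))" "m - Suc j = Suc (m - Suc (Suc j))" by auto
  have "s a (d (Suc (Suc j))) = (2 * \<kappa>) *\<^sub>R d (m - Suc j) - d (m - j)"
    using Suc by (simp add: d_rec s_simps)
  also have "\<dots> = d (m - Suc (Suc j))"
    using d_rec[of "m - Suc (Suc j)"] eq by simp
  finally show ?case using Suc by simp
qed

lemma sb_d: "Suc j \<le> m \<Longrightarrow> s b (d (Suc j)) = d (Suc m - j) \<and> s b (d (Suc (Suc j))) = d (m - j)"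
proof (induction j)
  case 0
  then show ?case using d_m d_Suc_m refl_refl[OF roots(2)] by (simp add: s_simps s_vals d_2)
next
  case (Suc j)
  then have eq: "Suc m - j = Suc (Suc (m - Suc j))" "m - j = Suc (m - Suc j)" by auto
  have "s b (d (Suc (Suc (Suc j)))) = (2 * \<kappa>) *\<^sub>R d (m - j) - d (Suc m - j)"
    using Suc by (simp add: d_rec[of "Suc j"] s_simps)
  also have "\<dots> = d (m - Suc j)"
    using d_rec[of "m - Suc j"] eq by simp
  finally show ?case using Suc eq by simp
qed

definition rot :: "'a \<Rightarrow> 'a" where "rot = s a \<circ> s b"

lemma rot_G: "rot \<in> G" unfolding rot_def using G_comp refl_G roots by blast

lemma rot_pow_G: "rot ^^ i \<in> G"
proof (induction i)
  case (Suc i)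
  then show ?case unfolding funpow.simps by (rule G_comp[OF rot_G])
qed (use G_id in \<open>simp add: id_def\<close>)

lemma rot_d: "rot (d (Suc (Suc j))) = d j \<and> rot (d (Suc (Suc (Suc j)))) = d (Suc j)"
proof (induction j)
  case 0
  then show ?case using refl_refl[OF roots(2)] by (simp add: rot_def d_2 d_rec s_simps s_vals)
next
  case (Suc j)
  have "rot (d (Suc (Suc (Suc (Suc j))))) = (2 * \<kappa>) *\<^sub>R d (Suc j) - d j"
    using Suc G_simps[OF rot_G] by (subst d_rec) simp
  then show ?case using Suc d_rec by simp
qed

lemma rot_pow_d: "(rot ^^ i) (d (j + 2 * i)) = d j"
  by (induction i) (use rot_d in \<open>auto simp: funpow_Suc_right simp del: funpow.simps(2)\<close>)

text \<open>
  The rotation permutes the chain periodically, and it fixes the orthogonal complement of the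
  plane; as \<open>\<kappa> < 1\<close>, the form is nondegenerate on the plane, and every vector is a sum of these two
  parts.
\<close>

lemma rot_order: "(rot ^^ m) v = v"
proof -
  define p r where "p = B v a" and "r = B v b"
  \<comment> \<open>Coordinates of the orthogonal projection of \<open>v\<close> to the plane.\<close>
  define x y where "x = (p + \<kappa> * r) / (1 - \<kappa>\<^sup>2)" and "y = (r + \<kappa> * p) / (1 - \<kappa>\<^sup>2)"
  define q where "q = v - x *\<^sub>R a - y *\<^sub>R b"
  have nz: "1 - \<kappa>\<^sup>2 \<noteq> 0" using kappa by (simp add: power2_eq_1_iff)
  have e: "(1 - \<kappa>\<^sup>2) * x = p + \<kappa> * r" "(1 - \<kappa>\<^sup>2) * y = r + \<kappa> * p"
    using nz by (simp_all add: x_def y_def)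
  have t: "(1 - \<kappa>\<^sup>2) * (u - \<kappa> * v) = (1 - \<kappa>\<^sup>2) * u - \<kappa> * ((1 - \<kappa>\<^sup>2) * v)" for u v
    by (simp add: algebra_simps)
  have "(1 - \<kappa>\<^sup>2) * (x - \<kappa> * y) = (1 - \<kappa>\<^sup>2) * p" "(1 - \<kappa>\<^sup>2) * (y - \<kappa> * x) = (1 - \<kappa>\<^sup>2) * r"
    unfolding t e by (simp_all add: power2_eq_square algebra_simps)
  then have "x - \<kappa> * y = p" "y - \<kappa> * x = r" using nz by simp_all
  then have "B q a = 0" "B q b = 0"
    unfolding q_def by (simp_all add: B_simps Bvals p_def r_def algebra_simps)
  then have "rot q = q" using sym_B[of a q] sym_B[of b q] by (simp add: rot_def refl_def)
  then have q: "(rot ^^ i) q = q" for i by (induction i) auto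
  have "(rot ^^ m) (d j) = d j" for j using rot_pow_d[of m j] d_period by simp
  then have "(rot ^^ m) (- a) = - a" "(rot ^^ m) b = b" by (metis chain.simps(1), metis chain.simps(2))
  then have "(rot ^^ m) (q + x *\<^sub>R a + y *\<^sub>R b) = q + x *\<^sub>R a + y *\<^sub>R b"
    using q by (simp add: G_simps[OF rot_pow_G])
  then show ?thesis by (simp add: q_def)
qed

section \<open>The averaged height\<close>

text \<open>
  The sum of the height over the \<open>2 m\<close> elements of the dihedral group generated by the reflections in
  \<open>a\<close> and \<open>b\<close>.  It is invariant under this group and therefore vanishes on the plane.
\<close>

definition \<phi> :: "'a \<Rightarrow> real"
  where "\<phi> v = (\<Sum>i<m. ht ((rot ^^ i) v) + ht ((rot ^^ i) (s a v)))"

lemma phi_linear: "linear \<phi>"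
  unfolding \<phi>_def
proof (intro linear_compose_sum ballI linear_compose_add)
  fix i
  show "linear (\<lambda>v. ht ((rot ^^ i) v))" using ht_comp_linear[OF rot_pow_G] .
  have "rot ^^ i \<circ> s a \<in> G" using rot_pow_G refl_G roots G_comp by blast
  from ht_comp_linear[OF this] show "linear (\<lambda>v. ht ((rot ^^ i) (s a v)))" by simp
qed

lemmas phi_simps = linear_add[OF phi_linear] linear_diff[OF phi_linear] linear_scale[OF phi_linear]
  linear_neg[OF phi_linear] linear_0[OF phi_linear]

lemma phi_sa: "\<phi> (s a v) = \<phi> v"
  using refl_refl[OF roots(1)] by (simp add: \<phi>_def add.commute)

lemma sum_shift: "f m = f 0 \<Longrightarrow> (\<Sum>i<m. f (Suc i)) = (\<Sum>i<m. f i)" for f :: "nat \<Rightarrow> real"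
  by (metis add.commute add_diff_cancel_left' lessThan_Suc_atMost sum.lessThan_Suc sum.lessThan_Suc_shift)

lemma phi_sb: "\<phi> (s b v) = \<phi> v"
proof -
  have 1: "s a (s b v) = rot v" "rot (s b v) = s a v"
    using refl_refl[OF roots(2)] by (auto simp: rot_def)
  have "(\<Sum>i<m. ht ((rot ^^ i) (s a (s b v)))) = (\<Sum>i<m. ht ((rot ^^ Suc i) v))"
    unfolding 1 by (simp add: funpow_Suc_right del: funpow.simps(2))
  also have "\<dots> = (\<Sum>i<m. ht ((rot ^^ i) v))"
    by (rule sum_shift) (use rot_order in simp)
  finally have A: "(\<Sum>i<m. ht ((rot ^^ i) (s a (s b v)))) = (\<Sum>i<m. ht ((rot ^^ i) v))" .
  have "(\<Sum>i<m. ht ((rot ^^ i) (s b v))) = (\<Sum>i<m. ht ((rot ^^ Suc i) (s b v)))"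
    by (rule sum_shift[symmetric]) (use rot_order in simp)
  also have "\<dots> = (\<Sum>i<m. ht ((rot ^^ i) (s a v)))"
    using 1 by (simp add: funpow_Suc_right del: funpow.simps(2))
  finally show ?thesis unfolding \<phi>_def sum.distrib using A by simp
qed

lemma phi_a: "\<phi> a = 0" and phi_b: "\<phi> b = 0"
  using phi_sa[of a] phi_sb[of b] by (simp_all add: s_vals phi_simps)

lemma phi_d: "\<phi> (d j) = 0"
  by (cases j) (simp_all add: d_Suc phi_simps phi_a phi_b)

text \<open>
  A root of \<open>M\<close> is made negative by some element of the dihedral group; this is why \<open>M\<close> is finite.
\<close>

definition M :: "'a set" where "M = {\<delta> \<in> pos. \<phi> \<delta> < 0}"

lemma finite_M: "finite M"
proof (rule finite_subset)
  show "finite (\<Union>i<m. neg_set (rot ^^ i) \<union> neg_set (rot ^^ i \<circ> s a))"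
    using finite_neg_set rot_pow_G refl_G roots G_comp by auto
  show "M \<subseteq> (\<Union>i<m. neg_set (rot ^^ i) \<union> neg_set (rot ^^ i \<circ> s a))"
  proof
    fix \<delta> assume "\<delta> \<in> M"
    then have \<delta>: "\<delta> \<in> pos" "\<phi> \<delta> < 0" by (auto simp: M_def)
    show "\<delta> \<in> (\<Union>i<m. neg_set (rot ^^ i) \<union> neg_set (rot ^^ i \<circ> s a))"
    proof (rule ccontr)
      assume "\<not> ?thesis"
      then have "0 \<le> ht ((rot ^^ i) \<delta>) + ht ((rot ^^ i) (s a \<delta>))" if "i < m" for i
        using that \<delta> by (intro add_nonneg_nonneg) (auto simp: neg_set_def not_less)
      then have "0 \<le> \<phi> \<delta>" unfolding \<phi>_def by (intro sum_nonneg) auto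
      then show False using \<delta> by simp
    qed
  qed
qed

text \<open>
  For \<open>\<gamma>\<close> in the plane, \<open>\<delta>\<close> may be averaged with its reflection in \<open>\<gamma>\<close>, which brings in the sums
  whose sign is determined by dominance between \<open>\<gamma>\<close> and \<open>\<delta>\<close>.
\<close>

lemma phi_pair:
  assumes "\<phi> \<gamma> = 0"
  shows "2 * \<phi> \<delta> = (\<Sum>i<m. (ht ((rot ^^ i) \<delta>) + ht ((rot ^^ i) (s \<gamma> \<delta>)))
    + (ht ((rot ^^ i \<circ> s a) \<delta>) + ht ((rot ^^ i \<circ> s a) (s \<gamma> \<delta>))))"
proof -
  have "\<phi> (s \<gamma> \<delta>) = \<phi> \<delta>" using assms by (simp add: refl_def phi_simps)
  then have "2 * \<phi> \<delta> = \<phi> \<delta> + \<phi> (s \<gamma> \<delta>)" by simp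
  then show ?thesis by (simp add: \<phi>_def sum.distrib algebra_simps)
qed

lemma phi_neg_of_dominated:
  assumes "\<gamma> \<in> pos" "\<phi> \<gamma> = 0" "\<delta> \<in> pos" "dom \<gamma> \<delta>" "\<gamma> \<noteq> \<delta>"
  shows "\<delta> \<in> M"
proof -
  have neg: "(ht (g \<delta>) + ht (g (s \<gamma> \<delta>))) < 0" if "g \<in> G" for g
    using dominated_pair_sum_neg assms that by blast
  have "(ht ((rot ^^ i) \<delta>) + ht ((rot ^^ i) (s \<gamma> \<delta>)))
    + (ht ((rot ^^ i \<circ> s a) \<delta>) + ht ((rot ^^ i \<circ> s a) (s \<gamma> \<delta>))) < 0" for i
    by (rule add_neg_neg[OF neg[OF rot_pow_G] neg[OF G_comp[OF rot_pow_G refl_G[OF roots(1)]]]])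
  then have "2 * \<phi> \<delta> < (\<Sum>i<m. 0)" unfolding phi_pair[OF assms(2)]
    using m_pos by (intro sum_strict_mono) auto
  then show ?thesis using assms by (simp add: M_def)
qed

section \<open>Small roots in a finite dihedral subsystem\<close>

text \<open>
  Among positive roots of the plane, these are the roots that dominate a member of \<open>M\<close>.
\<close>

definition above_M :: "'a \<Rightarrow> bool" where "above_M \<gamma> \<longleftrightarrow> (\<exists>\<delta>\<in>M. 1 \<le> B \<delta> \<gamma>)"

text \<open>
  A pairing of at least 1 means dominance in one of the two directions, and a root that dominates a root of
  the plane has \<open>\<phi> > 0\<close>.
\<close>

lemma above_M_not_small:
  assumes "\<gamma> \<in> pos" "\<phi> \<gamma> = 0" "above_M \<gamma>"
  shows "\<gamma> \<notin> small"
proof -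
  obtain \<delta> where \<delta>: "\<delta> \<in> pos" "\<phi> \<delta> < 0" "1 \<le> B \<delta> \<gamma>" using assms(3) by (auto simp: above_M_def M_def)
  have ne: "\<gamma> \<noteq> \<delta>" using assms \<delta> by auto
  have "\<not> dom \<delta> \<gamma>"
  proof
    assume "dom \<delta> \<gamma>"
    then have pos: "0 < (ht (g \<delta>) + ht (g (s \<gamma> \<delta>)))" if "g \<in> G" for g
      using dominating_pair_sum_pos[OF assms(1) \<delta>(1) _ ne that] by blast
    have "0 < (ht ((rot ^^ i) \<delta>) + ht ((rot ^^ i) (s \<gamma> \<delta>)))
      + (ht ((rot ^^ i \<circ> s a) \<delta>) + ht ((rot ^^ i \<circ> s a) (s \<gamma> \<delta>)))" for i
      by (rule add_pos_pos[OF pos[OF rot_pow_G] pos[OF G_comp[OF rot_pow_G refl_G[OF roots(1)]]]])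
    then have "(\<Sum>i<m. 0) < 2 * \<phi> \<delta>" unfolding phi_pair[OF assms(2)]
      using m_pos by (intro sum_strict_mono) auto
    then show False using \<delta> by simp
  qed
  then have "dom \<gamma> \<delta>" using dom_total[OF \<delta>(1) assms(1) \<delta>(3)] by blast
  then show ?thesis using \<delta> ne assms by (auto simp: small_def)
qed

lemma MD: "\<delta> \<in> M \<Longrightarrow> \<delta> \<in> \<Phi>" "\<delta> \<in> M \<Longrightarrow> \<delta> \<in> pos" "\<delta> \<in> M \<Longrightarrow> 0 < ht \<delta>" "\<delta> \<in> M \<Longrightarrow> \<phi> \<delta> < 0"
  by (auto simp: M_def pos_def)

lemma MI: "\<delta> \<in> \<Phi> \<Longrightarrow> 0 < ht \<delta> \<Longrightarrow> \<phi> \<delta> < 0 \<Longrightarrow> \<delta> \<in> M"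
  by (auto simp: M_def pos_def)

lemma neg_posI: "\<beta> \<in> \<Phi> \<Longrightarrow> \<not> 0 < ht \<beta> \<Longrightarrow> - \<beta> \<in> pos"
  using root_neg_or_pos[of \<beta>] uminus_root by (intro posI) (auto simp: ht_uminus)

text \<open>
  A reflection that raises \<open>\<gamma>\<close> keeps it above \<open>M\<close>. If the witness \<open>\<delta>\<close> pairs nonnegatively with \<open>j\<close>, it
  still serves for \<open>s j \<gamma>\<close>; otherwise \<open>s j \<delta>\<close> is higher than \<open>\<delta>\<close>, hence in \<open>M\<close>, and serves.
\<close>

lemma above_M_raise:
  assumes "above_M \<gamma>" "j \<in> pos" "\<phi> j = 0" "B \<gamma> j \<le> 0"
  shows "above_M (s j \<gamma>)"
proof -
  obtain \<delta> where \<delta>: "\<delta> \<in> M" "1 \<le> B \<delta> \<gamma>" using assms(1) by (auto simp: above_M_def)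
  show ?thesis
  proof (cases "0 \<le> B \<delta> j")
    case True
    have "B \<delta> (s j \<gamma>) = B \<delta> \<gamma> + 2 * ((- B \<gamma> j) * B \<delta> j)"
      by (simp add: refl_def B_simps sym_B[of j \<gamma>])
    moreover have "0 \<le> (- B \<gamma> j) * B \<delta> j" using True assms by (intro mult_nonneg_nonneg) auto
    ultimately have "1 \<le> B \<delta> (s j \<gamma>)" using \<delta> by linarith
    then show ?thesis using \<delta> by (auto simp: above_M_def)
  next
    case False
    have "ht (s j \<delta>) = ht \<delta> + 2 * ((- B \<delta> j) * ht j)"
      by (simp add: refl_def ht_simps sym_B[of j \<delta>])
    moreover have "0 \<le> (- B \<delta> j) * ht j" using False posD(2)[OF assms(2)] by (intro mult_nonneg_nonneg) auto
    ultimately have "0 < ht (s j \<delta>)" using MD \<delta> by smt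
    moreover have "\<phi> (s j \<delta>) < 0" using assms MD \<delta> by (simp add: refl_def phi_simps)
    ultimately have "s j \<delta> \<in> M"
      by (rule MI[OF refl_root[OF posD(1)[OF assms(2)] MD(1)[OF \<delta>(1)]]])
    moreover have "B (s j \<delta>) (s j \<gamma>) = B \<delta> \<gamma>"
      using G_isometry[OF refl_G[OF posD(1)[OF assms(2)]]] by simp
    ultimately show ?thesis using \<delta>(2) unfolding above_M_def by (intro bexI[of _ "s j \<delta>"]) simp_all
  qed
qed

text \<open>
  Suppose that no root of \<open>M\<close> of the form \<open>p *\<^sub>R \<zeta> + q *\<^sub>R j\<close> is closer to the plane than \<open>\<zeta>\<close>.
  If the pairing of \<open>\<zeta>\<close> and \<open>j\<close> is positive and less than \<open>1 / sqrt 2\<close> but not \<open>1 / 2\<close>, then the negative of the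
  fourth or the fifth root of the chain starting with \<open>j\<close>, \<open>\<zeta>\<close> has this form with \<open>0 < p < 1\<close>, depending on whether
  the pairing is less or greater than \<open>1 / 2\<close>.
\<close>

lemma small_pairing_discrete:
  assumes \<zeta>: "\<zeta> \<in> M" and j: "j \<in> pos" "\<phi> j = 0" and x: "0 < B \<zeta> j" "2 * (B \<zeta> j)\<^sup>2 < 1"
    and min: "\<And>p q. \<lbrakk>0 < p; p < 1; 0 \<le> q; p *\<^sub>R \<zeta> + q *\<^sub>R j \<in> M\<rbrakk> \<Longrightarrow> False"
  shows "B \<zeta> j = 1 / 2"
proof (rule ccontr)
  assume ne: "B \<zeta> j \<noteq> 1 / 2"
  define x where "x = B \<zeta> j"
  have jr: "j \<in> \<Phi>" "0 < ht j" using j posD by auto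
  let ?u = "chain B j \<zeta>"
  have u: "?u n \<in> \<Phi>" for n using chain_root[OF jr(1) MD(1)[OF \<zeta>]] by blast
  have x': "B j \<zeta> = x" using sym_B x_def by simp
  have u2: "?u (Suc (Suc 0)) = (2 * x) *\<^sub>R \<zeta> - j"
    by (simp add: x' chain.simps(3))
  have u3: "?u (Suc (Suc (Suc 0))) = (4 * x\<^sup>2 - 1) *\<^sub>R \<zeta> - (2 * x) *\<^sub>R j"
    by (simp add: x' chain.simps(3) power2_eq_square algebra_simps)
  have u4: "?u (Suc (Suc (Suc (Suc 0)))) = (4 * x * (2 * x\<^sup>2 - 1)) *\<^sub>R \<zeta> - (4 * x\<^sup>2 - 1) *\<^sub>R j"
  proof -
    have gen: "t *\<^sub>R (p *\<^sub>R v - q *\<^sub>R w) - (r *\<^sub>R v - w) = (t * p - r) *\<^sub>R v - (t * q - 1) *\<^sub>R w"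
      for t p q r :: real and v w :: 'a by (simp add: algebra_simps)
    have "?u (Suc (Suc (Suc (Suc 0))))
        = (2 * x) *\<^sub>R ((4 * x\<^sup>2 - 1) *\<^sub>R \<zeta> - (2 * x) *\<^sub>R j) - ((2 * x) *\<^sub>R \<zeta> - j)"
      by (subst chain.simps(3)) (simp only: u3 u2 x')
    also have "\<dots> = (2 * x * (4 * x\<^sup>2 - 1) - 2 * x) *\<^sub>R \<zeta> - (2 * x * (2 * x) - 1) *\<^sub>R j"
      using gen by blast
    also have "2 * x * (2 * x) - 1 = 4 * x\<^sup>2 - 1" by (simp add: power2_eq_square)
    also have "2 * x * (4 * x\<^sup>2 - 1) - 2 * x = 4 * x * (2 * x\<^sup>2 - 1)"
      by (simp add: algebra_simps)
    finally show ?thesis .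
  qed
  have mem: "p *\<^sub>R \<zeta> + q *\<^sub>R j \<in> M" if "p *\<^sub>R \<zeta> + q *\<^sub>R j \<in> \<Phi>" "0 < p" "0 \<le> q" for p q
  proof (rule MI[OF that(1)])
    show "0 < ht (p *\<^sub>R \<zeta> + q *\<^sub>R j)" using that MD(3)[OF \<zeta>] jr by (simp add: ht_simps add_pos_nonneg)
    show "\<phi> (p *\<^sub>R \<zeta> + q *\<^sub>R j) < 0" using that MD(4)[OF \<zeta>] j by (simp add: phi_simps mult_less_0_iff)
  qed
  have pos: "0 < x" "2 * x\<^sup>2 < 1" using x by (auto simp: x_def)
  consider "x < 1 / 2" | "1 / 2 < x" using ne x_def by linarith
  then show False
  proof cases
    case 1
    have "x * x < (1/2) * (1/2)" using 1 pos by (intro mult_strict_mono) auto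
    then have lt: "4 * x\<^sup>2 < 1" by (simp add: power2_eq_square)
    have "(1 - 4 * x\<^sup>2) *\<^sub>R \<zeta> + (2 * x) *\<^sub>R j = - ?u (Suc (Suc (Suc 0)))"
      unfolding u3 by (simp add: algebra_simps)
    then have r: "(1 - 4 * x\<^sup>2) *\<^sub>R \<zeta> + (2 * x) *\<^sub>R j \<in> \<Phi>" using u uminus_root by metis
    show False using min[OF _ _ _ mem[OF r]] lt pos by simp
  next
    case 2
    have "(1/2) * (1/2) < x * x" using 2 by (intro mult_strict_mono) auto
    then have gt: "1 < 4 * x\<^sup>2" by (simp add: power2_eq_square)
    have "(4 * x * (1 - 2 * x\<^sup>2)) *\<^sub>R \<zeta> + (4 * x\<^sup>2 - 1) *\<^sub>R j = - ?u (Suc (Suc (Suc (Suc 0))))"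
      unfolding u4 by (simp add: algebra_simps)
    then have r: "(4 * x * (1 - 2 * x\<^sup>2)) *\<^sub>R \<zeta> + (4 * x\<^sup>2 - 1) *\<^sub>R j \<in> \<Phi>" using u uminus_root by metis
    have "0 < (2 * x - 1) * (4 * x\<^sup>2 + 2 * x - 1)" using 2 gt by (intro mult_pos_pos) auto
    moreover have "(2 * x - 1) * (4 * x\<^sup>2 + 2 * x - 1) = 1 - 4 * x * (1 - 2 * x\<^sup>2)"
      by (simp add: power2_eq_square algebra_simps)
    ultimately have "4 * x * (1 - 2 * x\<^sup>2) < 1" by simp
    moreover have "0 < 4 * x * (1 - 2 * x\<^sup>2)" using pos by simp
    ultimately show False using min[OF _ _ _ mem[OF r]] gt by simp
  qed
qed

lemma kappa_sq: "3 < m \<Longrightarrow> 1 \<le> 2 * \<kappa>\<^sup>2"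
proof -
  assume m: "3 < m"
  have "0 \<le> cheb \<kappa> 4"
    using cheb_pos[of 4] cheb_m m by (cases "m = 4") auto
  moreover have "cheb \<kappa> 4 = (4 * \<kappa>) * (2 * \<kappa>\<^sup>2 - 1)"
    by (simp add: eval_nat_numeral algebra_simps)
  ultimately have "0 \<le> (4 * \<kappa>) * (2 * \<kappa>\<^sup>2 - 1)" by simp
  then show ?thesis using kappa by (simp add: zero_le_mult_iff)
qed

text \<open>
  In the span of \<open>\<delta>\<^sub>0\<close>, \<open>a\<close> and \<open>b\<close>, let \<open>\<zeta>\<close> be a root of \<open>M\<close> closest to the plane and, among those, highest.
  If \<open>d 2\<close> is not above \<open>M\<close>, then the pairings \<open>q\<close> and \<open>\<rho>\<close> of \<open>\<zeta>\<close> with \<open>a\<close> and \<open>b\<close> are nonnegative and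
  \<open>q + 2 \<kappa> \<rho> < 1\<close>, which leaves few values for \<open>\<rho>\<close>. In each case, a root obtained from \<open>\<zeta>\<close> by
  reflections shows that \<open>d 2\<close> is above \<open>M\<close>, or the form on the span is positive outside the plane, or
  \<open>\<delta>\<^sub>0 = \<zeta>\<close>.  The last two are incompatible with a pairing of at least 1 between \<open>\<delta>\<^sub>0\<close> and \<open>b\<close>.
\<close>

lemma above_M_d2:
  assumes m: "3 < m" and \<delta>\<^sub>0: "\<delta>\<^sub>0 \<in> M" "1 \<le> B \<delta>\<^sub>0 b"
  shows "above_M (d 2)"
proof (rule ccontr)
  assume nk: "\<not> above_M (d 2)"
  have d2: "d 2 = a + (2 * \<kappa>) *\<^sub>R b" using d_2 s_vals by (simp add: numeral_2_eq_2)
  define V where "V = {\<delta>. \<exists>p x y. \<delta> = p *\<^sub>R \<delta>\<^sub>0 + x *\<^sub>R b + y *\<^sub>R a}"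
  have VI: "p *\<^sub>R \<delta>\<^sub>0 + x *\<^sub>R b + y *\<^sub>R a \<in> V" for p x y by (auto simp: V_def)
  have V_add: "x *\<^sub>R u + y *\<^sub>R v \<in> V" if "u \<in> V" "v \<in> V" for u v x y
  proof -
    from that obtain p q r p' q' r' where "u = p *\<^sub>R \<delta>\<^sub>0 + q *\<^sub>R b + r *\<^sub>R a" "v = p' *\<^sub>R \<delta>\<^sub>0 + q' *\<^sub>R b + r' *\<^sub>R a"
      by (auto simp: V_def)
    then have "x *\<^sub>R u + y *\<^sub>R v = (x * p + y * p') *\<^sub>R \<delta>\<^sub>0 + (x * q + y * q') *\<^sub>R b + (x * r + y * r') *\<^sub>R a"
      by (simp add: algebra_simps)
    then show ?thesis using VI by metis
  qed
  have V_gen: "\<delta>\<^sub>0 \<in> V" "b \<in> V" "a \<in> V" using VI[of 1 0 0] VI[of 0 1 0] VI[of 0 0 1] by auto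
  define N where "N = M \<inter> V"
  have finN: "finite N" using finite_M by (simp add: N_def)
  have "\<delta>\<^sub>0 \<in> N" using \<delta>\<^sub>0 V_gen by (simp add: N_def)
  \<comment> \<open>The value \<open>m\<^sub>0\<close> is attained closest to the plane, as \<open>\<phi>\<close> is negative on \<open>M\<close>.\<close>
  define m\<^sub>0 where "m\<^sub>0 = Max (\<phi> ` N)"
  have m0: "\<phi> \<delta> \<le> m\<^sub>0" if "\<delta> \<in> N" for \<delta> using that finN by (simp add: m\<^sub>0_def)
  define N' where "N' = {\<delta> \<in> N. \<phi> \<delta> = m\<^sub>0}"
  have "m\<^sub>0 \<in> \<phi> ` N" unfolding m\<^sub>0_def using finN \<open>\<delta>\<^sub>0 \<in> N\<close> by (intro Max_in) auto
  then have "N' \<noteq> {}" "finite N'" using finN by (auto simp: N'_def)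
  then have "Max (ht ` N') \<in> ht ` N'" by (intro Max_in) auto
  then obtain \<zeta> where \<zeta>: "\<zeta> \<in> N'" and max: "ht \<zeta> = Max (ht ` N')" by (metis imageE)
  have highest: "ht \<delta> \<le> ht \<zeta>" if "\<delta> \<in> N'" for \<delta> using that \<open>finite N'\<close> by (simp add: max)
  have \<zeta>M: "\<zeta> \<in> M" and \<zeta>V: "\<zeta> \<in> V" and \<phi>\<zeta>: "\<phi> \<zeta> = m\<^sub>0" using \<zeta> by (auto simp: N'_def N_def)
  note \<zeta>r = MD[OF \<zeta>M]
  have nearest: "\<phi> \<delta> \<le> \<phi> \<zeta>" if "\<delta> \<in> M" "\<delta> \<in> V" for \<delta> using m0 that \<phi>\<zeta> by (simp add: N_def)
  \<comment> \<open>Otherwise the reflection in \<open>j\<close> would make \<open>\<zeta>\<close> higher.\<close>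
  have nonneg: "0 \<le> B \<zeta> j" if "j \<in> {a, b}" for j
  proof (rule ccontr)
    assume "\<not> ?thesis"
    then have neg: "B \<zeta> j < 0" by simp
    have j: "j \<in> \<Phi>" "0 < ht j" "\<phi> j = 0" "j \<in> V" using that roots phi_a phi_b V_gen by auto
    have "ht (s j \<zeta>) = ht \<zeta> + 2 * ((- B \<zeta> j) * ht j)" by (simp add: refl_def ht_simps sym_B[of j])
    moreover have "0 < (- B \<zeta> j) * ht j" using neg j by (intro mult_pos_pos) auto
    ultimately have up: "ht \<zeta> < ht (s j \<zeta>)" by linarith
    have ph: "\<phi> (s j \<zeta>) = \<phi> \<zeta>" using j by (simp add: refl_def phi_simps)
    have "s j \<zeta> = 1 *\<^sub>R \<zeta> + (- 2 * B j \<zeta>) *\<^sub>R j" by (simp add: refl_def)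
    then have "s j \<zeta> \<in> V" using V_add \<zeta>V j by metis
    then have "s j \<zeta> \<in> N'" using MI[OF refl_root[OF j(1) \<zeta>r(1)]] up \<zeta>r ph \<phi>\<zeta> by (auto simp: N'_def N_def)
    then show False using highest up by fastforce
  qed
  define q \<rho> where "q = B \<zeta> a" and "\<rho> = B \<zeta> b"
  have q0: "0 \<le> q" "0 \<le> \<rho>" using nonneg by (auto simp: q_def \<rho>_def)
  have Bz: "B \<zeta> a = q" "B a \<zeta> = q" "B \<zeta> b = \<rho>" "B b \<zeta> = \<rho>" "B \<zeta> \<zeta> = 1"
    using sym_B root_norm \<zeta>r by (auto simp: q_def \<rho>_def)
  have notk: "B \<delta> (d 2) < 1" if "\<delta> \<in> M" for \<delta> using nk that by (force simp: above_M_def)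
  have lt: "q + 2 * (\<kappa> * \<rho>) < 1" using notk[OF \<zeta>M] by (simp add: d2 B_simps Bz)
  have k2: "1 \<le> 2 * \<kappa>\<^sup>2" using kappa_sq m by blast
  have k1: "\<kappa>\<^sup>2 < 1" using kappa by (simp add: power_less_one_iff)
  have k12: "1 < 2 * \<kappa>"
  proof (rule ccontr)
    assume "\<not> ?thesis"
    then have "\<kappa> * \<kappa> \<le> (1/2) * (1/2)" using kappa by (intro mult_mono) auto
    then show False using k2 by (simp add: power2_eq_square)
  qed
  \<comment> \<open>Since \<open>2 \<kappa> \<rho> < 1\<close> and \<open>2 \<kappa>\<^sup>2 \<ge> 1\<close>, the pairing \<open>\<rho>\<close> is below \<open>1 / sqrt 2\<close>.\<close>
  have \<rho>12: "\<rho> = 0 \<or> \<rho> = 1 / 2"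
  proof (cases "\<rho> = 0")
    case False
    then have "0 < \<rho>" using q0 by simp
    have "2 * (\<kappa> * \<rho>) < 1" using lt q0 by simp
    moreover have "0 \<le> \<kappa> * \<rho>" using q0 kappa by simp
    ultimately have "(2 * (\<kappa> * \<rho>)) * (2 * (\<kappa> * \<rho>)) < 1 * 1" by (intro mult_strict_mono') auto
    moreover have "(2 * \<kappa>\<^sup>2) * (2 * \<rho>\<^sup>2) = (2 * (\<kappa> * \<rho>)) * (2 * (\<kappa> * \<rho>))" by (simp add: power2_eq_square)
    moreover have "1 * (2 * \<rho>\<^sup>2) \<le> (2 * \<kappa>\<^sup>2) * (2 * \<rho>\<^sup>2)" using k2 by (intro mult_right_mono) auto
    ultimately have "2 * \<rho>\<^sup>2 < 1" by linarith
    have "\<rho> = 1 / 2"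
      unfolding \<rho>_def
    proof (rule small_pairing_discrete[OF \<zeta>M b phi_b])
      show "0 < B \<zeta> b" "2 * (B \<zeta> b)\<^sup>2 < 1" using \<open>0 < \<rho>\<close> \<open>2 * \<rho>\<^sup>2 < 1\<close> by (auto simp: \<rho>_def)
      fix p x :: real assume p: "0 < p" "p < 1" "0 \<le> x" "p *\<^sub>R \<zeta> + x *\<^sub>R b \<in> M"
      have "\<phi> (p *\<^sub>R \<zeta> + x *\<^sub>R b) \<le> \<phi> \<zeta>" using nearest p V_add \<zeta>V V_gen by blast
      then have "p * \<phi> \<zeta> \<le> 1 * \<phi> \<zeta>" by (simp add: phi_simps phi_b)
      then show False using p \<zeta>r(4) by (simp add: mult_le_cancel_right)
    qed
    then show ?thesis by simp
  qed simp
  \<comment> \<open>If the form is positive off the plane, then \<open>\<delta>\<^sub>0\<close> and \<open>b\<close> violate it: the norm of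
    \<open>\<delta>\<^sub>0 - t *\<^sub>R b\<close> is \<open>1 - t\<^sup>2\<close> for their pairing \<open>t \<ge> 1\<close>.\<close>
  have pd0: False if pd: "\<And>p x y. p \<noteq> 0 \<Longrightarrow> 0 < B (p *\<^sub>R \<zeta> + x *\<^sub>R b + y *\<^sub>R a) (p *\<^sub>R \<zeta> + x *\<^sub>R b + y *\<^sub>R a)"
  proof -
    obtain p x y where z: "\<zeta> = p *\<^sub>R \<delta>\<^sub>0 + x *\<^sub>R b + y *\<^sub>R a" using \<zeta>V by (auto simp: V_def)
    have "\<phi> \<zeta> = p * \<phi> \<delta>\<^sub>0" unfolding z by (simp add: phi_simps phi_a phi_b)
    then have "p \<noteq> 0" using \<zeta>r by auto
    define t where "t = B \<delta>\<^sub>0 b"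
    have "\<delta>\<^sub>0 - t *\<^sub>R b = (1 / p) *\<^sub>R \<zeta> + (- x / p - t) *\<^sub>R b + (- y / p) *\<^sub>R a"
      unfolding z using \<open>p \<noteq> 0\<close> by (simp add: algebra_simps)
    then have "0 < B (\<delta>\<^sub>0 - t *\<^sub>R b) (\<delta>\<^sub>0 - t *\<^sub>R b)"
      using pd[of "1 / p" "- x / p - t" "- y / p"] \<open>p \<noteq> 0\<close> by (simp only:) simp
    also have "\<dots> = 1 - t\<^sup>2"
      using root_norm[OF MD(1)[OF \<delta>\<^sub>0(1)]] by (simp add: B_simps Bvals t_def sym_B[of b \<delta>\<^sub>0] power2_eq_square)
    finally have "t\<^sup>2 < 1" by simp
    then show False using \<delta>\<^sub>0(2) by (simp add: t_def power_less_one_iff abs_square_less_1)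
  qed
  have norm: "B (p *\<^sub>R \<zeta> + x *\<^sub>R b + y *\<^sub>R a) (p *\<^sub>R \<zeta> + x *\<^sub>R b + y *\<^sub>R a)
    = p\<^sup>2 + x\<^sup>2 + y\<^sup>2 + 2 * \<rho> * p * x + 2 * q * p * y - 2 * \<kappa> * x * y" for p x y
    by (simp add: B_simps Bz Bvals power2_eq_square algebra_simps)
  from \<rho>12 show False
  proof
    assume \<rho>: "\<rho> = 0"
    show False
    proof (cases "1 \<le> \<kappa>\<^sup>2 + q\<^sup>2")
      case True
      then have "q \<noteq> 0" using k1 by auto
      then have qp: "0 < q" using q0 by simp
      \<comment> \<open>This root has pairing \<open>2 q\<^sup>2 + 2 \<kappa>\<^sup>2 - 1 \<ge> 1\<close> with \<open>d 2\<close>; it is positive as \<open>a\<close> spans an extreme ray.\<close>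
      let ?\<delta> = "- s \<zeta> a"
      have eq: "?\<delta> = (2 * q) *\<^sub>R \<zeta> - a" by (simp add: refl_def Bz)
      have r: "?\<delta> \<in> \<Phi>" using refl_root uminus_root \<zeta>r roots by blast
      have ph: "\<phi> ?\<delta> < 0" unfolding eq using qp \<zeta>r by (simp add: phi_simps phi_a mult_pos_neg)
      have "0 < ht ?\<delta>"
      proof (rule ccontr)
        assume "\<not> ?thesis"
        then have n: "- ?\<delta> \<in> pos" by (rule neg_posI[OF r])
        have "(2 * q) *\<^sub>R \<zeta> + 1 *\<^sub>R (- ?\<delta>) = 1 *\<^sub>R a" unfolding eq by simp
        then have "\<zeta> = a" using simple_extreme2[OF a \<zeta>r(2) n, of "2 * q" 1 1] qp by simp
        then show False using \<zeta>r phi_a by simp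
      qed
      then have "?\<delta> \<in> M" using MI r ph by blast
      then have "B ?\<delta> (d 2) < 1" by (rule notk)
      moreover have "B ?\<delta> (d 2) = 2 * q\<^sup>2 + 2 * \<kappa>\<^sup>2 - 1"
        unfolding eq d2 using \<rho> by (simp add: B_simps Bz Bvals power2_eq_square algebra_simps)
      ultimately show False using True by simp
    next
      case False
      show False
      proof (rule pd0)
        fix p x y :: real assume "p \<noteq> 0"
        have "B (p *\<^sub>R \<zeta> + x *\<^sub>R b + y *\<^sub>R a) (p *\<^sub>R \<zeta> + x *\<^sub>R b + y *\<^sub>R a)
          = (x - \<kappa> * y)\<^sup>2 + (p + q * y)\<^sup>2 + (1 - \<kappa>\<^sup>2 - q\<^sup>2) * y\<^sup>2"
          unfolding norm \<rho> by (simp add: power2_eq_square algebra_simps)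
        also have "0 < \<dots>"
        proof (cases "y = 0")
          case True
          then show ?thesis using \<open>p \<noteq> 0\<close> by (simp add: add_nonneg_pos)
        next
          case y: False
          then have "0 < (1 - \<kappa>\<^sup>2 - q\<^sup>2) * y\<^sup>2" using False by (intro mult_pos_pos) auto
          then show ?thesis by (simp add: add_nonneg_pos)
        qed
        finally show "0 < B (p *\<^sub>R \<zeta> + x *\<^sub>R b + y *\<^sub>R a) (p *\<^sub>R \<zeta> + x *\<^sub>R b + y *\<^sub>R a)" .
      qed
    qed
  next
    assume \<rho>: "\<rho> = 1 / 2"
    have "q = 0"
    proof (rule ccontr)
      assume "q \<noteq> 0"
      then have qp: "0 < q" using q0 by simp
      have "q < 1 / 2" using lt \<rho> k12 by simp
      then have "q * q < (1/2) * (1/2)" using qp by (intro mult_strict_mono) auto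
      then have q2: "2 * q\<^sup>2 < 1" by (simp add: power2_eq_square)
      have "q = 1 / 2"
        unfolding q_def
      proof (rule small_pairing_discrete[OF \<zeta>M roots(3) phi_a])
        show "0 < B \<zeta> a" "2 * (B \<zeta> a)\<^sup>2 < 1" using qp q2 by (auto simp: q_def)
        fix p x :: real assume p: "0 < p" "p < 1" "0 \<le> x" "p *\<^sub>R \<zeta> + x *\<^sub>R a \<in> M"
        have "\<phi> (p *\<^sub>R \<zeta> + x *\<^sub>R a) \<le> \<phi> \<zeta>" using nearest p V_add \<zeta>V V_gen by blast
        then have "p * \<phi> \<zeta> \<le> 1 * \<phi> \<zeta>" by (simp add: phi_simps phi_a)
        then show False using p \<zeta>r(4) by (simp add: mult_le_cancel_right)
      qed
      then show False using \<open>q < 1 / 2\<close> by simp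
    qed
    have xy: "0 \<le> x\<^sup>2 + y\<^sup>2 - 2 * \<kappa> * x * y \<and> (x\<^sup>2 + y\<^sup>2 - 2 * \<kappa> * x * y = 0 \<longrightarrow> x = 0 \<and> y = 0)" for x y
    proof -
      have eq: "x\<^sup>2 + y\<^sup>2 - 2 * \<kappa> * x * y = (x - \<kappa> * y)\<^sup>2 + (1 - \<kappa>\<^sup>2) * y\<^sup>2"
        by (simp add: power2_eq_square algebra_simps)
      have "0 \<le> (1 - \<kappa>\<^sup>2) * y\<^sup>2" using k1 by simp
      moreover have "y = 0 \<and> x = 0" if "(x - \<kappa> * y)\<^sup>2 + (1 - \<kappa>\<^sup>2) * y\<^sup>2 = 0"
      proof -
        have "(x - \<kappa> * y)\<^sup>2 = 0" "(1 - \<kappa>\<^sup>2) * y\<^sup>2 = 0"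
          using that \<open>0 \<le> (1 - \<kappa>\<^sup>2) * y\<^sup>2\<close> by (smt (verit) zero_le_power2)+
        then show ?thesis using k1 by auto
      qed
      ultimately show ?thesis unfolding eq by auto
    qed
    show False
    proof (cases "\<kappa>\<^sup>2 < 3 / 4")
      case True
      show False
      proof (rule pd0)
        fix p x y :: real assume "p \<noteq> 0"
        have "B (p *\<^sub>R \<zeta> + x *\<^sub>R b + y *\<^sub>R a) (p *\<^sub>R \<zeta> + x *\<^sub>R b + y *\<^sub>R a)
          = (y - \<kappa> * x)\<^sup>2 + (p + x / 2)\<^sup>2 + (3 / 4 - \<kappa>\<^sup>2) * x\<^sup>2"
          unfolding norm \<rho> \<open>q = 0\<close> by (simp add: power2_eq_square algebra_simps)
        also have "0 < \<dots>"
        proof (cases "x = 0")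
          case True
          then show ?thesis using \<open>p \<noteq> 0\<close> by (simp add: add_nonneg_pos)
        next
          case x: False
          then have "0 < (3 / 4 - \<kappa>\<^sup>2) * x\<^sup>2" using True by (intro mult_pos_pos) auto
          then show ?thesis by (simp add: add_nonneg_pos)
        qed
        finally show "0 < B (p *\<^sub>R \<zeta> + x *\<^sub>R b + y *\<^sub>R a) (p *\<^sub>R \<zeta> + x *\<^sub>R b + y *\<^sub>R a)" .
      qed
    next
      case False
      \<comment> \<open>Whether \<open>\<eta> = b - \<zeta>\<close> is positive decides which root gives the contradiction.\<close>
      define \<eta> where "\<eta> = s \<zeta> b"
      have \<eta>: "\<eta> = b - \<zeta>" "\<eta> \<in> \<Phi>"
        by (simp add: \<eta>_def refl_def Bz \<rho>) (unfold \<eta>_def, rule refl_root[OF \<zeta>r(1) roots(2)])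
      show False
      proof (cases "0 < ht \<eta>")
        case False
        then have n\<eta>: "- \<eta> \<in> pos" by (rule neg_posI[OF \<eta>(2)])
        have sz: "s \<zeta> a = a" "s \<zeta> b = b - \<zeta>" by (simp_all add: refl_def Bz \<rho> \<open>q = 0\<close>)
        \<comment> \<open>If \<open>- \<eta>\<close> is positive, this root of \<open>M\<close> has pairing \<open>1 + 2 \<kappa>\<^sup>2 (4 \<kappa>\<^sup>2 - 3) \<ge> 1\<close> with \<open>d 2\<close>.\<close>
        let ?\<delta> = "- s \<zeta> (s a (s b a))"
        have "?\<delta> = (2 * \<kappa>) *\<^sub>R (\<zeta> - b) - (4 * \<kappa>\<^sup>2 - 1) *\<^sub>R a"
          by (simp add: s_vals s_simps sz G_simps[OF refl_G[OF \<zeta>r(1)]] power2_eq_square algebra_simps)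
        then have eq: "?\<delta> = (2 * \<kappa>) *\<^sub>R (- \<eta>) - (4 * \<kappa>\<^sup>2 - 1) *\<^sub>R a" using \<eta> by simp
        have r: "?\<delta> \<in> \<Phi>" using refl_root uminus_root \<zeta>r roots by blast
        have ph: "\<phi> ?\<delta> < 0" unfolding eq \<eta> using kappa \<zeta>r by (simp add: phi_simps phi_a phi_b mult_pos_neg)
        have "0 < ht ?\<delta>"
        proof (rule ccontr)
          assume "\<not> ?thesis"
          then have n: "- ?\<delta> \<in> pos" by (rule neg_posI[OF r])
          have "(2 * \<kappa>) *\<^sub>R (- \<eta>) + 1 *\<^sub>R (- ?\<delta>) = (4 * \<kappa>\<^sup>2 - 1) *\<^sub>R a" unfolding eq by simp
          then have "- \<eta> = a" using simple_extreme2[OF a n\<eta> n, of "2 * \<kappa>" 1 "4 * \<kappa>\<^sup>2 - 1"] kappa by simp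
          then have "\<phi> (- \<eta>) = 0" using phi_a by simp
          then show False unfolding \<eta> using \<zeta>r phi_b by (simp add: phi_simps)
        qed
        then have "?\<delta> \<in> M" using MI r ph by blast
        then have "B ?\<delta> (d 2) < 1" by (rule notk)
        moreover have "B ?\<delta> (d 2) = 1 + 2 * \<kappa>\<^sup>2 * (4 * \<kappa>\<^sup>2 - 3)"
          unfolding eq d2 \<eta> by (simp add: B_simps Bz Bvals \<rho> \<open>q = 0\<close> power2_eq_square algebra_simps)
        moreover have "0 \<le> 2 * \<kappa>\<^sup>2 * (4 * \<kappa>\<^sup>2 - 3)" using \<open>\<not> \<kappa>\<^sup>2 < 3 / 4\<close> by (intro mult_nonneg_nonneg) auto
        ultimately show False by linarith
      next
        case True
        then have \<eta>p: "\<eta> \<in> pos" using \<eta> posI by blast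
        \<comment> \<open>If \<open>\<eta>\<close> is positive, a root of \<open>M\<close> in the span with nonnegative coefficient of \<open>b\<close> is a multiple of \<open>\<zeta>\<close>:
          the coefficient \<open>p\<close> of \<open>\<zeta>\<close> is at least 1 as \<open>\<zeta>\<close> is closest to the plane, and the norm is 1.\<close>
        have step1: "x = 0 \<and> y = 0"
          if "p *\<^sub>R \<zeta> + x *\<^sub>R b + y *\<^sub>R a \<in> M" "0 \<le> x" "p *\<^sub>R \<zeta> + x *\<^sub>R b + y *\<^sub>R a \<in> V" for p x y
        proof -
          have "p * \<phi> \<zeta> \<le> 1 * \<phi> \<zeta>" using nearest[OF that(1,3)] by (simp add: phi_simps phi_a phi_b)
          then have p: "1 \<le> p" using \<zeta>r(4) by (simp add: mult_le_cancel_right)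
          have "1 = p\<^sup>2 + p * x + (x\<^sup>2 + y\<^sup>2 - 2 * \<kappa> * x * y)"
            using norm[of p x y] root_norm[OF MD(1)[OF that(1)]] by (simp add: \<rho> \<open>q = 0\<close>)
          moreover have "1 \<le> p\<^sup>2" "0 \<le> p * x" using p that(2) by simp_all
          ultimately have "x\<^sup>2 + y\<^sup>2 - 2 * \<kappa> * x * y = 0" using xy[of x y] by linarith
          then show ?thesis using xy by blast
        qed
        \<comment> \<open>The root \<open>\<delta>\<^sub>0\<close> satisfies the condition on the coefficient of \<open>b\<close>; so it equals \<open>\<zeta>\<close>, which pairs to \<open>1 / 2\<close> with \<open>b\<close>.\<close>
        obtain p' x' y' where z: "\<zeta> = p' *\<^sub>R \<delta>\<^sub>0 + x' *\<^sub>R b + y' *\<^sub>R a" using \<zeta>V by (auto simp: V_def)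
        have pz: "\<phi> \<zeta> = p' * \<phi> \<delta>\<^sub>0" unfolding z by (simp add: phi_simps phi_a phi_b)
        then have "p' \<noteq> 0" using \<zeta>r by auto
        define p x y where "p = 1 / p'" and "x = - x' / p'" and "y = - y' / p'"
        have e: "\<delta>\<^sub>0 = p *\<^sub>R \<zeta> + x *\<^sub>R b + y *\<^sub>R a"
          unfolding z p_def x_def y_def using \<open>p' \<noteq> 0\<close> by (simp add: algebra_simps)
        have "\<phi> \<delta>\<^sub>0 = p * \<phi> \<zeta>" unfolding e by (simp add: phi_simps phi_a phi_b)
        then have pp: "0 < p" using MD(4)[OF \<delta>\<^sub>0(1)] \<zeta>r(4) by (simp add: mult_less_0_iff)
        have "0 \<le> x"
        proof (rule ccontr)
          assume "\<not> 0 \<le> x"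
          then have xn: "x < 0" by simp
          have e2: "\<delta>\<^sub>0 = (p + x) *\<^sub>R \<zeta> + x *\<^sub>R \<eta> + y *\<^sub>R a" unfolding e \<eta> by (simp add: algebra_simps)
          have px: "0 < p + x"
          proof (rule ccontr)
            assume "\<not> ?thesis"
            moreover have "1 *\<^sub>R \<delta>\<^sub>0 + (- (p + x)) *\<^sub>R \<zeta> + (- x) *\<^sub>R \<eta> = y *\<^sub>R a" unfolding e2 by (simp add: algebra_simps)
            ultimately have "\<delta>\<^sub>0 = a"
              using simple_extreme[OF a MD(2)[OF \<delta>\<^sub>0(1)] \<zeta>r(2) \<eta>p, of 1 "- (p + x)" "- x" y] xn by simp
            then show False using MD(4)[OF \<delta>\<^sub>0(1)] phi_a by simp
          qed
          \<comment> \<open>If the coefficient \<open>x\<close> of \<open>b\<close> in \<open>\<delta>\<^sub>0\<close> were negative, this would be a root of \<open>M\<close> with coefficient \<open>- x > 0\<close>.\<close>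
          let ?\<delta> = "- s \<zeta> \<delta>\<^sub>0"
          have e3: "?\<delta> = (p + x) *\<^sub>R \<zeta> + (- x) *\<^sub>R b + (- y) *\<^sub>R a"
          proof -
            have "2 * B \<zeta> \<delta>\<^sub>0 = p + (p + x)" unfolding e by (simp add: B_simps Bz \<rho> \<open>q = 0\<close>)
            then have "?\<delta> = (p + (p + x)) *\<^sub>R \<zeta> - \<delta>\<^sub>0" by (simp add: refl_def)
            also have "\<dots> = (p + x) *\<^sub>R \<zeta> + (- x) *\<^sub>R b + (- y) *\<^sub>R a"
              by (subst e, simp only: scaleR_add_left scaleR_minus_left) (simp del: scaleR_left.minus)
            finally show ?thesis .
          qed
          have r: "?\<delta> \<in> \<Phi>" using refl_root uminus_root \<zeta>r MD(1)[OF \<delta>\<^sub>0(1)] by blast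
          have ph: "\<phi> ?\<delta> < 0" unfolding e3 using px \<zeta>r by (simp add: phi_simps phi_a phi_b mult_pos_neg)
          have "0 < ht ?\<delta>"
          proof (rule ccontr)
            assume "\<not> ?thesis"
            then have n: "- ?\<delta> \<in> pos" by (rule neg_posI[OF r])
            have "(p + x) *\<^sub>R \<zeta> + (- x) *\<^sub>R b + 1 *\<^sub>R (- ?\<delta>) = y *\<^sub>R a" unfolding e3 by simp
            then have "\<zeta> = a" using simple_extreme[OF a \<zeta>r(2) b n, of "p + x" "- x" 1 y] px xn by simp
            then show False using \<zeta>r phi_a by simp
          qed
          then have mem: "?\<delta> \<in> M" using MI r ph by blast
          have "?\<delta> \<in> V" unfolding e3 using V_add[OF V_add[OF \<zeta>V V_gen(2), of "p + x" "- x"] V_gen(3), of 1 "- y"] by (simp only: scaleR_one)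
          then have "- x = 0" using step1[of "p + x" "- x" "- y"] mem xn unfolding e3 by simp
          then show False using xn by simp
        qed
        then have "x = 0" "y = 0" using step1[of p x y] \<delta>\<^sub>0(1) V_gen(1) unfolding e[symmetric] by blast+
        then have e': "\<delta>\<^sub>0 = p *\<^sub>R \<zeta>" using e by simp
        then have "p\<^sup>2 = 1" using root_norm[OF MD(1)[OF \<delta>\<^sub>0(1)]] by (simp add: B_simps Bz power2_eq_square)
        then have "p = 1" using pp by (simp add: power2_eq_1_iff)
        then show False using e' \<delta>\<^sub>0(2) Bz \<rho> by simp
      qed
    qed
  qed
qed

text \<open>
  Every interior root other than \<open>d 2\<close> is obtained by a raising reflection in \<open>a\<close> or \<open>b\<close> from \<open>b\<close> or from a lower
  interior root; so being above \<open>M\<close> spreads from \<open>b\<close> and \<open>d 2\<close> to all of them.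
\<close>

theorem interior_not_small:
  assumes "b \<notin> small" and "1 < j" "j < m"
  shows "d j \<notin> small"
proof -
  obtain \<delta>\<^sub>0 where \<delta>\<^sub>0: "\<delta>\<^sub>0 \<in> pos" "dom b \<delta>\<^sub>0" "\<delta>\<^sub>0 \<noteq> b" using assms(1) b by (auto simp: small_def)
  have M0: "\<delta>\<^sub>0 \<in> M" using phi_neg_of_dominated[OF b phi_b \<delta>\<^sub>0(1,2)] \<delta>\<^sub>0(3) by blast
  have B0: "1 \<le> B \<delta>\<^sub>0 b" using dom_imp_B[OF b \<delta>\<^sub>0(1,2)] sym_B by simp
  have kb: "above_M b" using M0 B0 by (auto simp: above_M_def)
  have dpos: "d i \<in> pos" if "1 < i" "i < m" for i
  proof -
    from that(1) obtain n where n: "i = Suc n" "0 < n" by (cases i) auto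
    have "0 < ht (d i)" unfolding n d_Suc
      using cheb_pos[of n] cheb_pos[of "Suc n"] that n roots by (simp add: ht_simps add_pos_pos)
    then show ?thesis using d_root posI by blast
  qed
  have k1: "above_M (s a b)" using above_M_raise[OF kb roots(3) phi_a] Bvals kappa by simp
  have k2: "above_M (d 2)"
  proof (cases "m = 3")
    case True
    then show ?thesis using k1 d_below_m by simp
  next
    case False
    then show ?thesis using above_M_d2[OF _ M0 B0] m_ge_3 by simp
  qed
  have "above_M (d j)" if "1 < j" "j < m" for j
  proof (rule ccontr)
    assume nk: "\<not> above_M (d j)"
    \<comment> \<open>Take a lowest interior root that is not above \<open>M\<close>.\<close>
    define I where "I = {i. 1 < i \<and> i < m \<and> \<not> above_M (d i)}"
    have "finite I" by (rule finite_subset[of _ "{..<m}"]) (auto simp: I_def)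
    moreover have "j \<in> I" using that nk by (simp add: I_def)
    ultimately have "Min ((\<lambda>i. ht (d i)) ` I) \<in> (\<lambda>i. ht (d i)) ` I" by (intro Min_in) auto
    then obtain i where i: "i \<in> I" and min: "ht (d i) = Min ((\<lambda>i. ht (d i)) ` I)" by (metis (no_types, lifting) imageE)
    have least: "ht (d i) \<le> ht (d l)" if "l \<in> I" for l using that \<open>finite I\<close> by (simp add: min)
    have im: "1 < i" "i < m" "\<not> above_M (d i)" using i by (auto simp: I_def)
    from im(1) obtain n where n: "i = Suc n" "0 < n" by (cases i) auto
    have c: "0 < cheb \<kappa> (Suc n)" "0 < cheb \<kappa> n" using cheb_pos im n by auto
    \<comment> \<open>Since \<open>d i\<close> has norm 1, it pairs positively with \<open>a\<close> or with \<open>b\<close>, whose reflection then lowers it.\<close>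
    have "1 = B (d i) (d i)" using root_norm d_root by simp
    also have "\<dots> = cheb \<kappa> (Suc n) * B (d i) b + cheb \<kappa> n * B (d i) a"
      using d_Suc[of n] n by (metis bilinear_radd[OF bilinear_B] bilinear_rmul[OF bilinear_B] real_scaleR_def)
    finally have sum: "1 = cheb \<kappa> (Suc n) * B (d i) b + cheb \<kappa> n * B (d i) a" .
    \<comment> \<open>The lower root is \<open>b = d 1\<close> or interior, except that the reflection in \<open>b\<close> maps \<open>d 2\<close> to \<open>a\<close>.\<close>
    have key: "\<exists>l. s j (d i) = d l \<and> (l = 1 \<or> 1 < l \<and> l < m) \<or> s j (d i) = a \<and> d i = d 2" if "j \<in> {a, b}" for j
    proof (cases "j = a")
      case True
      have "s a (d i) = d (m - i)" using sa_d[of i] im by simp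
      moreover have "m - i = 1 \<or> 1 < m - i \<and> m - i < m" using im by auto
      ultimately show ?thesis using True by blast
    next
      case False
      have eq: "s b (d i) = d (Suc m - n)" using sb_d[of n] n im by simp
      show ?thesis
      proof (cases "n = 1")
        case True
        then show ?thesis using eq d_m False that n by (simp add: numeral_2_eq_2)
      next
        case False
        then have "1 < Suc m - n \<and> Suc m - n < m" using im n by auto
        then show ?thesis using eq \<open>j \<noteq> a\<close> that by auto
      qed
    qed
    have contra: False if j: "j \<in> {a, b}" and Bp: "0 < B (d i) j" for j
    proof -
      have jp: "j \<in> pos" "\<phi> j = 0" "0 < ht j" "j \<in> \<Phi>" using j roots b phi_a phi_b by auto
      have "ht (s j (d i)) = ht (d i) - 2 * (B (d i) j * ht j)" by (simp add: refl_def ht_simps sym_B[of j])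
      moreover have "0 < B (d i) j * ht j" using Bp jp by simp
      ultimately have low: "ht (s j (d i)) < ht (d i)" by linarith
      have "above_M (s j (d i)) \<or> d i = d 2"
      proof -
        from key[OF j] obtain l where "s j (d i) = d l \<and> (l = 1 \<or> 1 < l \<and> l < m) \<or> s j (d i) = a \<and> d i = d 2" by blast
        then show ?thesis
        proof (elim disjE conjE)
          assume l: "s j (d i) = d l" "1 < l" "l < m"
          then have "l \<notin> I" using low least by fastforce
          then show ?thesis using l by (auto simp: I_def)
        qed (use kb in \<open>auto simp: One_nat_def\<close>)
      qed
      moreover have "B (s j (d i)) j \<le> 0"
      proof -
        have "B (s j (d i)) j = - B (d i) j" using root_norm[OF jp(4)] by (simp add: refl_def B_simps sym_B[of j "d i"])
        then show ?thesis using Bp by simp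
      qed
      ultimately have "above_M (d i)"
        using above_M_raise[OF _ jp(1,2)] refl_refl[OF jp(4)] k2 by metis
      then show False using im by blast
    qed
    have "0 < B (d i) b \<or> 0 < B (d i) a"
    proof (rule ccontr)
      assume "\<not> ?thesis"
      then have "cheb \<kappa> (Suc n) * B (d i) b \<le> 0" "cheb \<kappa> n * B (d i) a \<le> 0"
        using c by (auto simp: mult_le_0_iff)
      then show False using sum by linarith
    qed
    then show False using contra by blast
  qed
  then show ?thesis using above_M_not_small dpos phi_d assms by blast
qed

end

section \<open>Cones\<close>

lemma cone_of_incl: "x \<in> X \<Longrightarrow> x \<in> cone_of X"
  unfolding cone_of_def by (intro CollectI exI[of _ "{x}"] exI[of _ "\<lambda>_. 1"]) auto

lemma cone_of_zero: "0 \<in> cone_of X"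
  unfolding cone_of_def by (intro CollectI exI[of _ "{}"]) auto

lemma cone_of_mono: "X \<subseteq> Y \<Longrightarrow> cone_of X \<subseteq> cone_of Y"
  unfolding cone_of_def by blast

lemma cone_of_scale:
  assumes "v \<in> cone_of X" "0 \<le> t"
  shows "t *\<^sub>R v \<in> cone_of X"
proof -
  obtain F c where "finite F" "F \<subseteq> X" "\<forall>a\<in>F. 0 \<le> c a" "v = (\<Sum>a\<in>F. (c a :: real) *\<^sub>R a)"
    using assms by (auto simp: cone_of_def)
  then show ?thesis using assms unfolding cone_of_def
    by (intro CollectI exI[of _ F] exI[of _ "\<lambda>a. t * c a"]) (auto simp: scaleR_sum_right)
qed

lemma cone_of_add:
  assumes "v \<in> cone_of X" "w \<in> cone_of X"
  shows "v + w \<in> cone_of X"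
proof -
  obtain F c where F: "finite F" "F \<subseteq> X" "\<forall>a\<in>F. 0 \<le> c a" "v = (\<Sum>a\<in>F. (c a :: real) *\<^sub>R a)"
    using assms by (auto simp: cone_of_def)
  obtain F' c' where F': "finite F'" "F' \<subseteq> X" "\<forall>a\<in>F'. 0 \<le> c' a" "w = (\<Sum>a\<in>F'. (c' a :: real) *\<^sub>R a)"
    using assms by (auto simp: cone_of_def)
  define e where "e a = (if a \<in> F then c a else 0) + (if a \<in> F' then c' a else 0)" for a
  have "v = (\<Sum>a\<in>F \<union> F'. (if a \<in> F then c a else 0) *\<^sub>R a)"
    unfolding F(4) using F(1) F'(1) by (intro sum.mono_neutral_cong_left) auto
  moreover have "w = (\<Sum>a\<in>F \<union> F'. (if a \<in> F' then c' a else 0) *\<^sub>R a)"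
    unfolding F'(4) using F(1) F'(1) by (intro sum.mono_neutral_cong_left) auto
  ultimately have "v + w = (\<Sum>a\<in>F \<union> F'. e a *\<^sub>R a)"
    by (simp add: e_def scaleR_add_left sum.distrib)
  moreover have "finite (F \<union> F')" "F \<union> F' \<subseteq> X" "\<forall>a\<in>F \<union> F'. 0 \<le> e a"
    using F F' by (auto simp: e_def)
  ultimately show ?thesis unfolding cone_of_def by blast
qed

lemma cone_of_sum:
  assumes "finite F" "\<And>a. a \<in> F \<Longrightarrow> f a \<in> cone_of X"
  shows "sum f F \<in> cone_of X"
  using assms by (induction F rule: finite_induct) (auto intro: cone_of_zero cone_of_add)

lemma cone_of_trans:
  assumes "X \<subseteq> cone_of Y"
  shows "cone_of X \<subseteq> cone_of Y"
  using assms unfolding cone_of_def[of X] by (auto intro!: cone_of_sum cone_of_scale)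

lemma cone_of_insert:
  assumes "v \<in> cone_of (insert b X)"
  obtains x p where "0 \<le> x" "p \<in> cone_of X" "v = x *\<^sub>R b + p"
proof -
  obtain F c where F: "finite F" "F \<subseteq> insert b X" "\<forall>a\<in>F. 0 \<le> c a" "v = (\<Sum>a\<in>F. (c a :: real) *\<^sub>R a)"
    using assms by (auto simp: cone_of_def)
  have p: "(\<Sum>a\<in>F - {b}. c a *\<^sub>R a) \<in> cone_of X"
    using F by (intro cone_of_sum cone_of_scale) (auto intro: cone_of_incl)
  show ?thesis
  proof (cases "b \<in> F")
    case True
    then show ?thesis using that[of "c b", OF _ p] F by (simp add: sum.remove)
  next
    case False
    then show ?thesis using that[of 0, OF _ p] F by simp
  qed
qed

text \<open>
  A functional that is positive on the generators vanishes on a point of the cone only if all coefficients are zero.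
\<close>

lemma cone_of_functional:
  assumes "p \<in> cone_of X" "linear h" "\<And>x. x \<in> X \<Longrightarrow> 0 < h x"
  shows "0 \<le> (h p :: real)" and "h p = 0 \<Longrightarrow> p = 0"
proof -
  obtain F c where F: "finite F" "F \<subseteq> X" "\<forall>a\<in>F. 0 \<le> c a" "p = (\<Sum>a\<in>F. (c a :: real) *\<^sub>R a)"
    using assms by (auto simp: cone_of_def)
  have e: "h p = (\<Sum>a\<in>F. c a * h a)" unfolding F(4) by (simp add: linear_sum[OF assms(2)] linear_scale[OF assms(2)])
  have nn: "0 \<le> c a * h a" if "a \<in> F" for a using that F assms(3)[of a] by auto
  then show "0 \<le> h p" unfolding e by (rule sum_nonneg)
  assume "h p = 0"
  then have "c a * h a = 0" if "a \<in> F" for a using that nn F(1) unfolding e by (simp add: sum_nonneg_eq_0_iff)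
  then have "c a = 0" if "a \<in> F" for a using that F(2) assms(3) by fastforce
  then show "p = 0" unfolding F(4) by simp
qed

lemma cone_of_finite:
  assumes "v \<in> cone_of X" "finite X"
  obtains c where "\<And>a. a \<in> X \<Longrightarrow> 0 \<le> c a" "v = (\<Sum>a\<in>X. (c a :: real) *\<^sub>R a)"
proof -
  obtain F c where F: "finite F" "F \<subseteq> X" "\<forall>a\<in>F. 0 \<le> c a" "v = (\<Sum>a\<in>F. (c a :: real) *\<^sub>R a)"
    using assms by (auto simp: cone_of_def)
  have "v = (\<Sum>a\<in>X. (if a \<in> F then c a else 0) *\<^sub>R a)"
    unfolding F(4) using F(2) assms(2) by (intro sum.mono_neutral_cong_left) auto
  then show ?thesis using that[of "\<lambda>a. if a \<in> F then c a else 0"] F(3) by simp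
qed

context root_system
begin

lemma neg_setD: "\<beta> \<in> neg_set g \<Longrightarrow> \<beta> \<in> pos" "\<beta> \<in> neg_set g \<Longrightarrow> \<beta> \<in> \<Phi>" "\<beta> \<in> neg_set g \<Longrightarrow> 0 < ht \<beta>"
  "\<beta> \<in> neg_set g \<Longrightarrow> ht (g \<beta>) < 0"
  by (auto simp: neg_set_def pos_def)

lemma neg_setI: "\<beta> \<in> \<Phi> \<Longrightarrow> 0 < ht \<beta> \<Longrightarrow> ht (g \<beta>) < 0 \<Longrightarrow> \<beta> \<in> neg_set g"
  by (auto simp: neg_set_def pos_def)

section \<open>Extremal inversions\<close>

text \<open>
  The roots \<open>\<gamma>\<close> and \<open>- s \<beta> \<gamma>\<close> add up to a multiple of \<open>\<beta>\<close>; an extremal \<open>\<beta>\<close> admits no such pair of inversions.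
  This combinatorial condition says what is needed about the cone of inversions: an extremal inversion is not
  in the cone of the other inversions (\<open>extremal_not_in_cone\<close>), and the extremal ones generate
  all inversions (\<open>exists_extremal\<close>).  It can also be read off from lengths (\<open>extremal_iff_card\<close>).
\<close>

definition extremal :: "('v \<Rightarrow> 'v) \<Rightarrow> 'v \<Rightarrow> bool"
  where "extremal g \<beta> \<longleftrightarrow> \<beta> \<in> neg_set g \<and> (\<forall>\<gamma>\<in>neg_set g. \<gamma> \<noteq> \<beta> \<longrightarrow> - s \<beta> \<gamma> \<notin> neg_set g)"

text \<open>
  Composing \<open>g\<close> with the reflection in an inversion \<open>\<beta>\<close> loses \<open>\<beta>\<close> and the inversions \<open>\<gamma>\<close> for which \<open>- s \<beta> \<gamma>\<close> is also an
  inversion; each of the others either survives or is replaced by its reflection.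
\<close>

lemma card_neg_set_refl:
  assumes g: "g \<in> G" and \<beta>: "\<beta> \<in> neg_set g"
  shows "card (neg_set (g \<circ> s \<beta>)) = card {\<gamma> \<in> neg_set g. \<gamma> \<noteq> \<beta> \<and> - s \<beta> \<gamma> \<notin> neg_set g}"
proof -
  let ?U = "neg_set (g \<circ> s \<beta>)" and ?E = "{\<gamma> \<in> neg_set g. \<gamma> \<noteq> \<beta> \<and> - s \<beta> \<gamma> \<notin> neg_set g}"
  let ?f = "\<lambda>\<tau>. if ht (g \<tau>) < 0 then \<tau> else s \<beta> \<tau>"
  note b = neg_setD[OF \<beta>]
  have gneg: "ht (g (- v)) = - ht (g v)" for v by (simp add: G_simps[OF g] ht_uminus)
  have sb: "s \<beta> \<beta> = - \<beta>" "s \<beta> (s \<beta> v) = v" for v using refl_self refl_refl b by auto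
  have gs: "ht (g (s \<beta> v)) = ht (g v) - 2 * (B \<beta> v * ht (g \<beta>))" for v
    by (simp add: refl_def G_simps[OF g] ht_simps)
  have hs: "ht (s \<beta> v) = ht v - 2 * (B \<beta> v * ht \<beta>)" for v
    by (simp add: refl_def ht_simps)
  have "bij_betw ?f ?U ?E"
  proof (rule bij_betw_imageI)
    show "inj_on ?f ?U"
      by (rule inj_onI) (auto split: if_splits simp: neg_set_def sb, (metis sb(2) less_asym' not_less_iff_gr_or_eq)+)
    show "?f ` ?U = ?E"
    proof (intro equalityI subsetI)
      fix \<sigma> assume "\<sigma> \<in> ?f ` ?U"
      then obtain \<tau> where \<tau>: "\<tau> \<in> ?U" "\<sigma> = ?f \<tau>" by blast
      have t: "\<tau> \<in> \<Phi>" "0 < ht \<tau>" "ht (g (s \<beta> \<tau>)) < 0" using \<tau>(1) by (auto simp: neg_set_def pos_def)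
      show "\<sigma> \<in> ?E"
      proof (cases "ht (g \<tau>) < 0")
        case True
        then have "\<tau> \<noteq> \<beta>" using t(3) b(4) sb gneg by auto
        moreover have "- s \<beta> \<tau> \<notin> neg_set g" using t(3) gneg by (auto simp: neg_set_def)
        ultimately show ?thesis using True \<tau> t neg_setI by simp
      next
        case False
        then have "B \<beta> \<tau> * ht (g \<beta>) > 0" using t(3) gs[of \<tau>] by linarith
        then have "B \<beta> \<tau> < 0" using b(4) by (simp add: zero_less_mult_iff)
        then have "B \<beta> \<tau> * ht \<beta> < 0" using b(3) by (simp add: mult_less_0_iff)
        then have "0 < ht (s \<beta> \<tau>)" using hs[of \<tau>] t by linarith
        then have "s \<beta> \<tau> \<in> neg_set g" using t refl_root b neg_setI by blast
        moreover have "s \<beta> \<tau> \<noteq> \<beta>"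
        proof
          assume "s \<beta> \<tau> = \<beta>"
          then have "\<tau> = - \<beta>" using sb by metis
          then show False using t b by (simp add: ht_uminus)
        qed
        moreover have "- \<tau> \<notin> neg_set g" using t by (auto simp: neg_set_def pos_def ht_uminus)
        ultimately show ?thesis using False \<tau> sb by simp
      qed
    next
      fix \<gamma> assume "\<gamma> \<in> ?E"
      then have c: "\<gamma> \<in> neg_set g" "\<gamma> \<noteq> \<beta>" "- s \<beta> \<gamma> \<notin> neg_set g" by auto
      note c' = neg_setD[OF c(1)]
      show "\<gamma> \<in> ?f ` ?U"
      proof (cases "ht (g (s \<beta> \<gamma>)) < 0")
        case True
        then have "\<gamma> \<in> ?U" using c' neg_setI by simp
        then show ?thesis using c' by (intro image_eqI[of _ _ \<gamma>]) auto
      next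
        case False
        have r: "s \<beta> \<gamma> \<in> \<Phi>" using refl_root b c' by blast
        then have gp: "0 < ht (g (s \<beta> \<gamma>))" using False root_neg_or_pos G_root[OF g] by blast
        have "0 < ht (s \<beta> \<gamma>)"
        proof (rule ccontr)
          assume "\<not> ?thesis"
          then have "0 < ht (- s \<beta> \<gamma>)" using root_neg_or_pos[OF r] by (simp add: ht_uminus)
          then have "- s \<beta> \<gamma> \<in> neg_set g" using gp gneg uminus_root[OF r] by (intro neg_setI) auto
          then show False using c by blast
        qed
        then have "s \<beta> \<gamma> \<in> ?U" using r c' sb by (intro neg_setI) auto
        then show ?thesis using False sb by (intro image_eqI[of _ _ "s \<beta> \<gamma>"]) auto
      qed
    qed
  qed
  then show ?thesis by (rule bij_betw_same_card)
qed

lemma card_neg_set_refl_less: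
  assumes "g \<in> G" "\<beta> \<in> neg_set g"
  shows "card (neg_set (g \<circ> s \<beta>)) < card (neg_set g)"
  unfolding card_neg_set_refl[OF assms]
  using assms finite_neg_set by (intro psubset_card_mono) auto

lemma extremal_iff_card:
  assumes "g \<in> G" "\<beta> \<in> neg_set g"
  shows "extremal g \<beta> \<longleftrightarrow> card (neg_set g) \<le> card (neg_set (g \<circ> s \<beta>)) + 1"
proof -
  let ?E = "{\<gamma> \<in> neg_set g. \<gamma> \<noteq> \<beta> \<and> - s \<beta> \<gamma> \<notin> neg_set g}"
  have fin: "finite (neg_set g)" using assms finite_neg_set by blast
  have sub: "?E \<subseteq> neg_set g - {\<beta>}" by auto
  have c: "card (neg_set g) = card (neg_set g - {\<beta>}) + 1" using card.remove[OF fin assms(2)] by simp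
  have "extremal g \<beta> \<longleftrightarrow> ?E = neg_set g - {\<beta>}" using assms by (auto simp: extremal_def)
  also have "\<dots> \<longleftrightarrow> card (neg_set g - {\<beta>}) \<le> card ?E"
  proof
    assume "card (neg_set g - {\<beta>}) \<le> card ?E"
    then show "?E = neg_set g - {\<beta>}" by (intro card_seteq[OF _ sub]) (use fin in simp)
  qed (simp only: order_refl)
  finally show ?thesis unfolding card_neg_set_refl[OF assms] by (simp only: c add_le_cancel_right)
qed

text \<open>
  Suppose that \<open>\<beta>\<close> is a nonnegative combination of the other inversions.  By extremality, each of these, or
  its reflection in \<open>\<beta>\<close>, is positive and made negative by \<open>g \<circ> s \<beta>\<close>. Replacing the former by the latter where
  needed changes the combination by a multiple of \<open>\<beta>\<close>, and the result \<open>(1 - P) *\<^sub>R \<beta>\<close> has nonnegative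
  height, while its image under \<open>g \<circ> s \<beta>\<close> has nonpositive height. Hence \<open>P = 1\<close> and all coefficients vanish.
\<close>

lemma extremal_not_in_cone:
  assumes g: "g \<in> G" and ext: "extremal g \<beta>"
  shows "\<beta> \<notin> cone_of (neg_set g - {\<beta>})"
proof
  assume "\<beta> \<in> cone_of (neg_set g - {\<beta>})"
  then obtain F c where F: "finite F" "F \<subseteq> neg_set g - {\<beta>}" "\<forall>a\<in>F. 0 \<le> c a" "\<beta> = (\<Sum>a\<in>F. (c a :: real) *\<^sub>R a)"
    by (auto simp: cone_of_def)
  have \<beta>: "\<beta> \<in> neg_set g" using ext by (auto simp: extremal_def)
  note b = neg_setD[OF \<beta>]
  define f where "f v = ht (g (s \<beta> v))" for v
  have gs: "g \<circ> s \<beta> \<in> G" using g refl_G b G_comp by blast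
  have fl: "linear f" using ht_comp_linear[OF gs] by (simp add: f_def[abs_def])
  note f_simps = linear_add[OF fl] linear_diff[OF fl] linear_scale[OF fl]
  have f\<beta>: "0 < f \<beta>" using b refl_self[OF b(2)] by (simp add: f_def G_simps[OF g] ht_uminus)
  define p where "p \<gamma> = (if f \<gamma> < 0 then 0 else 2 * B \<beta> \<gamma>)" for \<gamma>
  define \<tau> where "\<tau> \<gamma> = \<gamma> - p \<gamma> *\<^sub>R \<beta>" for \<gamma>
  have key: "f (\<tau> \<gamma>) \<le> 0 \<and> 0 < ht (\<tau> \<gamma>)" if "\<gamma> \<in> F" for \<gamma>
  proof -
    have c: "\<gamma> \<in> neg_set g" "- s \<beta> \<gamma> \<notin> neg_set g" using that F ext by (auto simp: extremal_def)
    note c' = neg_setD[OF c(1)]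
    show ?thesis
    proof (cases "f \<gamma> < 0")
      case True
      then show ?thesis using c' by (simp add: \<tau>_def p_def)
    next
      case False
      have e: "\<tau> \<gamma> = s \<beta> \<gamma>" using False by (simp add: \<tau>_def p_def refl_def)
      have r: "s \<beta> \<gamma> \<in> \<Phi>" using refl_root b c' by blast
      have "ht (g (s \<beta> \<gamma>)) > 0" using False root_neg_or_pos[OF G_root[OF g r]] by (simp add: f_def)
      then have "0 < ht (s \<beta> \<gamma>)"
        using root_neg_or_pos[OF r] uminus_root[OF r] c(2) neg_setI[of "- s \<beta> \<gamma>" g]
        by (auto simp: ht_uminus G_simps[OF g])
      moreover have "f (s \<beta> \<gamma>) < 0" using c' refl_refl[OF b(2)] by (simp add: f_def)
      ultimately show ?thesis using e by simp
    qed
  qed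
  define P where "P = (\<Sum>\<gamma>\<in>F. c \<gamma> * p \<gamma>)"
  have "(\<Sum>\<gamma>\<in>F. c \<gamma> *\<^sub>R \<tau> \<gamma>) = (\<Sum>\<gamma>\<in>F. c \<gamma> *\<^sub>R \<gamma>) - P *\<^sub>R \<beta>"
    by (simp add: \<tau>_def P_def scaleR_diff_right sum_subtractf scaleR_sum_left)
  also have "\<dots> = (1 - P) *\<^sub>R \<beta>" using F(4) by (simp add: algebra_simps)
  finally have eq: "(\<Sum>\<gamma>\<in>F. c \<gamma> *\<^sub>R \<tau> \<gamma>) = (1 - P) *\<^sub>R \<beta>" .
  have ef: "(1 - P) * f \<beta> = (\<Sum>\<gamma>\<in>F. c \<gamma> * f (\<tau> \<gamma>))"
    using arg_cong[OF eq, of f] by (simp add: linear_sum[OF fl] f_simps)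
  have eh: "(1 - P) * ht \<beta> = (\<Sum>\<gamma>\<in>F. c \<gamma> * ht (\<tau> \<gamma>))"
    using arg_cong[OF eq, of ht] by (simp add: linear_sum[OF ht_linear] ht_simps)
  have "(1 - P) * f \<beta> \<le> 0" unfolding ef using key F(3) by (intro sum_nonpos mult_nonneg_nonpos) auto
  then have "1 - P \<le> 0" using f\<beta> by (simp add: mult_le_0_iff)
  moreover have nn: "0 \<le> c \<gamma> * ht (\<tau> \<gamma>)" if "\<gamma> \<in> F" for \<gamma>
    using that key F(3) by (intro mult_nonneg_nonneg) (auto intro: less_imp_le)
  have "0 \<le> (1 - P) * ht \<beta>" unfolding eh using nn by (rule sum_nonneg)
  then have "0 \<le> 1 - P" using b(3) by (simp add: zero_le_mult_iff)
  ultimately have "P = 1" by simp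
  then have "(\<Sum>\<gamma>\<in>F. c \<gamma> * ht (\<tau> \<gamma>)) = 0" using eh by simp
  then have "c \<gamma> * ht (\<tau> \<gamma>) = 0" if "\<gamma> \<in> F" for \<gamma> using that nn F(1) by (simp add: sum_nonneg_eq_0_iff)
  then have "c \<gamma> = 0" if "\<gamma> \<in> F" for \<gamma> using that key by fastforce
  then have "\<beta> = 0" using F(4) by simp
  then show False using b(3) by (simp add: ht_simps)
qed

text \<open>
  Complete \<open>K\<close> to a generating set by as few inversions as possible; each inversion that was added is
  extremal.
\<close>

lemma exists_extremal:
  assumes g: "g \<in> G" and nsub: "\<not> neg_set g \<subseteq> cone_of K" and K: "K \<subseteq> neg_set g"
  obtains \<beta> where "extremal g \<beta>" "\<beta> \<notin> K"
proof -
  let ?N = "neg_set g"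
  have finN: "finite ?N" using finite_neg_set g by blast
  define good where "good A \<longleftrightarrow> A \<subseteq> ?N \<and> ?N \<subseteq> cone_of (K \<union> A)" for A
  have "good ?N" by (auto simp: good_def intro: cone_of_incl)
  then obtain A where A: "good A" and least: "\<And>A'. good A' \<Longrightarrow> card A \<le> card A'"
    by (metis ex_has_least_nat)
  have "A \<noteq> {}" using A nsub by (auto simp: good_def)
  then obtain \<beta> where \<beta>: "\<beta> \<in> A" by blast
  define X where "X = K \<union> (A - {\<beta>})"
  have X: "\<And>v. v \<in> X \<Longrightarrow> 0 < ht v" using K A neg_setD(3) by (auto simp: X_def good_def)
  have out: "\<beta> \<notin> cone_of X"
  proof
    assume in_X: "\<beta> \<in> cone_of X"
    have "K \<union> A \<subseteq> cone_of X" using in_X cone_of_incl[of _ X] by (auto simp: X_def)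
    then have "cone_of (K \<union> A) \<subseteq> cone_of X" by (rule cone_of_trans)
    then have "?N \<subseteq> cone_of (K \<union> (A - {\<beta>}))" using A unfolding good_def X_def by (meson order.trans)
    then have "good (A - {\<beta>})" using A unfolding good_def by blast
    then have "card A \<le> card (A - {\<beta>})" by (rule least)
    moreover have "finite A" using A finN finite_subset by (auto simp: good_def)
    ultimately show False using \<beta> by (metis card_Diff1_less not_le)
  qed
  have N: "?N \<subseteq> cone_of (insert \<beta> X)" using A \<beta> by (simp add: good_def X_def insert_absorb Un_commute flip: Un_insert_right)
  have \<beta>N: "\<beta> \<in> ?N" using A \<beta> by (auto simp: good_def)
  note b = neg_setD[OF \<beta>N]
  have "extremal g \<beta>"
    unfolding extremal_def
  proof (intro conjI ballI impI notI \<beta>N)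
    fix \<gamma> assume \<gamma>: "\<gamma> \<in> ?N" "\<gamma> \<noteq> \<beta>" "- s \<beta> \<gamma> \<in> ?N"
    obtain x p where x: "0 \<le> x" "p \<in> cone_of X" "\<gamma> = x *\<^sub>R \<beta> + p"
      using cone_of_insert N \<gamma>(1) by (metis subsetD)
    obtain x' p' where x': "0 \<le> x'" "p' \<in> cone_of X" "- s \<beta> \<gamma> = x' *\<^sub>R \<beta> + p'"
      using cone_of_insert N \<gamma>(3) by (metis subsetD)
    define c where "c = 2 * B \<beta> \<gamma>"
    define t where "t = c - x - x'"
    have "c *\<^sub>R \<beta> = \<gamma> + - s \<beta> \<gamma>" by (simp add: refl_def c_def)
    also have "\<dots> = (x *\<^sub>R \<beta> + p) + (x' *\<^sub>R \<beta> + p')" unfolding x'(3) by (subst x(3)) simp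
    finally have eq: "t *\<^sub>R \<beta> = p + p'" by (simp add: t_def scaleR_diff_left)
    have pp: "p + p' \<in> cone_of X" using x x' cone_of_add by blast
    show False
    proof (cases "0 < t")
      case True
      have "\<beta> = (1 / t) *\<^sub>R (p + p')" using True unfolding eq[symmetric] by simp
      then have "\<beta> \<in> cone_of X" using cone_of_scale[OF pp, of "1 / t"] True by simp
      then show False using out by blast
    next
      case False
      have "ht p + ht p' = t * ht \<beta>" using arg_cong[OF eq, of ht] by (simp add: ht_simps)
      also have "\<dots> \<le> 0" using False b by (simp add: mult_le_0_iff)
      finally have "ht p = 0" using cone_of_functional(1)[OF x(2) ht_linear X] cone_of_functional(1)[OF x'(2) ht_linear X] by simp
      then have "\<gamma> = x *\<^sub>R \<beta>" using cone_of_functional(2)[OF x(2) ht_linear X] x(3) by simp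
      moreover from this have "x\<^sup>2 = 1" using root_norm[OF neg_setD(2)[OF \<gamma>(1)]] root_norm[OF b(2)]
        by (simp add: B_simps power2_eq_square)
      ultimately show False using x(1) \<gamma>(2) by (auto simp: power2_eq_1_iff)
    qed
  qed
  moreover have "\<beta> \<notin> K" using out cone_of_incl[of \<beta> X] by (auto simp: X_def)
  ultimately show ?thesis using that by blast
qed

text \<open>
  If \<open>\<gamma>\<close> dominates \<open>\<delta>\<close>, then \<open>\<delta>\<close> is an inversion too and therefore not \<open>a\<close>; the reflection in \<open>a\<close> carries the
  pair to positive roots.
\<close>

lemma small_reflect:
  assumes a: "a \<in> \<Delta>" "0 < ht (g a)" and g: "g \<in> G" and \<gamma>: "\<gamma> \<in> neg_set g" and small: "s a \<gamma> \<in> small"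
  shows "\<gamma> \<in> small"
  unfolding small_def
proof (intro CollectI conjI ballI impI)
  show "\<gamma> \<in> pos" using \<gamma> neg_setD by blast
  fix \<delta> assume \<delta>: "\<delta> \<in> pos" "dom \<gamma> \<delta>"
  have ar: "a \<in> \<Phi>" using a simple_root by blast
  have "\<delta> \<noteq> a" using \<delta>(2) g \<gamma> a(2) neg_setD by (auto simp: dom_def)
  then have "s a \<delta> \<in> pos" using simple_permutes[OF a(1)] \<delta>(1) refl_root[OF ar] posD posI by blast
  moreover have "dom (s a \<gamma>) (s a \<delta>)" using dom_act[OF refl_G[OF ar] \<delta>(2)] .
  ultimately have "s a \<delta> = s a \<gamma>" using small by (auto simp: small_def)
  then show "\<delta> = \<gamma>" using refl_refl[OF ar] by metis
qed

lemma neg_set_simple: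
  assumes a: "a \<in> \<Delta>" "0 < ht (g a)" and g: "g \<in> G"
  shows "neg_set (g \<circ> s a) = insert a (s a ` neg_set g)"
proof (intro equalityI subsetI)
  have ar: "a \<in> \<Phi>" using a simple_root by blast
  fix \<beta> assume "\<beta> \<in> neg_set (g \<circ> s a)"
  then have b: "\<beta> \<in> \<Phi>" "0 < ht \<beta>" "ht (g (s a \<beta>)) < 0" by (auto simp: neg_set_def pos_def)
  show "\<beta> \<in> insert a (s a ` neg_set g)"
  proof (cases "\<beta> = a")
    case False
    then have "s a \<beta> \<in> neg_set g" using simple_permutes[OF a(1)] b refl_root[OF ar] by (intro neg_setI) auto
    then show ?thesis using refl_refl[OF ar] by (metis image_eqI insertI2)
  qed simp
next
  have ar: "a \<in> \<Phi>" using a simple_root by blast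
  fix \<beta> assume "\<beta> \<in> insert a (s a ` neg_set g)"
  then consider "\<beta> = a" | \<gamma> where "\<gamma> \<in> neg_set g" "\<beta> = s a \<gamma>" by blast
  then show "\<beta> \<in> neg_set (g \<circ> s a)"
  proof cases
    case 1
    then show ?thesis using ar simple_pos[OF a(1)] a(2) refl_self[OF ar]
      by (intro neg_setI) (auto simp: G_simps[OF g] ht_uminus)
  next
    case 2
    then have "\<gamma> \<noteq> a" using a(2) neg_setD(4) by fastforce
    then show ?thesis using 2 simple_permutes[OF a(1)] neg_setD[OF 2(1)] refl_root[OF ar] refl_refl[OF ar]
      by (intro neg_setI) auto
  qed
qed

section \<open>Cancelling a simple reflection in front of a low element\<close>

lemma refl_uminus: "s (- \<beta>) v = s \<beta> v"
  by (simp add: refl_def B_simps)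

text \<open>
  The product of the reflections in two successive roots of a chain is always the same rotation.
\<close>

lemma chain_rotation:
  assumes "a \<in> \<Phi>" "b \<in> \<Phi>"
  shows "s (chain B a b (Suc n)) (s (chain B a b n) v) = s b (s a v)"
proof (induction n arbitrary: v)
  case (Suc n)
  let ?p = "chain B a b (Suc n)" and ?q = "chain B a b n"
  have p: "?p \<in> \<Phi>" using chain_root[OF assms] by blast
  have "s (chain B a b (Suc (Suc n))) (s ?p v) = s (s ?p ?q) (s ?p v)"
    unfolding chain_refl[OF assms] refl_uminus ..
  also have "\<dots> = s ?p (s ?q v)" using refl_conj[OF refl_G[OF p], of ?q v] by simp
  finally show ?case using Suc by simp
qed simp

declare chain.simps(3) [simp del]

text \<open>
  In terms of group elements, \<open>g\<close> represents the inverse of \<open>w\<close> and \<open>a\<close> is the simple root of a generator \<open>r\<close>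
  with \<open>r w\<close> longer than \<open>w\<close>: if small inversions generate the inversion set of \<open>r w\<close>, then they do so for \<open>w\<close>.
\<close>

theorem low_suffix:
  assumes g: "g \<in> G" and a: "a \<in> \<Delta>" "0 < ht (g a)"
    and A: "A \<subseteq> small" "A \<subseteq> neg_set (g \<circ> s a)" "neg_set (g \<circ> s a) \<subseteq> cone_of A"
  shows "neg_set g \<subseteq> cone_of (small \<inter> neg_set g)"
proof (rule ccontr)
  assume "\<not> ?thesis"
  then obtain b where ext: "extremal g b" and "b \<notin> small \<inter> neg_set g"
    using exists_extremal[OF g] by blast
  then have bN: "b \<in> neg_set g" and nsmall: "b \<notin> small" by (auto simp: extremal_def)
  note b = neg_setD[OF bN]
  have ar: "a \<in> \<Phi>" "a \<in> pos" "0 < ht a" using a simple_root simple_pos posI by auto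
  have ab: "b \<noteq> a" using a b by auto
  \<comment> \<open>Two distinct positive roots, one of them simple, are not proportional.\<close>
  have indep: "x = 0 \<and> y = 0" if "x *\<^sub>R b = y *\<^sub>R a" for x y
  proof (rule ccontr)
    assume nz: "\<not> ?thesis"
    have e: "x * ht b = y * ht a" using arg_cong[OF that, of ht] by (simp add: ht_simps)
    have "x \<noteq> 0" using nz e ar by auto
    show False
    proof (cases "0 < x")
      case True
      then show False using simple_extreme2[OF a(1) b(1) b(1), of x 0 y] that ab by simp
    next
      case False
      then show False using simple_extreme2[OF a(1) b(1) b(1), of "- x" 0 "- y"] that ab \<open>x \<noteq> 0\<close> by simp
    qed
  qed
  let ?g' = "g \<circ> s a"
  have g': "?g' \<in> G" using g ar refl_G G_comp by blast
  have N': "neg_set ?g' = insert a (s a ` neg_set g)" using neg_set_simple[OF a g] .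
  have aN: "a \<notin> neg_set g" using a neg_setD by fastforce
  \<comment> \<open>A generating set contains every extremal inversion.\<close>
  have ext_small: "\<gamma> \<in> small" if "extremal ?g' \<gamma>" for \<gamma>
  proof (rule ccontr)
    assume "\<gamma> \<notin> small"
    then have "A \<subseteq> neg_set ?g' - {\<gamma>}" using A by auto
    then have "\<gamma> \<in> cone_of (neg_set ?g' - {\<gamma>})"
      using A(3) cone_of_mono that unfolding extremal_def by blast
    then show False using extremal_not_in_cone[OF g' that] by blast
  qed
  have conj: "s a (s (s a \<beta>) v) = s \<beta> (s a v)" for \<beta> v
    using refl_conj[OF refl_G[OF ar(1)], of "s a \<beta>" v] refl_refl[OF ar(1)] by simp
  have s_in: "s a \<gamma> \<in> neg_set g" if "\<gamma> \<in> neg_set ?g'" "\<gamma> \<noteq> a" for \<gamma>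
    using that refl_refl[OF ar(1)] unfolding N' by auto
  have s_neg: "s a (- v) = - s a v" "s b (- v) = - s b v" for v
    using G_simps refl_G ar b by blast+
  \<comment> \<open>As \<open>s a b\<close> is not small, it is not extremal. A pair of inversions witnessing this is reflected in \<open>a\<close> to a
    pair that would violate extremality of \<open>b\<close>, unless one of its members is \<open>a\<close> and the other one becomes \<open>s b a\<close>.\<close>
  have d2N: "s b a \<in> neg_set g"
  proof -
    have nab: "s b a \<noteq> - a"
    proof
      assume "s b a = - a"
      have "(2 * B b a) *\<^sub>R b = a - s b a" by (simp add: refl_def)
      also have "\<dots> = 2 *\<^sub>R a" unfolding \<open>s b a = - a\<close> by (simp add: scaleR_2)
      finally have "(2 * B b a) *\<^sub>R b = 2 *\<^sub>R a" .
      then show False using indep by fastforce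
    qed
    have "s a b \<in> neg_set ?g'" using bN unfolding N' by blast
    moreover have "s a b \<notin> small" using small_reflect[OF a g bN] nsmall by blast
    ultimately obtain \<gamma> where \<gamma>: "\<gamma> \<in> neg_set ?g'" "\<gamma> \<noteq> s a b" "- s (s a b) \<gamma> \<in> neg_set ?g'"
      using ext_small by (auto simp: extremal_def)
    let ?\<gamma>' = "- s (s a b) \<gamma>"
    have sg': "s a ?\<gamma>' = - s b (s a \<gamma>)" using conj s_neg by simp
    show ?thesis
    proof (cases "\<gamma> = a")
      case True
      then have e: "s a ?\<gamma>' = s b a" using sg' refl_self[OF ar(1)] s_neg by simp
      have "?\<gamma>' \<noteq> a"
      proof
        assume "?\<gamma>' = a"
        then have "s b a = - a" using e refl_self[OF ar(1)] by simp
        then show False using nab by blast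
      qed
      then show ?thesis using s_in[OF \<gamma>(3)] e by simp
    next
      case False
      then have s\<gamma>: "s a \<gamma> \<in> neg_set g" using s_in \<gamma> by blast
      show ?thesis
      proof (cases "?\<gamma>' = a")
        case True
        then have "- s b (s a \<gamma>) = - a" using sg' refl_self[OF ar(1)] by simp
        then have "s a \<gamma> = s b a" using refl_refl[OF b(2)] by (metis neg_equal_iff_equal)
        then show ?thesis using s\<gamma> by simp
      next
        case False
        then have "- s b (s a \<gamma>) \<in> neg_set g" using s_in[OF \<gamma>(3)] sg' by simp
        moreover have "s a \<gamma> \<noteq> b" using \<gamma>(2) refl_refl[OF ar(1)] by metis
        ultimately show ?thesis using ext s\<gamma> by (auto simp: extremal_def)
      qed
    qed
  qed
  define \<kappa> where "\<kappa> = - B a b"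
  have Bk: "B a b = - \<kappa>" "B b a = - \<kappa>" "B (- a) b = \<kappa>" using sym_B by (auto simp: \<kappa>_def B_simps)
  have d2: "s b a = (2 * \<kappa>) *\<^sub>R b + a" by (simp add: refl_def Bk)
  have "ht (g (s b a)) = ht (g a) + 2 * (\<kappa> * ht (g b))" unfolding d2 by (simp add: G_simps[OF g] ht_simps)
  then have "\<kappa> * ht (g b) < 0" using neg_setD(4)[OF d2N] a(2) by linarith
  then have \<kappa>: "0 < \<kappa>" using b(4) by (simp add: mult_less_0_iff)
  let ?d = "chain B (- a) b"
  have na: "- a \<in> \<Phi>" using uminus_root ar by blast
  have dr: "?d n \<in> \<Phi>" for n using chain_root[OF na b(2)] by blast
  have d_Suc: "?d (Suc n) = cheb \<kappa> (Suc n) *\<^sub>R b + cheb \<kappa> n *\<^sub>R a" for n using chain_cheb[of B a b n] Bk by simp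
  have ht_rec: "ht (?d (Suc (Suc n))) = 2 * \<kappa> * ht (?d (Suc n)) - ht (?d n)" for n using ht_chain_id[of "- a" b n] Bk by simp
  have inc: "strict_mono (\<lambda>n. ht (?d n)) \<and> (\<forall>n. 0 < ht (?d (Suc n)))" if "1 \<le> \<kappa>"
    using recurrence_strict_mono[where x = "\<lambda>n. ht (?d n)", OF ht_rec that] ar b by (auto simp: ht_uminus)
  \<comment> \<open>The chain leaves the finite inversion set: its heights do not stay positive or else increase strictly.\<close>
  have "\<exists>n. ?d (Suc n) \<notin> neg_set g"
  proof (rule ccontr)
    assume "\<not> ?thesis"
    then have all: "?d (Suc n) \<in> neg_set g" for n by blast
    show False
    proof (cases "\<kappa> < 1")
      case True
      show False
        using recurrence_not_pos[where x = "\<lambda>n. ht (?d (Suc n))", OF ht_rec True] all neg_setD(3) by blast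
    next
      case False
      then have sm: "strict_mono (\<lambda>n. ht (?d n))" using inc by simp
      have "inj (\<lambda>n. ?d (Suc n))"
      proof (rule injI)
        fix x y assume e: "?d (Suc x) = ?d (Suc y)"
        show "x = y" using strict_mono_eq[OF sm, of "Suc x" "Suc y"] e by simp
      qed
      moreover have "range (\<lambda>n. ?d (Suc n)) \<subseteq> neg_set g" using all by blast
      ultimately show False using finite_neg_set[OF g] range_inj_infinite finite_subset by blast
    qed
  qed
  then obtain l where l: "?d (Suc l) \<notin> neg_set g" and below: "\<And>i. i < l \<Longrightarrow> ?d (Suc i) \<in> neg_set g"
    using exists_least_iff[of "\<lambda>l. ?d (Suc l) \<notin> neg_set g"] by blast
  have "?d (Suc 0) \<in> neg_set g" "?d (Suc (Suc 0)) \<in> neg_set g" using bN d2N d2 Bk by (auto simp: chain.simps(3))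
  then have "l \<noteq> 0" "l \<noteq> Suc 0" using l by metis+
  then obtain k where lk: "l = Suc (Suc k)" by (metis not0_implies_Suc)
  \<comment> \<open>The coefficients stay positive as long as the chain is inside, since \<open>g\<close> makes \<open>b\<close> negative and \<open>a\<close> positive.\<close>
  have cpos: "0 < cheb \<kappa> (Suc i)" if "i \<le> Suc k" for i
    using that
  proof (induction i)
    case (Suc i)
    have c: "0 < cheb \<kappa> (Suc i)" using Suc by simp
    have "?d (Suc (Suc i)) \<in> neg_set g" using below Suc lk by simp
    then have "ht (g (?d (Suc (Suc i)))) < 0" using neg_setD by blast
    then have lt: "cheb \<kappa> (Suc (Suc i)) * ht (g b) + cheb \<kappa> (Suc i) * ht (g a) < 0"
      unfolding d_Suc[of "Suc i"] by (simp only: G_simps[OF g] ht_simps real_scaleR_def)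
    have "0 < cheb \<kappa> (Suc i) * ht (g a)" using c a by simp
    then have "cheb \<kappa> (Suc (Suc i)) * ht (g b) < 0" using lt by linarith
    then show ?case using b(4) by (simp only: mult_less_0_iff) linarith
  qed simp
  \<comment> \<open>If a root of the chain passed beyond \<open>a\<close>, then its negative would be an inversion, and
    \<open>b\<close> would lie in the cone of this inversion and \<open>s b a\<close>.\<close>
  have overshoot: False if c: "cheb \<kappa> (Suc i) < 0" "0 < cheb \<kappa> i" for i
  proof -
    let ?e = "- ?d (Suc i)"
    have e: "?e = (- cheb \<kappa> (Suc i)) *\<^sub>R b - cheb \<kappa> i *\<^sub>R a" unfolding d_Suc by simp
    have "0 < ht ?e"
    proof (rule ccontr)
      assume "\<not> ?thesis"
      then have "?d (Suc i) \<in> pos" using root_neg_or_pos[OF dr[of "Suc i"]] dr by (intro posI) (auto simp: ht_uminus)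
      moreover have "(- cheb \<kappa> (Suc i)) *\<^sub>R b + 1 *\<^sub>R ?d (Suc i) = cheb \<kappa> i *\<^sub>R a" unfolding d_Suc by simp
      ultimately show False using simple_extreme2[OF a(1) b(1)] c ab by (metis less_eq_real_def neg_0_less_iff_less zero_less_one)
    qed
    moreover have "ht (g ?e) < 0"
    proof -
      have "ht (g ?e) = (- cheb \<kappa> (Suc i)) * ht (g b) - cheb \<kappa> i * ht (g a)"
        unfolding e by (simp only: G_simps[OF g] ht_simps real_scaleR_def)
      moreover have "(- cheb \<kappa> (Suc i)) * ht (g b) < 0" using c b by (simp add: mult_less_0_iff zero_less_mult_iff)
      moreover have "0 < cheb \<kappa> i * ht (g a)" using c a by simp
      ultimately show ?thesis by linarith
    qed
    ultimately have eN: "?e \<in> neg_set g" using dr uminus_root neg_setI by blast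
    have "?e \<noteq> b"
    proof
      assume "?e = b"
      then have "(- cheb \<kappa> (Suc i) - 1) *\<^sub>R b = cheb \<kappa> i *\<^sub>R a" using e by (simp add: algebra_simps)
      then show False using indep c by fastforce
    qed
    moreover have "s b a \<noteq> b"
    proof
      assume "s b a = b"
      then have "(1 - 2 * \<kappa>) *\<^sub>R b = 1 *\<^sub>R a" using d2 by (simp add: algebra_simps)
      then show False using indep by fastforce
    qed
    ultimately have "?e \<in> neg_set g - {b}" "s b a \<in> neg_set g - {b}" using eN d2N by blast+
    then have in_cone: "?e \<in> cone_of (neg_set g - {b})" "s b a \<in> cone_of (neg_set g - {b})"
      by (simp_all only: cone_of_incl)
    define t where "t = 2 * \<kappa> * cheb \<kappa> i - cheb \<kappa> (Suc i)"
    have "0 < 2 * \<kappa> * cheb \<kappa> i" using c \<kappa> by simp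
    then have t: "0 < t" using c by (simp add: t_def)
    have "cheb \<kappa> i *\<^sub>R s b a + ?e = t *\<^sub>R b" unfolding e d2 t_def by (simp add: algebra_simps)
    moreover have "cheb \<kappa> i *\<^sub>R s b a + ?e \<in> cone_of (neg_set g - {b})"
      using in_cone c by (intro cone_of_add cone_of_scale) auto
    ultimately have "t *\<^sub>R b \<in> cone_of (neg_set g - {b})" by (simp only:)
    from cone_of_scale[OF this, of "1 / t"] show False using t extremal_not_in_cone[OF g ext] by simp
  qed
  \<comment> \<open>The last root before the chain leaves the inversion set.\<close>
  let ?\<gamma> = "?d (Suc (Suc k))"
  have \<gamma>N: "?\<gamma> \<in> neg_set g" and dk: "?d (Suc k) \<in> neg_set g" using below lk by auto
  \<comment> \<open>The next root is still positive, so it leaves by becoming positive under \<open>g\<close>.\<close>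
  have last: "0 < ht (g (?d (Suc l)))"
  proof -
    have "0 \<le> cheb \<kappa> (Suc l)" using overshoot[of l] cpos[of "Suc k"] lk by force
    moreover have "0 < cheb \<kappa> l" using cpos[of "Suc k"] lk by simp
    ultimately have "0 < cheb \<kappa> (Suc l) * ht b + cheb \<kappa> l * ht a" using b(3) ar(3) by (simp add: add_nonneg_pos)
    then have "0 < ht (?d (Suc l))" unfolding d_Suc[of l] by (simp only: ht_simps real_scaleR_def)
    then have "\<not> ht (g (?d (Suc l))) < 0" using l dr neg_setI by blast
    then show ?thesis using root_neg_or_pos[OF G_root[OF g dr]] by blast
  qed
  have "s a ?\<gamma> \<in> small"
  proof (rule ext_small)
    have s\<gamma>: "s a ?\<gamma> \<in> neg_set ?g'" using \<gamma>N unfolding N' by blast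
    \<comment> \<open>Deleting \<open>s a \<gamma>\<close> and then \<open>\<tau>\<close> from \<open>r w\<close> has the same effect as deleting \<open>b\<close> from \<open>w\<close>, which shortens \<open>w\<close> by one.
      So the first deletion shortens \<open>r w\<close> by at most one.\<close>
    let ?x = "?g' \<circ> s (s a ?\<gamma>)" and ?\<tau> = "s a (?d (Suc k))"
    have x: "?x \<in> G" using g' refl_G neg_setD(2)[OF s\<gamma>] G_comp by blast
    have xv: "?x v = g (s ?\<gamma> (s a v))" for v using conj by simp
    have "?x ?\<tau> = g (s ?\<gamma> (?d (Suc k)))" using xv refl_refl[OF ar(1)] by simp
    also have "\<dots> = - g (?d (Suc l))"
      using chain_refl[OF na b(2), of "Suc k"] unfolding lk by (simp add: G_simps[OF g])
    finally have "ht (?x ?\<tau>) < 0" using last by (simp add: ht_uminus)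
    moreover have "?\<tau> \<in> neg_set ?g'" using dk unfolding N' by blast
    ultimately have \<tau>: "?\<tau> \<in> neg_set ?x" using neg_setD by (intro neg_setI) auto
    have "?x \<circ> s ?\<tau> = g \<circ> s b"
    proof
      fix v
      have "(?x \<circ> s ?\<tau>) v = g (s ?\<gamma> (s (?d (Suc k)) (s a v)))" using xv conj by simp
      also have "\<dots> = g (s b (s (- a) (s a v)))" using chain_rotation[OF na b(2), of "Suc k"] by simp
      finally show "(?x \<circ> s ?\<tau>) v = (g \<circ> s b) v" using refl_uminus refl_refl[OF ar(1)] by simp
    qed
    then have "card (neg_set (g \<circ> s b)) < card (neg_set ?x)" using card_neg_set_refl_less[OF x \<tau>] by simp
    moreover have "card (neg_set g) \<le> card (neg_set (g \<circ> s b)) + 1" using extremal_iff_card[OF g bN] ext by simp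
    moreover have "card (neg_set ?g') \<le> card (neg_set g) + 1"
      unfolding N' using finite_neg_set[OF g] by (metis Suc_eq_plus1 card_image_le card_insert_le_m1 card_insert_if finite_imageI le_SucI not_less_eq_eq)
    ultimately show "extremal ?g' (s a ?\<gamma>)" using extremal_iff_card[OF g' s\<gamma>] by linarith
  qed
  then have \<gamma>small: "?\<gamma> \<in> small" using small_reflect[OF a g \<gamma>N] by blast
  show False
  proof (cases "\<kappa> < 1")
    case False
    then have k1: "1 \<le> \<kappa>" by simp
    have up: "ht (?d i) < ht (?d (Suc i))" "0 < ht (?d (Suc i))" for i using inc[OF k1] by (auto simp: strict_mono_Suc_iff)
    \<comment> \<open>In an infinite dihedral subsystem every root of the chain dominates \<open>b\<close>.\<close>
    have "dom (?d (Suc i)) b" for i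
    proof (induction i)
      case (Suc i)
      have "1 \<le> B (?d (Suc (Suc i))) (?d (Suc i))"
        using chain_root[OF na b(2), of "Suc i"] k1 Bk sym_B by metis
      then have "dom (?d (Suc (Suc i))) (?d (Suc i))"
        using dom_by_height posI dr up less_imp_le by metis
      then show ?case using Suc dom_trans by blast
    qed (simp add: dom_refl)
    then have "?\<gamma> = b" using \<gamma>small b(1) by (auto simp: small_def)
    moreover have "ht b < ht ?\<gamma>" using inc[OF k1] strict_monoD[of "\<lambda>n. ht (?d n)" "Suc 0" "Suc (Suc k)"] by simp
    ultimately show False by simp
  next
    case True
    \<comment> \<open>The coefficients of \<open>b\<close> cannot stay positive. As there is no overshoot, the first one that is not positive is zero,
      and the chain ends with \<open>a\<close> after finitely many steps.\<close>
    have "\<exists>i. cheb \<kappa> (Suc i) \<le> 0"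
    proof (rule ccontr)
      assume "\<not> ?thesis"
      then have "0 < cheb \<kappa> (Suc i)" for i by (simp add: not_le)
      then show False using recurrence_not_pos[where x = "\<lambda>n. cheb \<kappa> (Suc n)", OF _ True] by simp
    qed
    then obtain i where i: "cheb \<kappa> (Suc i) \<le> 0" and least: "\<And>j. j < i \<Longrightarrow> 0 < cheb \<kappa> (Suc j)"
      using exists_least_iff[of "\<lambda>i. cheb \<kappa> (Suc i) \<le> 0"] by (auto simp: not_le)
    have "i \<noteq> 0" using i by (metis cheb.simps(2) not_one_le_zero)
    then have ci: "0 < cheb \<kappa> i" using least[of "i - 1"] by simp
    then have c0: "cheb \<kappa> (Suc i) = 0" using overshoot[of i] i by force
    interpret finite_dihedral B G \<Phi> \<Delta> ht a b \<kappa> "Suc i"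
    proof
      show "a \<in> \<Delta>" "b \<in> pos" "B a b = - \<kappa>" "0 < \<kappa>" "\<kappa> < 1" using a b Bk \<kappa> True by auto
      show "0 < cheb \<kappa> j" if "0 < j" "j < Suc i" for j
        using that least[of "j - 1"] by simp
      show "cheb \<kappa> (Suc i) = 0" "0 < Suc i" using c0 by auto
    qed
    have "Suc (Suc k) < Suc i"
    proof (rule ccontr)
      assume "\<not> ?thesis"
      then have "0 < cheb \<kappa> (Suc i)" using cpos[of i] by simp
      then show False using c0 by simp
    qed
    then show False using interior_not_small[OF nsmall, of "Suc (Suc k)"] \<gamma>small by simp
  qed
qed

end

section \<open>A linear functional that is positive on the simple roots\<close>

lemma exists_functional_eq_1:
  fixes v :: "'v::real_vector"
  assumes "v \<noteq> 0"
  obtains f :: "'v \<Rightarrow> real" where "linear f" "f v = 1"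
proof -
  have "independent {v}" using assms by simp
  then obtain f where "linear f" "\<forall>x\<in>{v}. f x = (1::real)"
    using linear_independent_extend[of "{v}" "\<lambda>_. 1 :: real"] by blast
  then show ?thesis using that by blast
qed

text \<open>
  Gordan's theorem, by induction on the number of vectors.  A functional that is positive on all but the
  last vector is obtained by induction; if it is not positive on the last one, all vectors are projected along the last
  one.
\<close>

lemma exists_positive_functional:
  fixes x :: "'i \<Rightarrow> 'v::real_vector"
  assumes "finite I"
    and "\<And>c i. \<lbrakk>\<And>j. j \<in> I \<Longrightarrow> 0 \<le> c j; (\<Sum>j\<in>I. (c j :: real) *\<^sub>R x j) = 0; i \<in> I\<rbrakk> \<Longrightarrow> c i = 0"
  shows "\<exists>h :: 'v \<Rightarrow> real. linear h \<and> (\<forall>i\<in>I. 0 < h (x i))"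
  using assms
proof (induction I arbitrary: x rule: finite_induct)
  case empty
  show ?case by (intro exI[of _ "\<lambda>_. 0"]) (simp add: linear_iff)
next
  case (insert k I)
  let ?a = "x k"
  have indep: "c i = 0" if "\<And>j. j \<in> I \<Longrightarrow> 0 \<le> c j" "0 \<le> t" "t *\<^sub>R ?a + (\<Sum>j\<in>I. (c j :: real) *\<^sub>R x j) = 0" "i \<in> I" for c t i
  proof -
    let ?c = "c(k := t)"
    have "(\<Sum>j\<in>I. ?c j *\<^sub>R x j) = (\<Sum>j\<in>I. c j *\<^sub>R x j)" using insert(2) by (intro sum.cong) auto
    then have "(\<Sum>j\<in>insert k I. ?c j *\<^sub>R x j) = 0" using insert(1,2) that(3) by simp
    then have "?c i = 0" using insert(4)[of ?c i] that by fastforce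
    then show ?thesis using insert(2) that(4) by (auto split: if_splits)
  qed
  have a0: "?a \<noteq> 0"
  proof
    assume "?a = 0"
    then have "(\<Sum>j\<in>insert k I. (if j = k then 1 else 0 :: real) *\<^sub>R x j) = 0"
      by (intro sum.neutral) auto
    then have "(if k = k then 1 else 0 :: real) = 0" by (intro insert(4)) auto
    then show False by simp
  qed
  have "\<exists>h :: 'v \<Rightarrow> real. linear h \<and> (\<forall>i\<in>I. 0 < h (x i))"
    using indep[where t = 0] by (intro insert(3)) auto
  then obtain h :: "'v \<Rightarrow> real" where h: "linear h" "\<And>i. i \<in> I \<Longrightarrow> 0 < h (x i)" by blast
  show ?case
  proof (cases "0 < h ?a")
    case True
    then show ?thesis using h by auto
  next
    case False
    obtain f :: "'v \<Rightarrow> real" where f: "linear f" "f ?a = 1" using exists_functional_eq_1[OF a0] by blast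
    \<comment> \<open>The projected vectors remain positively independent because \<open>h (x k) \<le> 0\<close>.\<close>
    define y where "y i = x i - f (x i) *\<^sub>R ?a" for i
    have "\<exists>h :: 'v \<Rightarrow> real. linear h \<and> (\<forall>i\<in>I. 0 < h (y i))"
    proof (rule insert(3))
      fix c i assume c: "\<And>j. j \<in> I \<Longrightarrow> 0 \<le> c j" "(\<Sum>j\<in>I. (c j :: real) *\<^sub>R y j) = 0" "i \<in> I"
      define t where "t = (\<Sum>j\<in>I. c j * f (x j))"
      have "(\<Sum>j\<in>I. c j *\<^sub>R y j) = (\<Sum>j\<in>I. c j *\<^sub>R x j) - t *\<^sub>R ?a"
        by (simp add: y_def t_def scaleR_diff_right sum_subtractf scaleR_sum_left)
      then have e: "(\<Sum>j\<in>I. c j *\<^sub>R x j) = t *\<^sub>R ?a" using c(2) by simp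
      show "c i = 0"
      proof (cases "t \<le> 0")
        case True
        then show ?thesis using indep[where t = "- t" and i = i, OF c(1)] e c(3) by simp
      next
        case t: False
        have "(\<Sum>j\<in>I. c j * h (x j)) = t * h ?a"
          using arg_cong[OF e, of h] by (simp add: linear_sum[OF h(1)] linear_scale[OF h(1)])
        also have "\<dots> \<le> 0" using t False by (simp add: mult_le_0_iff)
        finally have le: "(\<Sum>j\<in>I. c j * h (x j)) \<le> 0" .
        have nn: "0 \<le> c j * h (x j)" if "j \<in> I" for j using c(1) h(2) that by (simp add: less_imp_le)
        have "(\<Sum>j\<in>I. c j * h (x j)) = 0" using le sum_nonneg[of I "\<lambda>j. c j * h (x j)"] nn by force
        then have "c i * h (x i) = 0" using nn insert(1) c(3) by (simp add: sum_nonneg_eq_0_iff)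
        then show ?thesis using h(2)[OF c(3)] by simp
      qed
    qed
    then obtain h' :: "'v \<Rightarrow> real" where h': "linear h'" "\<And>i. i \<in> I \<Longrightarrow> 0 < h' (y i)" by blast
    define p where "p v = h' (v - f v *\<^sub>R ?a)" for v
    have p_lin: "linear p" unfolding p_def
      by (rule linearI) (simp_all add: linear_add[OF f(1)] linear_scale[OF f(1)] linear_add[OF h'(1)] linear_scale[OF h'(1)] linear_diff[OF h'(1)] algebra_simps)
    have p: "0 < p (x i)" if "i \<in> I" for i using h'(2)[OF that] by (simp add: p_def y_def)
    have pa: "p ?a = 0" using f(2) linear_0[OF h'(1)] by (simp add: p_def)
    \<comment> \<open>A small multiple of \<open>f\<close> makes the value at \<open>x k\<close> positive without spoiling the others.\<close>
    obtain e where e: "0 < e" "\<And>i. i \<in> I \<Longrightarrow> 0 < p (x i) + e * f (x i)"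
    proof -
      define e where "e = Min (insert 1 ((\<lambda>i. p (x i) / (\<bar>f (x i)\<bar> + 1)) ` I)) / 2"
      have fin: "finite (insert 1 ((\<lambda>i. p (x i) / (\<bar>f (x i)\<bar> + 1)) ` I))" using insert(1) by simp
      have "0 < 2 * e" unfolding e_def using fin p by (auto simp: Min_gr_iff intro!: divide_pos_pos)
      then have e0: "0 < e" by simp
      have "0 < p (x i) + e * f (x i)" if i: "i \<in> I" for i
      proof -
        have "2 * e \<le> p (x i) / (\<bar>f (x i)\<bar> + 1)" unfolding e_def using fin i by (auto intro!: Min_le)
        then have "e < p (x i) / (\<bar>f (x i)\<bar> + 1)" using e0 by linarith
        then have lt: "e * (\<bar>f (x i)\<bar> + 1) < p (x i)" by (simp add: pos_less_divide_eq)
        have "e * (- f (x i)) \<le> e * (\<bar>f (x i)\<bar> + 1)" using e0 by (intro mult_left_mono) auto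
        then show ?thesis using lt by simp
      qed
      then show ?thesis using that e0 by blast
    qed
    have lin: "linear (\<lambda>v. p v + e * f v)"
      by (rule linearI) (simp_all add: linear_add[OF f(1)] linear_scale[OF f(1)] linear_add[OF p_lin] linear_scale[OF p_lin] algebra_simps)
    show ?thesis using lin e pa f(2) by (intro exI[of _ "\<lambda>v. p v + e * f v"]) auto
  qed
qed

section \<open>Words and length\<close>

context coxeter_system
begin

lemma word_prod_Nil [simp]: "word_prod W [] = \<one>" and word_prod_Cons [simp]: "word_prod W (x # xs) = x \<otimes> word_prod W xs"
  by (simp_all add: word_prod_def)

lemma word_prod_closed [simp]: "set ws \<subseteq> S \<Longrightarrow> word_prod W ws \<in> carrier W"
  by (induction ws) (use gens_closed in auto)

lemma word_prod_append: "set us \<subseteq> S \<Longrightarrow> set vs \<subseteq> S \<Longrightarrow> word_prod W (us @ vs) = word_prod W us \<otimes> word_prod W vs"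
  by (induction us) (use gens_closed in \<open>auto simp: m_assoc\<close>)

lemma gen_carrier: "s \<in> S \<Longrightarrow> s \<in> carrier W" using gens_closed by auto

lemma gen_square: assumes "s \<in> S" shows "s \<otimes> s = \<one>"
proof -
  have c: "s \<in> carrier W" using assms gen_carrier by blast
  have "s [^] (2::nat) = \<one>" using pow_ord_eq_1[OF c] gens_order[OF assms] by simp
  then show ?thesis using c by (simp add: numeral_2_eq_2)
qed

lemma gen_inv: "s \<in> S \<Longrightarrow> inv s = s"
  using gen_square gen_carrier inv_equality by blast

lemma gen_cancel: "s \<in> S \<Longrightarrow> w \<in> carrier W \<Longrightarrow> w \<otimes> s \<otimes> s = w" "s \<in> S \<Longrightarrow> w \<in> carrier W \<Longrightarrow> s \<otimes> (s \<otimes> w) = w"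
  using gen_square gen_carrier by (simp_all add: m_assoc flip: m_assoc[of s s w])

lemma word_exists:
  assumes "w \<in> carrier W"
  shows "\<exists>ws. set ws \<subseteq> S \<and> word_prod W ws = w"
proof -
  have "w \<in> generate W S" using assms gens_generate by simp
  then show ?thesis
  proof (induction rule: generate.induct)
    case one
    show ?case by (intro exI[of _ "[]"]) simp
  next
    case (incl h)
    then show ?case using gen_carrier by (intro exI[of _ "[h]"]) simp
  next
    case (inv h)
    then show ?case using gen_carrier gen_inv by (intro exI[of _ "[h]"]) simp
  next
    case (eng h1 h2)
    then obtain us vs where "set us \<subseteq> S" "word_prod W us = h1" "set vs \<subseteq> S" "word_prod W vs = h2" by blast
    then show ?case using word_prod_append[of us vs] by (intro exI[of _ "us @ vs"]) simp
  qed
qed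

lemma reduced_word:
  assumes "w \<in> carrier W"
  obtains ws where "set ws \<subseteq> S" "length ws = len w" "word_prod W ws = w"
proof -
  obtain us where "set us \<subseteq> S" "word_prod W us = w" using word_exists assms by blast
  then have "\<exists>n ws. set ws \<subseteq> S \<and> length ws = n \<and> word_prod W ws = w" by blast
  then have "\<exists>ws. set ws \<subseteq> S \<and> length ws = len w \<and> word_prod W ws = w" unfolding len_def by (rule LeastI_ex)
  then show ?thesis using that by blast
qed

lemma len_le: "set ws \<subseteq> S \<Longrightarrow> len (word_prod W ws) \<le> length ws"
  unfolding len_def by (rule Least_le) blast

lemma len_mult:
  assumes "u \<in> carrier W" "v \<in> carrier W"
  shows "len (u \<otimes> v) \<le> len u + len v"
proof -
  obtain us where us: "set us \<subseteq> S" "length us = len u" "word_prod W us = u" using reduced_word assms by blast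
  obtain vs where vs: "set vs \<subseteq> S" "length vs = len v" "word_prod W vs = v" using reduced_word assms by blast
  show ?thesis using len_le[of "us @ vs"] us vs by (simp add: word_prod_append)
qed

lemma len_one: "len \<one> = 0"
  using len_le[of "[]"] by simp

lemma len_gen: "s \<in> S \<Longrightarrow> len s \<le> 1"
  using len_le[of "[s]"] gen_carrier by simp

lemma inv_word_prod: "set ws \<subseteq> S \<Longrightarrow> inv (word_prod W ws) = word_prod W (rev ws)"
proof (induction ws)
  case (Cons x xs)
  then have "x \<in> S" "x \<in> carrier W" using gen_carrier by auto
  then show ?case using Cons by (simp add: inv_mult_group gen_inv word_prod_append)
qed simp

lemma len_inv:
  assumes "w \<in> carrier W"
  shows "len (inv w) = len w"
proof -
  have le: "len (inv w) \<le> len w" if "w \<in> carrier W" for w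
  proof -
    from that obtain ws where ws: "set ws \<subseteq> S" "length ws = len w" "word_prod W ws = w"
      by (rule reduced_word)
    then show ?thesis using len_le[of "rev ws"] inv_word_prod[of ws] by simp
  qed
  show ?thesis using le[OF assms] le[of "inv w"] assms by simp
qed

lemma right_descent:
  assumes "w \<in> carrier W" "w \<noteq> \<one>"
  obtains s where "s \<in> S" "len (w \<otimes> s) < len w"
proof -
  obtain ws where ws: "set ws \<subseteq> S" "length ws = len w" "word_prod W ws = w" using reduced_word assms by blast
  then have "ws \<noteq> []" using assms by auto
  then obtain us s where us: "ws = us @ [s]" by (meson rev_exhaust)
  then have s: "s \<in> S" "set us \<subseteq> S" using ws by auto
  have "w = word_prod W us \<otimes> s" using ws(3) us s word_prod_append[of us "[s]"] gen_carrier by simp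
  then have "w \<otimes> s = word_prod W us" using s gen_cancel by simp
  then have "len (w \<otimes> s) < len w" using len_le[OF s(2)] ws(2) us by simp
  then show ?thesis using that s by blast
qed

lemma left_descent:
  assumes "w \<in> carrier W" "w \<noteq> \<one>"
  obtains s where "s \<in> S" "len (s \<otimes> w) < len w"
proof -
  have "inv w \<noteq> \<one>" using assms by (metis inv_inv inv_one)
  then obtain s where s: "s \<in> S" "len (inv w \<otimes> s) < len (inv w)" using right_descent assms by (metis inv_closed)
  have "inv (s \<otimes> w) = inv w \<otimes> s" using s gen_inv gen_carrier assms by (simp add: inv_mult_group)
  then show ?thesis using that s len_inv assms gen_carrier by (metis m_closed)
qed

end

section \<open>Roots are positive or negative\<close>

lemma cheb_sin: "cheb (cos \<theta>) n * sin \<theta> = sin (real n * \<theta>) \<and> cheb (cos \<theta>) (Suc n) * sin \<theta> = sin (real (Suc n) * \<theta>)"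
proof (induction n)
  case (Suc n)
  have "sin (real (Suc (Suc n)) * \<theta>) + sin (real n * \<theta>) = 2 * cos \<theta> * sin (real (Suc n) * \<theta>)"
  proof -
    have "real (Suc (Suc n)) * \<theta> = real (Suc n) * \<theta> + \<theta>" "real n * \<theta> = real (Suc n) * \<theta> - \<theta>"
      by (simp_all add: algebra_simps)
    then show ?thesis by (simp only: sin_add sin_diff) (simp add: algebra_simps)
  qed
  then show ?case using Suc by (simp add: algebra_simps)
qed simp

lemma cheb_cos_pi:
  assumes "2 \<le> m"
  shows "n \<le> m \<Longrightarrow> 0 \<le> cheb (cos (pi / real m)) n"
    and "cheb (cos (pi / real m)) m = 0" and "cheb (cos (pi / real m)) (Suc m) = - 1"
proof -
  let ?t = "pi / real m"
  have t: "0 < ?t" "?t < pi" using assms by (simp_all add: field_simps)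
  then have st: "0 < sin ?t" by (rule sin_gt_zero)
  show "0 \<le> cheb (cos ?t) n" if "n \<le> m"
  proof -
    have "real n * ?t \<le> pi" using that assms by (simp add: field_simps)
    then have "0 \<le> sin (real n * ?t)" using t by (intro sin_ge_zero) auto
    then have "0 \<le> cheb (cos ?t) n * sin ?t" using cheb_sin by simp
    then show ?thesis using st by (simp add: zero_le_mult_iff)
  qed
  have e: "real m * ?t = pi" "real (Suc m) * ?t = pi + ?t" using assms by (simp_all add: field_simps)
  have "cheb (cos ?t) m * sin ?t = 0" using cheb_sin[of ?t m] e by simp
  then show "cheb (cos ?t) m = 0" using st by simp
  have "cheb (cos ?t) (Suc m) * sin ?t = - 1 * sin ?t" using cheb_sin[of ?t m] e by simp
  then show "cheb (cos ?t) (Suc m) = - 1" using st by (simp only: mult_right_cancel)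
qed

lemma cheb_nonneg:
  assumes "1 \<le> \<kappa>"
  shows "0 \<le> cheb \<kappa> n"
proof (cases n)
  case (Suc k)
  have "0 < cheb \<kappa> (Suc k)"
    using recurrence_mono[where x = "cheb \<kappa>" and b = \<kappa> and n = k] assms by simp
  then show ?thesis using Suc by simp
qed simp

context geometric_representation
begin

lemma rho_linear: "w \<in> carrier W \<Longrightarrow> linear (\<rho> w)"
  and rho_bij: "w \<in> carrier W \<Longrightarrow> bij (\<rho> w)"
  and rho_isometry: "w \<in> carrier W \<Longrightarrow> B (\<rho> w x) (\<rho> w y) = B x y"
  using rep_hom by (auto simp: hom_def isometry_group_def Pi_iff)

lemma rho_mult: "u \<in> carrier W \<Longrightarrow> v \<in> carrier W \<Longrightarrow> \<rho> (u \<otimes> v) = \<rho> u \<circ> \<rho> v"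
  using rep_hom by (auto simp: hom_def isometry_group_def)

lemma rho_one: "\<rho> \<one> = id"
proof
  fix v
  have "\<rho> \<one> (\<rho> \<one> v) = \<rho> \<one> v" using rho_mult[of \<one> \<one>] by (simp add: fun_eq_iff)
  then show "\<rho> \<one> v = id v" using rho_bij[of \<one>] by (simp add: bij_def inj_eq)
qed

lemma rho_inv: "w \<in> carrier W \<Longrightarrow> \<rho> w (\<rho> (inv w) v) = v" "w \<in> carrier W \<Longrightarrow> \<rho> (inv w) (\<rho> w v) = v"
  using rho_mult[of w "inv w"] rho_mult[of "inv w" w] rho_one by (simp_all add: fun_eq_iff)

lemma rho_gen: "t \<in> S \<Longrightarrow> \<rho> t = refl B (\<alpha> t)"
  using rep_gens by (auto simp: refl_def)

lemmas Bs = bilinear_simps[OF form_bilinear]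

lemma simple_norm': "t \<in> S \<Longrightarrow> B (\<alpha> t) (\<alpha> t) = 1"
  using simple_norm by blast

lemma simple_nonpos:
  assumes "t \<in> S" "r \<in> S" "t \<noteq> r"
  shows "B (\<alpha> t) (\<alpha> r) \<le> 0"
proof -
  have "\<alpha> t \<noteq> \<alpha> r" using assms simple_inj by (auto dest: inj_onD)
  then have "B (\<alpha> t) (\<alpha> r) \<in> {..-1} \<union> {- cos (pi / real k) | k :: nat. 2 \<le> k}"
    using simple_distinct assms by blast
  then consider "B (\<alpha> t) (\<alpha> r) \<le> -1" | k where "2 \<le> k" "B (\<alpha> t) (\<alpha> r) = - cos (pi / real k)" by auto
  then show ?thesis
  proof cases
    case 2
    have "0 \<le> pi / real k" "pi / real k \<le> pi / 2" using 2(1) by (simp_all add: field_simps)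
    then have "0 \<le> cos (pi / real k)" by (intro cos_ge_zero) linarith+
    then show ?thesis using 2 by simp
  qed simp
qed

lemma rho_conj_refl:
  assumes w: "w \<in> carrier W" and t: "t \<in> S"
  shows "\<rho> (w \<otimes> t \<otimes> inv w) = refl B (\<rho> w (\<alpha> t))"
proof
  fix v
  have tc: "t \<in> carrier W" using t gen_carrier by blast
  have "\<rho> (w \<otimes> t \<otimes> inv w) v = \<rho> w (\<rho> t (\<rho> (inv w) v))" using w tc by (simp add: rho_mult)
  also have "\<dots> = \<rho> w (\<rho> (inv w) v) - (2 * B (\<alpha> t) (\<rho> (inv w) v)) *\<^sub>R \<rho> w (\<alpha> t)"
    using rho_linear[OF w] by (simp add: rep_gens[OF t] linear_diff linear_scale)
  also have "B (\<alpha> t) (\<rho> (inv w) v) = B (\<rho> w (\<alpha> t)) v"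
    using rho_isometry[OF w, of "\<alpha> t" "\<rho> (inv w) v"] rho_inv(1)[OF w] by simp
  finally show "\<rho> (w \<otimes> t \<otimes> inv w) v = refl B (\<rho> w (\<alpha> t)) v"
    using rho_inv(1)[OF w] by (simp add: refl_def)
qed

text \<open>
  The word \<open>... r t\<close> of length \<open>n\<close> that alternates between \<open>t\<close> and \<open>r\<close> and ends with \<open>t\<close>.
\<close>

fun alternating :: "'w \<Rightarrow> 'w \<Rightarrow> nat \<Rightarrow> 'w"
  where
    "alternating r t 0 = \<one>"
  | "alternating r t (Suc n) = (if even n then t else r) \<otimes> alternating r t n"

lemma alternating_closed: "r \<in> S \<Longrightarrow> t \<in> S \<Longrightarrow> alternating r t n \<in> carrier W"
  by (induction n) (use gen_carrier in auto)

lemma len_alternating: "r \<in> S \<Longrightarrow> t \<in> S \<Longrightarrow> len (alternating r t n) \<le> n"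
proof (induction n)
  case (Suc n)
  let ?x = "if even n then t else r"
  have x: "?x \<in> S" using Suc(2,3) by simp
  have "len (alternating r t (Suc n)) \<le> len ?x + len (alternating r t n)"
    using len_mult[OF gen_carrier[OF x] alternating_closed[OF Suc(2,3)]] by simp
  then show ?case using len_gen[OF x] Suc by simp
qed (simp add: len_one)

lemma rho_alternating:
  assumes "r \<in> S" "t \<in> S"
  shows "\<rho> (alternating r t n) (\<alpha> r)
    = cheb (- B (\<alpha> r) (\<alpha> t)) (Suc n) *\<^sub>R \<alpha> (if even n then r else t)
      + cheb (- B (\<alpha> r) (\<alpha> t)) n *\<^sub>R \<alpha> (if even n then t else r)"
proof (induction n)
  case 0
  then show ?case by (simp add: rho_one)
next
  case (Suc n)
  let ?k = "- B (\<alpha> r) (\<alpha> t)" and ?p = "if even n then r else t" and ?q = "if even n then t else r"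
  have q: "?q \<in> S" "?p \<in> S" using assms by auto
  have Bq: "B (\<alpha> ?q) (\<alpha> ?p) = - ?k" "B (\<alpha> ?q) (\<alpha> ?q) = 1" using form_symmetric simple_norm' q by auto
  have "\<rho> (alternating r t (Suc n)) (\<alpha> r) = \<rho> ?q (\<rho> (alternating r t n) (\<alpha> r))"
    using rho_mult gen_carrier q alternating_closed[OF assms] by simp
  also have "\<dots> = refl B (\<alpha> ?q) (cheb ?k (Suc n) *\<^sub>R \<alpha> ?p + cheb ?k n *\<^sub>R \<alpha> ?q)"
    unfolding Suc rho_gen[OF q(1)] ..
  also have "\<dots> = cheb ?k (Suc n) *\<^sub>R \<alpha> ?p
      + (cheb ?k n - 2 * (cheb ?k (Suc n) * (- ?k) + cheb ?k n)) *\<^sub>R \<alpha> ?q"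
    unfolding refl_def by (simp only: Bs Bq real_scaleR_def mult_1_right scaleR_diff_left add_diff_eq)
  also have "cheb ?k n - 2 * (cheb ?k (Suc n) * (- ?k) + cheb ?k n) = cheb ?k (Suc (Suc n))"
    by (simp add: algebra_simps)
  finally show ?case by (simp add: add.commute)
qed

text \<open>
  Split off from \<open>w\<close> the longest alternating suffix in \<open>r\<close> and \<open>t\<close>, where \<open>t\<close> is a right descent of \<open>w\<close>.  The rest \<open>v\<close>
  is shorter and has neither \<open>r\<close> nor \<open>t\<close> as a right descent, so that it maps \<open>\<alpha> r\<close> and \<open>\<alpha> t\<close> into the cone by
  induction.  The suffix maps \<open>\<alpha> r\<close> to a combination of \<open>\<alpha> r\<close> and \<open>\<alpha> t\<close>, whose coefficients are nonnegative
  because the suffix is shorter than the order of \<open>r t\<close>.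
\<close>

lemma simple_image_positive:
  assumes "w \<in> carrier W" "r \<in> S" "len w \<le> len (w \<otimes> r)"
  shows "\<rho> w (\<alpha> r) \<in> cone_of (\<alpha> ` S)"
  using assms
proof (induction "len w" arbitrary: w r rule: less_induct)
  case less
  show ?case
  proof (cases "w = \<one>")
    case True
    then show ?thesis using less(3) cone_of_incl[of "\<alpha> r" "\<alpha> ` S"] by (simp add: rho_one)
  next
    case False
    then obtain t where t: "t \<in> S" "len (w \<otimes> t) < len w" using right_descent less(2) by blast
    then have rt: "r \<noteq> t" using less(4) by auto
    note rc = gen_carrier[OF less(3)] and tc = gen_carrier[OF t(1)] and wc = less(2)
    let ?b = "alternating r t" and ?\<kappa> = "- B (\<alpha> r) (\<alpha> t)"
    have bc: "?b n \<in> carrier W" for n using alternating_closed less(3) t(1) .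
    define valid where "valid n \<longleftrightarrow> len (w \<otimes> inv (?b n)) + n \<le> len w" for n
    have "\<not> valid (Suc (len w))" by (simp add: valid_def)
    then obtain n where n: "\<not> valid n" "\<And>i. i < n \<Longrightarrow> valid i" using exists_least_iff[of "\<lambda>n. \<not> valid n"] by blast
    have v01: "valid 0" "valid 1" using t wc tc by (auto simp: valid_def gen_inv[OF t(1)])
    have n0: "n \<noteq> 0" by (rule notI) (use v01(1) n(1) in simp)
    have n1: "n \<noteq> 1" by (rule notI) (use v01(2) n(1) in simp)
    define k where "k = n - 2"
    have k: "n = Suc (Suc k)" using n0 n1 by (simp add: k_def)
    note [simp del] = alternating.simps(2)
    note b_Suc = alternating.simps(2)[of r t]
    define v where "v = w \<otimes> inv (?b (Suc k))"
    have vc: "v \<in> carrier W" using wc bc by (simp add: v_def)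
    have wv: "w = v \<otimes> ?b (Suc k)" using wc bc by (simp add: v_def m_assoc)
    have lv: "len v + Suc k \<le> len w" using n(2)[of "Suc k"] k by (simp add: valid_def v_def)
    let ?x = "if even (Suc k) then t else r" and ?y = "if even k then t else r"
    have xy: "?x \<in> S" "?y \<in> S" "?x \<in> carrier W" "?y \<in> carrier W" using less(3) t rc tc by auto
    have len_b: "len (?b i) \<le> i" for i using len_alternating[OF less(3) t(1)] .
    have "len v \<le> len (v \<otimes> ?x)"
    proof (rule ccontr)
      assume "\<not> ?thesis"
      then have lt: "len (v \<otimes> ?x) < len v" by simp
      have "inv (?b n) = inv (?b (Suc k)) \<otimes> ?x"
        unfolding k b_Suc[of "Suc k"] using bc xy gen_inv by (simp only: inv_mult_group)
      then have "w \<otimes> inv (?b n) = v \<otimes> ?x" unfolding v_def using wc bc xy by (simp add: m_assoc)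
      then have "valid n" using lt lv k by (simp add: valid_def)
      then show False using n by blast
    qed
    then have px: "\<rho> v (\<alpha> ?x) \<in> cone_of (\<alpha> ` S)" using less(1)[OF _ vc xy(1)] lv by simp
    have "len v \<le> len (v \<otimes> ?y)"
    proof (rule ccontr)
      assume "\<not> ?thesis"
      then have lt: "len (v \<otimes> ?y) < len v" by simp
      have "w = (v \<otimes> ?y) \<otimes> ?b k" unfolding wv b_Suc[of k] using vc bc xy by (simp only: m_assoc)
      then have "len w \<le> len (v \<otimes> ?y) + len (?b k)" using len_mult vc bc xy by (metis m_closed)
      then show False using lt lv len_b[of k] by linarith
    qed
    then have py: "\<rho> v (\<alpha> ?y) \<in> cone_of (\<alpha> ` S)" using less(1)[OF _ vc xy(2)] lv by simp
    have pv: "\<rho> v (\<alpha> r) \<in> cone_of (\<alpha> ` S)" "\<rho> v (\<alpha> t) \<in> cone_of (\<alpha> ` S)"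
      using px py by (auto split: if_splits)
    have "\<alpha> r \<noteq> \<alpha> t" using rt less(3) t(1) simple_inj by (auto dest: inj_onD)
    then have "B (\<alpha> r) (\<alpha> t) \<in> {..-1} \<union> {- cos (pi / real m) | m :: nat. 2 \<le> m}"
      using simple_distinct less(3) t(1) by blast
    then consider "1 \<le> ?\<kappa>" | m where "2 \<le> m" "?\<kappa> = cos (pi / real m)" by auto
    then have "0 \<le> cheb ?\<kappa> (Suc (Suc k)) \<and> 0 \<le> cheb ?\<kappa> (Suc k)"
    proof cases
      case 1
      then show ?thesis using cheb_nonneg by blast
    next
      case 2
      have "Suc k < m"
      proof (rule ccontr)
        \<comment> \<open>If the suffix had length \<open>m\<close>, the braid relation would make \<open>w \<otimes> r\<close> shorter than \<open>w\<close>.\<close>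
        assume "\<not> ?thesis"
        then have "valid m" using n(2)[of m] k by simp
        then have lm: "len (w \<otimes> inv (?b m)) + m \<le> len w" by (simp add: valid_def)
        obtain m' where m': "m = Suc m'" using 2(1) by (cases m) auto
        let ?p = "if even m then r else t"
        have p: "?p \<in> S" "?p \<in> carrier W" using less(3) t rc tc by auto
        have "\<rho> (?b m) (\<alpha> r) = - \<alpha> ?p"
          using rho_alternating[OF less(3) t(1), of m] cheb_cos_pi(2,3)[OF 2(1)] 2(2) by simp
        then have "\<rho> (?b m \<otimes> r \<otimes> inv (?b m)) = refl B (- \<alpha> ?p)"
          using rho_conj_refl[OF bc less(3)] by simp
        also have "\<dots> = \<rho> ?p" unfolding rho_gen[OF p(1)] by (auto simp: refl_def Bs)
        finally have conj: "?b m \<otimes> r \<otimes> inv (?b m) = ?p"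
          using bc[of m] rc p by (intro inj_onD[OF rep_faithful]) simp_all
        have "?b m \<otimes> r = (?b m \<otimes> r \<otimes> inv (?b m)) \<otimes> ?b m" using bc[of m] rc by (simp add: m_assoc)
        also have "\<dots> = ?p \<otimes> ?b m" unfolding conj ..
        also have "\<dots> = ?b m'" unfolding m' b_Suc[of m'] using gen_cancel(2)[OF _ bc] less(3) t(1) by simp
        finally have br: "?b m \<otimes> r = ?b m'" .
        have "inv (?b m) \<otimes> (?b m \<otimes> r) = r" using bc[of m] rc by (simp flip: m_assoc)
        then have "w \<otimes> r = (w \<otimes> inv (?b m)) \<otimes> (?b m \<otimes> r)" using wc bc[of m] rc by (simp add: m_assoc)
        then have "w \<otimes> r = (w \<otimes> inv (?b m)) \<otimes> ?b m'" unfolding br .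
        then have "len (w \<otimes> r) \<le> len (w \<otimes> inv (?b m)) + len (?b m')" using len_mult wc bc by simp
        then show False using lm len_b[of m'] less(4) m' by linarith
      qed
      then show ?thesis unfolding 2(2)
        using cheb_cos_pi(1)[OF 2(1), of "Suc (Suc k)"] cheb_cos_pi(1)[OF 2(1), of "Suc k"]
        by (simp del: cheb.simps)
    qed
    then have "cheb ?\<kappa> (Suc (Suc k)) *\<^sub>R \<rho> v (\<alpha> (if even (Suc k) then r else t))
      + cheb ?\<kappa> (Suc k) *\<^sub>R \<rho> v (\<alpha> (if even (Suc k) then t else r)) \<in> cone_of (\<alpha> ` S)"
      using pv by (intro cone_of_add cone_of_scale) auto
    moreover have "\<rho> w (\<alpha> r) = cheb ?\<kappa> (Suc (Suc k)) *\<^sub>R \<rho> v (\<alpha> (if even (Suc k) then r else t))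
      + cheb ?\<kappa> (Suc k) *\<^sub>R \<rho> v (\<alpha> (if even (Suc k) then t else r))"
    proof -
      have "\<rho> w (\<alpha> r) = \<rho> v (\<rho> (?b (Suc k)) (\<alpha> r))" unfolding wv using rho_mult[OF vc bc] by simp
      then show ?thesis using rho_alternating[OF less(3) t(1), of "Suc k"] rho_linear[OF vc]
        by (simp only: linear_add linear_scale)
    qed
    ultimately show ?thesis by simp
  qed
qed

end

section \<open>The height of a root\<close>

context geometric_representation
begin

text \<open>
  The simple roots may be linearly dependent, so the sum of coefficients is not available as a height; any
  linear functional that is positive on them serves.
\<close>

definition height :: "'v \<Rightarrow> real"
  where "height = (SOME h. linear h \<and> (\<forall>\<delta>\<in>\<alpha> ` S. 0 < h \<delta>))"

lemma height_linear: "linear height" and height_simple: "t \<in> S \<Longrightarrow> 0 < height (\<alpha> t)"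
proof -
  have "\<exists>h :: 'v \<Rightarrow> real. linear h \<and> (\<forall>\<delta>\<in>\<alpha> ` S. 0 < h \<delta>)"
    using exists_positive_functional[OF finite_simple, of "\<lambda>\<delta>. \<delta>"] simple_pos_independent by blast
  then have *: "linear height \<and> (\<forall>\<delta>\<in>\<alpha> ` S. 0 < height \<delta>)" unfolding height_def by (rule someI_ex)
  show "linear height" using * by blast
  show "t \<in> S \<Longrightarrow> 0 < height (\<alpha> t)" using * by blast
qed

lemma height_uminus: "height (- v) = - height v"
  by (rule linear_neg[OF height_linear])

lemma height_cone:
  assumes "p \<in> cone_of (\<alpha> ` S)"
  shows "0 \<le> height p" and "height p = 0 \<Longrightarrow> p = 0"
  using cone_of_functional[OF assms height_linear] height_simple by auto

lemma rootsI: "w \<in> carrier W \<Longrightarrow> t \<in> S \<Longrightarrow> \<rho> w (\<alpha> t) \<in> roots"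
  by (auto simp: roots_def)

lemma rootsE:
  assumes "\<beta> \<in> roots"
  obtains w t where "w \<in> carrier W" "t \<in> S" "\<beta> = \<rho> w (\<alpha> t)"
  using assms by (auto simp: roots_def)

lemma root_norm_1:
  assumes "\<beta> \<in> roots"
  shows "B \<beta> \<beta> = 1"
  using rootsE[OF assms] rho_isometry simple_norm' by metis

lemma root_cone_or_neg:
  assumes "\<beta> \<in> roots"
  shows "\<beta> \<in> cone_of (\<alpha> ` S) \<or> - \<beta> \<in> cone_of (\<alpha> ` S)"
proof -
  obtain w t where w: "w \<in> carrier W" "t \<in> S" "\<beta> = \<rho> w (\<alpha> t)" using rootsE[OF assms] .
  note tc = gen_carrier[OF w(2)]
  show ?thesis
  proof (cases "len w \<le> len (w \<otimes> t)")
    case True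
    then show ?thesis using simple_image_positive w by blast
  next
    case False
    then have "len (w \<otimes> t) \<le> len (w \<otimes> t \<otimes> t)" using gen_cancel(1)[OF w(2,1)] by simp
    then have c: "\<rho> (w \<otimes> t) (\<alpha> t) \<in> cone_of (\<alpha> ` S)" using simple_image_positive w tc by blast
    have "\<rho> t (\<alpha> t) = - \<alpha> t" using simple_norm'[OF w(2)] rep_gens[OF w(2), of "\<alpha> t"] by (simp add: scaleR_2)
    then have "\<rho> (w \<otimes> t) (\<alpha> t) = - \<beta>" using w tc rho_mult linear_neg[OF rho_linear[OF w(1)]] by simp
    then show ?thesis using c by simp
  qed
qed

lemma height_nonzero:
  assumes "\<beta> \<in> roots"
  shows "height \<beta> \<noteq> 0"
proof
  assume "height \<beta> = 0"
  then have "\<beta> = 0" using root_cone_or_neg[OF assms] height_cone(2)[of \<beta>] height_cone(2)[of "- \<beta>"]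
    by (auto simp: height_uminus)
  then show False using root_norm_1[OF assms] by (simp add: Bs)
qed

lemma root_pos_cone: "\<beta> \<in> roots \<Longrightarrow> 0 < height \<beta> \<longleftrightarrow> \<beta> \<in> cone_of (\<alpha> ` S)"
  using root_cone_or_neg[of \<beta>] height_cone(1)[of \<beta>] height_cone(1)[of "- \<beta>"] height_nonzero[of \<beta>]
  by (auto simp: height_uminus)

lemma rho_root:
  assumes "w \<in> carrier W" "\<beta> \<in> roots"
  shows "\<rho> w \<beta> \<in> roots"
proof -
  obtain u t where u: "u \<in> carrier W" "t \<in> S" "\<beta> = \<rho> u (\<alpha> t)" using rootsE[OF assms(2)] .
  then have "\<rho> w \<beta> = \<rho> (w \<otimes> u) (\<alpha> t)" using assms(1) by (simp add: rho_mult)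
  then show ?thesis using rootsI assms(1) u by simp
qed

lemma uminus_roots:
  assumes "\<beta> \<in> roots"
  shows "- \<beta> \<in> roots"
proof -
  obtain u t where u: "u \<in> carrier W" "t \<in> S" "\<beta> = \<rho> u (\<alpha> t)" using rootsE[OF assms] .
  have "\<rho> t (\<alpha> t) = - \<alpha> t" using simple_norm'[OF u(2)] rep_gens[OF u(2), of "\<alpha> t"] by (simp add: scaleR_2)
  then have "- \<beta> = \<rho> u (\<rho> t (\<alpha> t))" using u linear_neg[OF rho_linear[OF u(1)]] by simp
  then show ?thesis using rho_root[OF u(1) rho_root[OF gen_carrier[OF u(2)]]] rootsI[OF one_closed u(2)]
    by (simp add: rho_one)
qed

text \<open>
  Otherwise \<open>\<beta>\<close> and \<open>- refl B a \<beta>\<close> are both nonnegative combinations of simple roots, and their sum is a multiple of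
  \<open>a = \<alpha> t\<close>.  If the coefficient of \<open>a\<close> in the sum is large enough, positive independence leaves only \<open>a\<close>.
  If it is too small, pairing with \<open>a\<close> gives a contradiction, as \<open>a\<close> has nonpositive pairings with the other simple roots.
\<close>

lemma simple_reflection_permutes:
  assumes t: "t \<in> S" and \<beta>: "\<beta> \<in> roots" "0 < height \<beta>" "\<beta> \<noteq> \<alpha> t"
  shows "0 < height (refl B (\<alpha> t) \<beta>)"
proof (rule ccontr)
  let ?D = "\<alpha> ` S" and ?a = "\<alpha> t"
  assume n: "\<not> ?thesis"
  have r: "refl B ?a \<beta> \<in> roots" using rho_root[OF gen_carrier[OF t] \<beta>(1)] rho_gen[OF t] by simp
  then have "0 < height (- refl B ?a \<beta>)" using n height_nonzero[OF r] by (simp add: height_uminus)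
  then have "- refl B ?a \<beta> \<in> cone_of ?D" using root_pos_cone uminus_roots[OF r] by blast
  then obtain d where d: "\<And>\<delta>. \<delta> \<in> ?D \<Longrightarrow> 0 \<le> d \<delta>" "- refl B ?a \<beta> = (\<Sum>\<delta>\<in>?D. (d \<delta> :: real) *\<^sub>R \<delta>)"
    using cone_of_finite[OF _ finite_simple] by blast
  have "\<beta> \<in> cone_of ?D" using root_pos_cone \<beta> by blast
  then obtain c where c: "\<And>\<delta>. \<delta> \<in> ?D \<Longrightarrow> 0 \<le> c \<delta>" "\<beta> = (\<Sum>\<delta>\<in>?D. (c \<delta> :: real) *\<^sub>R \<delta>)"
    using cone_of_finite[OF _ finite_simple] by blast
  define x where "x = 2 * B ?a \<beta>"
  define e where "e \<delta> = c \<delta> + d \<delta>" for \<delta>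
  have a: "?a \<in> ?D" using t by blast
  have "(\<Sum>\<delta>\<in>?D. e \<delta> *\<^sub>R \<delta>) = \<beta> + - refl B ?a \<beta>"
    unfolding d(2) by (subst c(2)) (simp add: e_def scaleR_add_left sum.distrib)
  also have "\<dots> = x *\<^sub>R ?a" by (simp add: refl_def x_def)
  finally have sum: "(\<Sum>\<delta>\<in>?D. e \<delta> *\<^sub>R \<delta>) = x *\<^sub>R ?a" .
  have split: "(\<Sum>\<delta>\<in>?D. f \<delta>) = f ?a + (\<Sum>\<delta>\<in>?D - {?a}. f \<delta>)" for f :: "'v \<Rightarrow> 'v"
    using sum.remove[OF finite_simple a] .
  show False
  proof (cases "x \<le> e ?a")
    case True
    define e' where "e' = e(?a := e ?a - x)"
    have "(\<Sum>\<delta>\<in>?D. e' \<delta> *\<^sub>R \<delta>) = (e ?a - x) *\<^sub>R ?a + (\<Sum>\<delta>\<in>?D - {?a}. e \<delta> *\<^sub>R \<delta>)"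
      unfolding split by (simp add: e'_def)
    also have "\<dots> = 0" using sum unfolding split by (simp add: algebra_simps)
    finally have z: "(\<Sum>\<delta>\<in>?D. e' \<delta> *\<^sub>R \<delta>) = 0" .
    have nn: "0 \<le> e' \<delta>" if "\<delta> \<in> ?D" for \<delta> using that True c(1) d(1) by (simp add: e'_def e_def)
    have "c \<delta> = 0" if \<delta>: "\<delta> \<in> ?D" "\<delta> \<noteq> ?a" for \<delta>
    proof -
      have "e' \<delta> = 0" by (rule simple_pos_independent[OF nn z \<delta>(1)])
      then show ?thesis using c(1)[OF \<delta>(1)] d(1)[OF \<delta>(1)] \<delta>(2) by (simp add: e'_def e_def)
    qed
    then have b: "\<beta> = c ?a *\<^sub>R ?a" using c(2) unfolding split by simp
    then have "(c ?a)\<^sup>2 = 1" using root_norm_1[OF \<beta>(1)] simple_norm'[OF t] by (simp add: Bs power2_eq_square)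
    then have "c ?a = 1" using c(1)[OF a] by (auto simp: power2_eq_1_iff)
    then show False using b \<beta>(3) by simp
  next
    case False
    have "(x - e ?a) *\<^sub>R ?a = (\<Sum>\<delta>\<in>?D - {?a}. e \<delta> *\<^sub>R \<delta>)" using sum unfolding split by (simp add: algebra_simps)
    then have "B ?a ((x - e ?a) *\<^sub>R ?a) = (\<Sum>\<delta>\<in>?D - {?a}. e \<delta> * B ?a \<delta>)"
      using bilinear_sum[OF form_bilinear, of "\<lambda>_. ?a" "{()}"]
      by (simp add: linear_sum[OF bilinear_def[THEN iffD1, OF form_bilinear, THEN conjunct1, rule_format]] Bs)
    then have "x - e ?a = (\<Sum>\<delta>\<in>?D - {?a}. e \<delta> * B ?a \<delta>)" using simple_norm'[OF t] by (simp add: Bs)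
    also have "\<dots> \<le> 0"
    proof (intro sum_nonpos mult_nonneg_nonpos)
      fix \<delta> assume \<delta>: "\<delta> \<in> ?D - {?a}"
      then show "0 \<le> e \<delta>" using c(1) d(1) by (simp add: e_def)
      obtain r where "r \<in> S" "\<delta> = \<alpha> r" "r \<noteq> t" using \<delta> by blast
      then show "B ?a \<delta> \<le> 0" using simple_nonpos[OF t] by simp
    qed
    finally show False using False by simp
  qed
qed

lemma finite_negative:
  assumes "w \<in> carrier W"
  shows "finite {\<beta> \<in> roots. 0 < height \<beta> \<and> height (\<rho> w \<beta>) < 0}"
  using assms
proof (induction "len w" arbitrary: w rule: less_induct)
  case less
  show ?case
  proof (cases "w = \<one>")
    case True
    have e: "{\<beta> \<in> roots. 0 < height \<beta> \<and> height (\<rho> w \<beta>) < 0} = {}" by (auto simp: True rho_one)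
    show ?thesis unfolding e by (rule finite.emptyI)
  next
    case False
    then obtain t where t: "t \<in> S" "len (w \<otimes> t) < len w" using right_descent less(2) by blast
    note tc = gen_carrier[OF t(1)]
    let ?N = "\<lambda>w. {\<beta> \<in> roots. 0 < height \<beta> \<and> height (\<rho> w \<beta>) < 0}"
    have tt: "\<rho> t (\<rho> t \<beta>) = \<beta>" for \<beta> using rho_inv(2)[OF tc] gen_inv[OF t(1)] by simp
    have "?N w \<subseteq> insert (\<alpha> t) (\<rho> t ` ?N (w \<otimes> t))"
    proof
      fix \<beta> assume \<beta>: "\<beta> \<in> ?N w"
      show "\<beta> \<in> insert (\<alpha> t) (\<rho> t ` ?N (w \<otimes> t))"
      proof (cases "\<beta> = \<alpha> t")
        case False
        then have "\<rho> t \<beta> \<in> ?N (w \<otimes> t)"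
          using \<beta> simple_reflection_permutes[OF t(1), of \<beta>] rho_root[OF tc] less(2) tc tt
          by (simp add: rho_mult rho_gen[OF t(1), symmetric])
        then show ?thesis by (intro insertI2 image_eqI[of _ _ "\<rho> t \<beta>"]) (simp_all only: tt)
      qed simp
    qed
    moreover have "finite (?N (w \<otimes> t))" by (rule less(1)[OF t(2)]) (use less(2) tc in simp)
    then have "finite (insert (\<alpha> t) (\<rho> t ` ?N (w \<otimes> t)))" by (intro finite.insertI finite_imageI)
    ultimately show ?thesis by (rule finite_subset)
  qed
qed

sublocale rs: root_system B "\<rho> ` carrier W" roots "\<alpha> ` S" height
proof (rule root_system.intro)
  show "bilinear B" by (rule form_bilinear)
  show "B x y = B y x" for x y by (rule form_symmetric)
  show "linear height" by (rule height_linear)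
  show "height \<beta> \<noteq> 0" if "\<beta> \<in> roots" for \<beta> using height_nonzero[OF that] .
  show "B \<beta> \<beta> = 1" if "\<beta> \<in> roots" for \<beta> using root_norm_1[OF that] .
  show "id \<in> \<rho> ` carrier W" using rho_one one_closed by (metis image_eqI)
  show "refl B \<beta> \<in> \<rho> ` carrier W" if "\<beta> \<in> roots" for \<beta>
  proof -
    obtain w t where w: "w \<in> carrier W" "t \<in> S" "\<beta> = \<rho> w (\<alpha> t)" using rootsE[OF \<open>\<beta> \<in> roots\<close>] .
    then show ?thesis using rho_conj_refl[OF w(1,2)] gen_carrier[OF w(2)]
      by (intro image_eqI[of _ _ "w \<otimes> t \<otimes> inv w"]) simp_all
  qed
  show "\<exists>g\<in>\<rho> ` carrier W. g \<beta> \<in> \<alpha> ` S" if "\<beta> \<in> roots" for \<beta>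
  proof -
    obtain w t where w: "w \<in> carrier W" "t \<in> S" "\<beta> = \<rho> w (\<alpha> t)" using rootsE[OF \<open>\<beta> \<in> roots\<close>] .
    then show ?thesis using rho_inv(2)[OF w(1)] by (intro bexI[of _ "\<rho> (inv w)"]) auto
  qed
  fix a assume "a \<in> \<alpha> ` S"
  then obtain t where t: "t \<in> S" "a = \<alpha> t" by blast
  show "a \<in> roots" using rootsI[OF one_closed t(1)] t by (simp add: rho_one)
  show "0 < height a" using height_simple t by simp
  show "0 < height (refl B a \<beta>)" if "\<beta> \<in> roots" "0 < height \<beta>" "\<beta> \<noteq> a" for \<beta>
    using simple_reflection_permutes[OF t(1)] that t(2) by simp
next
  fix g assume "g \<in> \<rho> ` carrier W"
  then obtain w where w: "w \<in> carrier W" "g = \<rho> w" by blast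
  show "linear g" "B (g x) (g y) = B x y" "inj g" for x y
    using w rho_linear rho_isometry rho_bij bij_is_inj by blast+
  show "g \<beta> \<in> roots" if "\<beta> \<in> roots" for \<beta> using rho_root w that by blast
  show "finite {\<beta> \<in> roots. 0 < height \<beta> \<and> height (g \<beta>) < 0}" using finite_negative w by simp
  show "g \<circ> g' \<in> \<rho> ` carrier W" if "g' \<in> \<rho> ` carrier W" for g'
  proof -
    from that obtain w' where w': "w' \<in> carrier W" "g' = \<rho> w'" by blast
    then show ?thesis using w rho_mult[OF w(1) w'(1)] by (intro image_eqI[of _ _ "w \<otimes> w'"]) simp_all
  qed
qed

end

section \<open>Inversion sets and the weak order\<close>

context geometric_representation
begin

abbreviation inv_set :: "'w \<Rightarrow> 'v set" where "inv_set w \<equiv> rs.neg_set (\<rho> (inv w))"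

lemma pos_roots_eq: "pos_roots = rs.pos"
  using root_pos_cone by (auto simp: pos_roots_def rs.pos_def)

lemma inversions_eq:
  assumes w: "w \<in> carrier W"
  shows "inversions w = inv_set w"
proof (intro equalityI subsetI)
  fix \<beta> assume "\<beta> \<in> inversions w"
  then obtain \<gamma> where "\<beta> \<in> rs.pos" "\<gamma> \<in> rs.pos" "\<beta> = \<rho> w (- \<gamma>)"
    by (auto simp: inversions_def neg_roots_def pos_roots_eq)
  then show "\<beta> \<in> inv_set w" using rho_inv(2)[OF w, of "- \<gamma>"]
    by (auto simp: rs.neg_set_def rs.pos_def height_uminus)
next
  fix \<beta> assume \<beta>: "\<beta> \<in> inv_set w"
  note b = rs.neg_setD[OF \<beta>]
  define \<gamma> where "\<gamma> = - \<rho> (inv w) \<beta>"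
  have "\<gamma> \<in> rs.pos"
    unfolding \<gamma>_def using b(4) uminus_roots[OF rho_root[OF inv_closed[OF w] b(2)]]
    by (intro rs.posI) (auto simp: height_uminus)
  moreover have "\<beta> = \<rho> w (- \<gamma>)" unfolding \<gamma>_def using rho_inv(1)[OF w] by simp
  ultimately show "\<beta> \<in> inversions w" using b(1)
    unfolding inversions_def neg_roots_def pos_roots_eq by blast
qed

lemma dominates_eq:
  assumes "\<beta> \<in> rs.pos" "\<gamma> \<in> rs.pos"
  shows "dominates \<beta> \<gamma> \<longleftrightarrow> rs.dom \<beta> \<gamma>"
proof
  assume d: "dominates \<beta> \<gamma>"
  show "rs.dom \<beta> \<gamma>"
    unfolding rs.dom_def
  proof (intro ballI impI)
    fix g assume "g \<in> \<rho> ` carrier W" and neg: "height (g \<beta>) < 0"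
    then obtain u where u: "u \<in> carrier W" "g = \<rho> u" by blast
    have "\<beta> \<in> inversions (inv u)" using assms(1) neg u inversions_eq[of "inv u"] by (simp add: rs.neg_set_def)
    then have "\<gamma> \<in> inversions (inv u)" using d u by (simp add: dominates_def)
    then show "height (g \<gamma>) < 0" using u inversions_eq[of "inv u"] by (simp add: rs.neg_set_def)
  qed
next
  assume d: "rs.dom \<beta> \<gamma>"
  show "dominates \<beta> \<gamma>"
    unfolding dominates_def
  proof (intro ballI impI)
    fix w assume w: "w \<in> carrier W" and "\<beta> \<in> inversions w"
    then have "height (\<rho> (inv w) \<beta>) < 0" using inversions_eq by (simp add: rs.neg_set_def)
    then have "height (\<rho> (inv w) \<gamma>) < 0" using d w by (simp add: rs.dom_def)
    then show "\<gamma> \<in> inversions w" using assms(2) w inversions_eq by (simp add: rs.neg_set_def)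
  qed
qed

lemma small_roots_eq: "small_roots = rs.small"
  unfolding small_roots_def rs.small_def pos_roots_eq using dominates_eq by blast

lemma simple_in_roots: "t \<in> S \<Longrightarrow> \<alpha> t \<in> roots" and simple_in_pos: "t \<in> S \<Longrightarrow> \<alpha> t \<in> rs.pos"
  using rootsI[OF one_closed] height_simple rs.posI by (simp_all add: rho_one)

lemma rho_gen_self: "t \<in> S \<Longrightarrow> \<rho> t (\<alpha> t) = - \<alpha> t"
  using rs.refl_self[OF simple_in_roots] rho_gen by simp

lemma card_neg_set_right:
  assumes u: "u \<in> carrier W" and t: "t \<in> S" and pos: "0 < height (\<rho> u (\<alpha> t))"
  shows "card (rs.neg_set (\<rho> (u \<otimes> t))) = card (rs.neg_set (\<rho> u)) + 1"
proof -
  note tc = gen_carrier[OF t]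
  let ?N = "rs.neg_set (\<rho> u)"
  have fin: "finite ?N" using rs.finite_neg_set u by blast
  have "\<rho> (u \<otimes> t) = \<rho> u \<circ> refl B (\<alpha> t)" using rho_mult[OF u tc] rho_gen[OF t] by simp
  then have e: "rs.neg_set (\<rho> (u \<otimes> t)) = insert (\<alpha> t) (refl B (\<alpha> t) ` ?N)"
    using rs.neg_set_simple[of "\<alpha> t" "\<rho> u"] t u pos by simp
  have "\<alpha> t \<notin> refl B (\<alpha> t) ` ?N"
  proof
    assume "\<alpha> t \<in> refl B (\<alpha> t) ` ?N"
    then obtain \<gamma> where \<gamma>: "\<gamma> \<in> ?N" "\<alpha> t = refl B (\<alpha> t) \<gamma>" by blast
    have "refl B (\<alpha> t) (\<alpha> t) = \<gamma>" using rs.refl_refl[OF simple_in_roots[OF t], of \<gamma>] \<gamma>(2) by simp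
    then have "\<gamma> = - \<alpha> t" using rs.refl_self[OF simple_in_roots[OF t]] by simp
    then show False using rs.neg_setD(3)[OF \<gamma>(1)] height_simple[OF t] by (simp add: height_uminus)
  qed
  moreover have "inj_on (refl B (\<alpha> t)) ?N"
    by (rule inj_on_inverseI[of _ "refl B (\<alpha> t)"]) (rule rs.refl_refl[OF simple_in_roots[OF t]])
  ultimately show ?thesis unfolding e using fin by (simp add: card_image)
qed

lemma len_card:
  assumes "u \<in> carrier W"
  shows "len u = card (rs.neg_set (\<rho> u))"
  using assms
proof (induction "len u" arbitrary: u rule: less_induct)
  case less
  show ?case
  proof (cases "u = \<one>")
    case True
    have "rs.neg_set (\<rho> u) = {}" by (auto simp: True rho_one rs.neg_set_def rs.pos_def)
    then show ?thesis using True len_one by simp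
  next
    case False
    then obtain t where t: "t \<in> S" "len (u \<otimes> t) < len u" using right_descent less(2) by blast
    note tc = gen_carrier[OF t(1)]
    let ?u = "u \<otimes> t"
    have uc: "?u \<in> carrier W" using less(2) tc by simp
    have e: "?u \<otimes> t = u" using gen_cancel(1)[OF t(1) less(2)] .
    have "len ?u \<le> len (?u \<otimes> t)" using t(2) e by simp
    then have "\<rho> ?u (\<alpha> t) \<in> cone_of (\<alpha> ` S)" using simple_image_positive[OF uc t(1)] by blast
    then have "0 < height (\<rho> ?u (\<alpha> t))" using root_pos_cone[OF rootsI[OF uc t(1)]] by blast
    then have "card (rs.neg_set (\<rho> u)) = card (rs.neg_set (\<rho> ?u)) + 1"
      using card_neg_set_right[OF uc t(1)] e by simp
    also have "card (rs.neg_set (\<rho> ?u)) = len ?u" using less(1)[OF t(2) uc] by simp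
    also have "len ?u + 1 = len u" using len_mult[OF uc tc] len_gen[OF t(1)] t(2) e by simp
    finally show ?thesis by simp
  qed
qed

lemma len_inv_set: "w \<in> carrier W \<Longrightarrow> len w = card (inv_set w)"
  using len_card[of "inv w"] len_inv[of w] by simp

lemma len_left_up:
  assumes w: "w \<in> carrier W" and t: "t \<in> S" and notin: "\<alpha> t \<notin> inv_set w"
  shows "len (t \<otimes> w) = len w + 1"
proof -
  note tc = gen_carrier[OF t]
  have "0 < height (\<rho> (inv w) (\<alpha> t))"
    using notin simple_in_pos[OF t] rs.root_neg_or_pos[OF rootsI[OF inv_closed[OF w] t]]
    by (auto simp: rs.neg_set_def)
  then have "card (rs.neg_set (\<rho> (inv w \<otimes> t))) = card (inv_set w) + 1"
    by (rule card_neg_set_right[OF inv_closed[OF w] t])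
  moreover have "inv (t \<otimes> w) = inv w \<otimes> t" using inv_mult_group[OF tc w] gen_inv[OF t] by simp
  ultimately show ?thesis using len_inv_set[of "t \<otimes> w"] len_inv_set[OF w] tc w by simp
qed

lemma len_left_down:
  assumes w: "w \<in> carrier W" and t: "t \<in> S" and mem: "\<alpha> t \<in> inv_set w"
  shows "len (t \<otimes> w) + 1 = len w"
proof -
  note tc = gen_carrier[OF t]
  have "\<rho> (inv (t \<otimes> w)) (\<alpha> t) = \<rho> (inv w) (\<rho> t (\<alpha> t))"
    using inv_mult_group[OF tc w] gen_inv[OF t] rho_mult[OF inv_closed[OF w] tc] by simp
  also have "\<dots> = - \<rho> (inv w) (\<alpha> t)"
    using rho_gen_self[OF t] linear_neg[OF rho_linear[OF inv_closed[OF w]]] by simp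
  finally have "\<alpha> t \<notin> inv_set (t \<otimes> w)" using rs.neg_setD(4)[OF mem] by (simp add: rs.neg_set_def height_uminus)
  then have "len (t \<otimes> (t \<otimes> w)) = len (t \<otimes> w) + 1" using len_left_up[OF _ t] tc w by simp
  then show ?thesis using gen_cancel(2)[OF t w] by simp
qed

lemma inv_set_right:
  assumes w: "w \<in> carrier W" and t: "t \<in> S" and pos: "0 < height (\<rho> w (\<alpha> t))"
  shows "inv_set (w \<otimes> t) = insert (\<rho> w (\<alpha> t)) (inv_set w)"
proof -
  note tc = gen_carrier[OF t]
  have e: "\<rho> (inv (w \<otimes> t)) \<beta> = refl B (\<alpha> t) (\<rho> (inv w) \<beta>)" for \<beta>
    using inv_mult_group[OF w tc] gen_inv[OF t] rho_mult[OF tc inv_closed[OF w]] rho_gen[OF t] by simp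
  have key: "height (refl B (\<alpha> t) (\<rho> (inv w) \<beta>)) < 0 \<longleftrightarrow> \<beta> = \<rho> w (\<alpha> t) \<or> height (\<rho> (inv w) \<beta>) < 0"
    if \<beta>: "\<beta> \<in> rs.pos" for \<beta>
  proof -
    define \<delta> where "\<delta> = \<rho> (inv w) \<beta>"
    have r: "\<delta> \<in> roots" unfolding \<delta>_def using rho_root[OF inv_closed[OF w]] rs.posD(1)[OF \<beta>] by blast
    have b: "\<beta> = \<rho> w \<delta>" unfolding \<delta>_def using rho_inv(1)[OF w] by simp
    have eq: "\<beta> = \<rho> w (\<alpha> t) \<longleftrightarrow> \<delta> = \<alpha> t" unfolding \<delta>_def using rho_inv[OF w] by (metis (no_types))
    have ne: "- \<delta> \<noteq> \<alpha> t"
    proof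
      assume "- \<delta> = \<alpha> t"
      then have "\<rho> w (\<alpha> t) = - \<beta>" using b linear_neg[OF rho_linear[OF w], of \<delta>] by simp
      then show False using pos rs.posD(2)[OF \<beta>] by (simp add: height_uminus)
    qed
    show ?thesis
      unfolding eq \<delta>_def[symmetric]
    proof (cases "height \<delta> < 0")
      case True
      then have "0 < height (refl B (\<alpha> t) (- \<delta>))"
        using simple_reflection_permutes[OF t uminus_roots[OF r] _ ne] by (simp add: height_uminus)
      also have "refl B (\<alpha> t) (- \<delta>) = - refl B (\<alpha> t) \<delta>"
        using linear_neg[OF rho_linear[OF tc]] rho_gen[OF t] by simp
      finally show "height (refl B (\<alpha> t) \<delta>) < 0 \<longleftrightarrow> \<delta> = \<alpha> t \<or> height \<delta> < 0"
        using True by (simp add: height_uminus)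
    next
      case False
      then have p: "0 < height \<delta>" using rs.root_neg_or_pos[OF r] by blast
      show "height (refl B (\<alpha> t) \<delta>) < 0 \<longleftrightarrow> \<delta> = \<alpha> t \<or> height \<delta> < 0"
      proof (cases "\<delta> = \<alpha> t")
        case True
        then show ?thesis using rs.refl_self[OF simple_in_roots[OF t]] height_simple[OF t] by (simp add: height_uminus)
      next
        case ne': False
        then show ?thesis using simple_reflection_permutes[OF t r p ne'] False by simp
      qed
    qed
  qed
  have mem: "\<rho> w (\<alpha> t) \<in> rs.pos" using rs.posI[OF rootsI[OF w t] pos] .
  show ?thesis
    unfolding rs.neg_set_def e using key mem by blast
qed

lemma not_in_inv_set:
  assumes w: "w \<in> carrier W" and t: "t \<in> S"
  shows "\<rho> w (\<alpha> t) \<notin> inv_set w"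
  using rho_inv(2)[OF w] height_simple[OF t] by (auto simp: rs.neg_set_def)

lemma finite_inv_set: "w \<in> carrier W \<Longrightarrow> finite (inv_set w)"
  using rs.finite_neg_set[of "\<rho> (inv w)"] by simp

lemma inv_set_step:
  assumes u: "u \<in> carrier W" and v: "v \<in> carrier W" and \<gamma>: "\<gamma> \<in> inv_set v"
  shows "if 0 < height (\<rho> u \<gamma>) then \<rho> u \<gamma> \<in> inv_set (u \<otimes> v) - inv_set u
    else - \<rho> u \<gamma> \<in> inv_set u - inv_set (u \<otimes> v)"
proof -
  note g = rs.neg_setD[OF \<gamma>]
  have r: "\<rho> u \<gamma> \<in> roots" using rho_root[OF u g(2)] .
  have e: "\<rho> (inv u) (\<rho> u \<gamma>) = \<gamma>" "\<rho> (inv (u \<otimes> v)) (\<rho> u \<gamma>) = \<rho> (inv v) \<gamma>"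
    using rho_inv(2)[OF u] inv_mult_group[OF u v] rho_mult[OF inv_closed[OF v] inv_closed[OF u]] by simp_all
  have neg: "\<rho> (inv u) (- x) = - \<rho> (inv u) x" "\<rho> (inv (u \<otimes> v)) (- x) = - \<rho> (inv (u \<otimes> v)) x" for x
    using linear_neg[OF rho_linear] u v by simp_all
  show ?thesis
  proof (cases "0 < height (\<rho> u \<gamma>)")
    case True
    then show ?thesis using r g e by (simp add: rs.neg_set_def rs.pos_def)
  next
    case False
    then have "0 < height (- \<rho> u \<gamma>)" using rs.root_neg_or_pos[OF r] by (simp add: height_uminus)
    then show ?thesis using False uminus_roots[OF r] g e by (simp add: rs.neg_set_def rs.pos_def neg height_uminus)
  qed
qed

text \<open>
  Up to signs, \<open>\<rho> u\<close> maps the inversions of \<open>v\<close> bijectively to the symmetric difference: those whose image is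
  positive become new inversions, the others cancel inversions of \<open>u\<close>.
\<close>

lemma len_sym_diff:
  assumes u: "u \<in> carrier W" and v: "v \<in> carrier W"
  shows "len v = card (inv_set (u \<otimes> v) - inv_set u) + card (inv_set u - inv_set (u \<otimes> v))"
proof -
  let ?w = "u \<otimes> v"
  have wc: "?w \<in> carrier W" using u v by simp
  let ?f = "\<lambda>\<gamma>. if 0 < height (\<rho> u \<gamma>) then \<rho> u \<gamma> else - \<rho> u \<gamma>"
  let ?E = "(inv_set ?w - inv_set u) \<union> (inv_set u - inv_set ?w)"
  have e: "\<rho> (inv v) (\<rho> (inv u) \<beta>) = \<rho> (inv ?w) \<beta>" for \<beta>
    using inv_mult_group[OF u v] rho_mult[OF inv_closed[OF v] inv_closed[OF u]] by simp
  have lin: "\<rho> (inv v) (- x) = - \<rho> (inv v) x" "\<rho> u (- x) = - \<rho> u x" for x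
    using linear_neg[OF rho_linear] u v by simp_all
  have "bij_betw ?f (inv_set v) ?E"
  proof (rule bij_betw_imageI)
    show "inj_on ?f (inv_set v)"
    proof (rule inj_onI)
      fix \<gamma> \<gamma>' assume \<gamma>: "\<gamma> \<in> inv_set v" "\<gamma>' \<in> inv_set v" and eq: "?f \<gamma> = ?f \<gamma>'"
      have "\<rho> u \<gamma> = \<rho> u \<gamma>' \<or> \<rho> u \<gamma> = \<rho> u (- \<gamma>')"
        using eq lin by (auto split: if_splits simp: minus_equation_iff)
      then have "\<gamma> = \<gamma>' \<or> \<gamma> = - \<gamma>'" using rho_bij[OF u] by (simp add: bij_def inj_eq)
      then show "\<gamma> = \<gamma>'" using rs.neg_setD(3)[OF \<gamma>(1)] rs.neg_setD(3)[OF \<gamma>(2)] by (auto simp: height_uminus)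
    qed
    show "?f ` inv_set v = ?E"
    proof (intro equalityI subsetI)
      fix \<beta> assume "\<beta> \<in> ?f ` inv_set v"
      then obtain \<gamma> where \<gamma>: "\<gamma> \<in> inv_set v" "\<beta> = ?f \<gamma>" by blast
      show "\<beta> \<in> ?E" using inv_set_step[OF u v \<gamma>(1)] \<gamma>(2) by (cases "0 < height (\<rho> u \<gamma>)") simp_all
    next
      fix \<beta> assume \<beta>: "\<beta> \<in> ?E"
      then have bp: "\<beta> \<in> rs.pos" using rs.neg_setD(1) by blast
      note b = rs.posD[OF bp]
      let ?\<gamma> = "\<rho> (inv u) \<beta>"
      have r: "?\<gamma> \<in> roots" using rho_root[OF inv_closed[OF u] b(1)] .
      have u\<gamma>: "\<rho> u ?\<gamma> = \<beta>" using rho_inv(1)[OF u] .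
      show "\<beta> \<in> ?f ` inv_set v"
      proof (cases "\<beta> \<in> inv_set ?w")
        case True
        then have "0 < height ?\<gamma>" using \<beta> bp rs.root_neg_or_pos[OF r] by (auto simp: rs.neg_set_def)
        moreover have "height (\<rho> (inv v) ?\<gamma>) < 0" unfolding e using rs.neg_setD(4)[OF True] .
        ultimately have "?\<gamma> \<in> inv_set v" using r rs.neg_setI by blast
        then show ?thesis using u\<gamma> b by (intro image_eqI[of _ _ ?\<gamma>]) simp_all
      next
        case False
        then have "height ?\<gamma> < 0" using \<beta> rs.neg_setD(4) by blast
        moreover have "\<not> height (\<rho> (inv v) ?\<gamma>) < 0" unfolding e using False bp by (simp add: rs.neg_set_def)
        then have "0 < height (\<rho> (inv v) ?\<gamma>)" using rs.root_neg_or_pos[OF rho_root[OF inv_closed[OF v] r]] by blast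
        ultimately have "- ?\<gamma> \<in> inv_set v" using uminus_roots[OF r] lin
          by (intro rs.neg_setI) (simp_all add: height_uminus)
        then show ?thesis using u\<gamma> b lin by (intro image_eqI[of _ _ "- ?\<gamma>"]) (simp_all add: height_uminus)
      qed
    qed
  qed
  then have "card (inv_set v) = card ?E" by (rule bij_betw_same_card)
  also have "\<dots> = card (inv_set ?w - inv_set u) + card (inv_set u - inv_set ?w)"
    using finite_inv_set[OF u] finite_inv_set[OF wc] by (intro card_Un_disjoint) auto
  finally show ?thesis using len_inv_set[OF v] by simp
qed

lemma len_additive_iff:
  assumes u: "u \<in> carrier W" and v: "v \<in> carrier W"
  shows "len (u \<otimes> v) = len u + len v \<longleftrightarrow> inv_set u \<subseteq> inv_set (u \<otimes> v)"
proof -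
  let ?U = "inv_set u" and ?X = "inv_set (u \<otimes> v)"
  have wc: "u \<otimes> v \<in> carrier W" using u v by simp
  have fin: "finite ?U" "finite ?X" using finite_inv_set u wc by blast+
  have c: "card ?X = card (?X \<inter> ?U) + card (?X - ?U)" "card ?U = card (?U \<inter> ?X) + card (?U - ?X)"
    using fin card_Int_Diff by blast+
  have "len (u \<otimes> v) = len u + len v \<longleftrightarrow> card (?U - ?X) = 0"
    using len_sym_diff[OF u v] len_inv_set[OF u] len_inv_set[OF wc] c by (simp add: Int_commute)
  also have "\<dots> \<longleftrightarrow> ?U \<subseteq> ?X" using fin by auto
  finally show ?thesis .
qed

lemma prefix_iff:
  assumes u: "u \<in> carrier W" and w: "w \<in> carrier W"
  shows "is_prefix u w \<longleftrightarrow> inv_set u \<subseteq> inv_set w"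
proof -
  define v where "v = inv u \<otimes> w"
  have v: "v \<in> carrier W" "w = u \<otimes> v" using u w by (simp_all add: v_def flip: m_assoc)
  have uniq: "v' = v" if "v' \<in> carrier W" "w = u \<otimes> v'" for v'
    using that u v by simp
  have "is_prefix u w \<longleftrightarrow> len w = len u + len v"
    unfolding is_prefix_def reduced_prod_def using u v uniq by blast
  then show ?thesis using len_additive_iff[OF u v(1)] v(2) by simp
qed

end

section \<open>Joins\<close>

context geometric_representation
begin

text \<open>
  The roots in a cone of positive roots form such a set, and the property is inherited by the set of positive roots
  whose image under \<open>w\<close> lies in the given set (\<open>closed_pair_shift\<close>).  This is what the induction on length requires.
\<close>

definition closed_pair :: "'v set \<Rightarrow> bool"
  where "closed_pair T \<longleftrightarrow> T \<subseteq> rs.pos \<and>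
    (\<forall>\<beta>\<in>T. \<forall>\<gamma>\<in>T. \<forall>p q. 0 \<le> p \<longrightarrow> 0 \<le> q \<longrightarrow> p *\<^sub>R \<beta> + q *\<^sub>R \<gamma> \<in> roots \<longrightarrow> p *\<^sub>R \<beta> + q *\<^sub>R \<gamma> \<in> T)"

lemma closed_pairD:
  assumes "closed_pair T"
  shows "T \<subseteq> rs.pos"
    and "\<lbrakk>\<beta> \<in> T; \<gamma> \<in> T; 0 \<le> p; 0 \<le> q; p *\<^sub>R \<beta> + q *\<^sub>R \<gamma> \<in> roots\<rbrakk> \<Longrightarrow> p *\<^sub>R \<beta> + q *\<^sub>R \<gamma> \<in> T"
  using assms unfolding closed_pair_def by blast+

lemma closed_pair_shift:
  assumes w: "w \<in> carrier W" and T: "closed_pair T"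
  shows "closed_pair {\<gamma> \<in> rs.pos. \<rho> w \<gamma> \<in> T}"
  unfolding closed_pair_def
proof (intro conjI ballI allI impI)
  fix \<beta> \<gamma> p q
  assume \<beta>: "\<beta> \<in> {\<gamma> \<in> rs.pos. \<rho> w \<gamma> \<in> T}" and \<gamma>: "\<gamma> \<in> {\<gamma> \<in> rs.pos. \<rho> w \<gamma> \<in> T}"
    and pq: "0 \<le> p" "0 \<le> q" and r: "p *\<^sub>R \<beta> + q *\<^sub>R \<gamma> \<in> roots"
  have e: "\<rho> w (p *\<^sub>R \<beta> + q *\<^sub>R \<gamma>) = p *\<^sub>R \<rho> w \<beta> + q *\<^sub>R \<rho> w \<gamma>"
    using rho_linear[OF w] by (simp add: linear_add linear_scale)
  have "p *\<^sub>R \<rho> w \<beta> + q *\<^sub>R \<rho> w \<gamma> \<in> roots" using rho_root[OF w r] e by simp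
  then have "\<rho> w (p *\<^sub>R \<beta> + q *\<^sub>R \<gamma>) \<in> T" unfolding e using closed_pairD(2)[OF T] \<beta> \<gamma> pq by simp
  moreover have "0 < height (p *\<^sub>R \<beta> + q *\<^sub>R \<gamma>)"
  proof -
    have "0 < height \<beta>" "0 < height \<gamma>" using \<beta> \<gamma> rs.posD(2) by blast+
    then have "0 \<le> p * height \<beta>" "0 \<le> q * height \<gamma>" using pq by simp_all
    then have "0 \<le> height (p *\<^sub>R \<beta> + q *\<^sub>R \<gamma>)" by (simp add: rs.ht_simps)
    then show ?thesis using height_nonzero[OF r] by simp
  qed
  ultimately show "p *\<^sub>R \<beta> + q *\<^sub>R \<gamma> \<in> {\<gamma> \<in> rs.pos. \<rho> w \<gamma> \<in> T}" using r rs.posI by simp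
qed auto

lemma simple_pair_coeffs:
  assumes r: "r \<in> S" and t: "t \<in> S" and ne: "r \<noteq> t" and pos: "p *\<^sub>R \<alpha> r + q *\<^sub>R \<alpha> t \<in> rs.pos"
  shows "0 \<le> p \<and> 0 \<le> q"
proof -
  have ab: "\<alpha> r \<noteq> \<alpha> t" using r t ne simple_inj by (auto dest: inj_onD)
  have "0 \<le> p" if "r \<in> S" "t \<in> S" "\<alpha> r \<noteq> \<alpha> t" "p *\<^sub>R \<alpha> r + q *\<^sub>R \<alpha> t \<in> rs.pos" for r t p q
  proof (rule ccontr)
    assume "\<not> 0 \<le> p"
    then have p: "0 < - p" by simp
    have e: "(- p) *\<^sub>R \<alpha> r + 1 *\<^sub>R (p *\<^sub>R \<alpha> r + q *\<^sub>R \<alpha> t) = q *\<^sub>R \<alpha> t" by simp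
    have "\<alpha> r = \<alpha> t"
      using rs.simple_extreme2[OF imageI[OF that(2)] simple_in_pos[OF that(1)] that(4) p zero_le_one e] .
    then show False using that(3) by simp
  qed
  from this[OF r t ab pos] this[OF t r ab[symmetric], of q p] pos show ?thesis by (simp add: add.commute)
qed

lemma alternating_inv_span:
  assumes "r \<in> S" "t \<in> S"
  shows "\<exists>p' q'. \<rho> (inv (alternating r t n)) (p *\<^sub>R \<alpha> r + q *\<^sub>R \<alpha> t) = p' *\<^sub>R \<alpha> r + q' *\<^sub>R \<alpha> t"
proof (induction n arbitrary: p q)
  case 0
  show ?case by (auto simp: rho_one)
next
  case (Suc n)
  let ?x = "if even n then t else r"
  have x: "?x \<in> S" using assms by simp
  note xc = gen_carrier[OF x] and bc = alternating_closed[OF assms, of n]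
  define c where "c = 2 * B (\<alpha> ?x) (p *\<^sub>R \<alpha> r + q *\<^sub>R \<alpha> t)"
  have "\<rho> (inv (alternating r t (Suc n))) (p *\<^sub>R \<alpha> r + q *\<^sub>R \<alpha> t)
      = \<rho> (inv (alternating r t n)) (\<rho> ?x (p *\<^sub>R \<alpha> r + q *\<^sub>R \<alpha> t))"
    using inv_mult_group[OF xc bc] gen_inv[OF x] rho_mult[OF inv_closed[OF bc] xc] by simp
  also have "\<rho> ?x (p *\<^sub>R \<alpha> r + q *\<^sub>R \<alpha> t) = p *\<^sub>R \<alpha> r + q *\<^sub>R \<alpha> t - c *\<^sub>R \<alpha> ?x"
    unfolding c_def using rep_gens[OF x] .
  also have "\<dots> = (if even n then p *\<^sub>R \<alpha> r + (q - c) *\<^sub>R \<alpha> t else (p - c) *\<^sub>R \<alpha> r + q *\<^sub>R \<alpha> t)"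
    by (simp add: scaleR_diff_left)
  finally show ?case using Suc[of p "q - c"] Suc[of "p - c" q] by (cases "even n") simp_all
qed

text \<open>
  Split off from \<open>z\<close> the longest alternating prefix \<open>a\<close> in \<open>r\<close> and \<open>t\<close>, where \<open>t\<close> is a left descent of \<open>z\<close>: \<open>z = a y\<close>.
  For the letter that would continue the prefix, the image of its simple root under \<open>a\<close> is a nonnegative combination of
  \<open>\<alpha> r\<close> and \<open>\<alpha> t\<close>, hence in \<open>T\<close>.  So the induction hypothesis applies to \<open>y\<close>, to this letter and to the
  set \<open>T\<close> pulled back by \<open>a\<close>.
\<close>

lemma extend_in_closed:
  assumes "z \<in> carrier W" "closed_pair T" "inv_set z \<subseteq> T" "r \<in> S" "\<alpha> r \<in> T" "\<alpha> r \<notin> inv_set z"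
  shows "\<exists>x\<in>S. \<rho> z (\<alpha> x) \<in> T"
  using assms
proof (induction "len z" arbitrary: z T r rule: less_induct)
  case less
  note zc = less(2) and T = less(3) and zT = less(4) and r = less(5) and rT = less(6) and rz = less(7)
  show ?case
  proof (cases "z = \<one>")
    case True
    then show ?thesis using r rT by (intro bexI[of _ r]) (simp_all add: rho_one)
  next
    case False
    then obtain t where t: "t \<in> S" "len (t \<otimes> z) < len z" using left_descent zc by blast
    have tz: "\<alpha> t \<in> inv_set z"
      by (rule ccontr) (use len_left_up[OF zc t(1)] t(2) in simp)
    have rt: "r \<noteq> t" using tz rz by blast
    note rc = gen_carrier[OF r] and tc = gen_carrier[OF t(1)]
    let ?b = "alternating r t"
    have bc: "?b n \<in> carrier W" for n using alternating_closed[OF r t(1)] .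
    have bzc: "?b n \<otimes> z \<in> carrier W" for n using bc[of n] zc by simp
    define valid where "valid n \<longleftrightarrow> len (?b n \<otimes> z) + n \<le> len z" for n
    have "\<not> valid (Suc (len z))" by (simp add: valid_def)
    then obtain n where n: "\<not> valid n" "\<And>i. i < n \<Longrightarrow> valid i" using exists_least_iff[of "\<lambda>n. \<not> valid n"] by blast
    have v01: "valid 0" "valid 1" using t(2) zc tc by (simp_all add: valid_def)
    have n0: "n \<noteq> 0" by (rule notI) (use v01(1) n(1) in simp)
    have n1: "n \<noteq> 1" by (rule notI) (use v01(2) n(1) in simp)
    define l where "l = n - 2"
    have nl: "n = Suc (Suc l)" using n0 n1 by (simp add: l_def)
    note [simp del] = alternating.simps(2)
    note b_Suc = alternating.simps(2)[of r t]
    define a where "a = inv (?b (Suc l))"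
    define y where "y = ?b (Suc l) \<otimes> z"
    have ac: "a \<in> carrier W" and yc: "y \<in> carrier W" using bc[of "Suc l"] zc by (simp_all add: a_def y_def)
    have zay: "z = a \<otimes> y" using bc[of "Suc l"] zc by (simp add: a_def y_def flip: m_assoc)
    have ly: "len y + Suc l \<le> len z" using n(2)[of "Suc l"] nl by (simp add: valid_def y_def)
    let ?x = "if even l then t else r" and ?x' = "if even (Suc l) then t else r"
    have x: "?x \<in> S" "?x' \<in> S" using r t(1) by simp_all
    note xc = gen_carrier[OF x(1)] gen_carrier[OF x(2)]
    have len_b: "len (?b i) \<le> i" for i using len_alternating[OF r t(1)] .
    have la: "len a \<le> Suc l" unfolding a_def using len_inv[OF bc] len_b[of "Suc l"] by simp
    have lz: "len z \<le> len a + len y" using len_mult[OF ac yc] zay by simp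
    have add: "len z = len a + len y" and la': "len a = Suc l" using la lz ly by linarith+
    have az: "inv_set a \<subseteq> inv_set z" using len_additive_iff[OF ac yc] add zay by simp
    \<comment> \<open>By maximality of the prefix, \<open>?x'\<close> is not a left descent of the rest \<open>y\<close>.\<close>
    have x'y: "\<alpha> ?x' \<notin> inv_set y"
    proof
      assume "\<alpha> ?x' \<in> inv_set y"
      then have "len (?x' \<otimes> y) + 1 = len y" by (rule len_left_down[OF yc x(2)])
      moreover have "?b n \<otimes> z = ?x' \<otimes> y"
        unfolding nl b_Suc[of "Suc l"] y_def by (rule m_assoc[OF xc(2) bc zc])
      ultimately have "valid n" using ly nl by (simp add: valid_def)
      then show False using n(1) by blast
    qed
    have neg: "height (\<rho> a (\<alpha> ?x)) < 0"
    proof (rule ccontr)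
      assume "\<not> ?thesis"
      then have "0 < height (\<rho> a (\<alpha> ?x))" using rs.root_neg_or_pos[OF rootsI[OF ac x(1)]] by blast
      then have "card (rs.neg_set (\<rho> (a \<otimes> ?x))) = card (rs.neg_set (\<rho> a)) + 1"
        by (rule card_neg_set_right[OF ac x(1)])
      then have "len (a \<otimes> ?x) = len a + 1"
        using len_card[OF ac] len_card[of "a \<otimes> ?x"] ac xc by simp
      moreover have "a \<otimes> ?x = inv (?b l)"
        unfolding a_def b_Suc[of l] using inv_mult_group[OF xc(1) bc] gen_inv[OF x(1)] gen_cancel(1)[OF x(1)] bc by simp
      then have "len (a \<otimes> ?x) \<le> l" using len_inv[OF bc] len_b[of l] by simp
      ultimately show False using la' by simp
    qed
    \<comment> \<open>Otherwise \<open>a\<close> would make both \<open>\<alpha> r\<close> and \<open>\<alpha> t\<close> negative, and with them \<open>\<alpha> r\<close>, the image of a nonnegative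
      combination of the two.\<close>
    have pos: "0 < height (\<rho> a (\<alpha> ?x'))"
    proof (rule ccontr)
      assume "\<not> ?thesis"
      then have neg': "height (\<rho> a (\<alpha> ?x')) < 0" using rs.root_neg_or_pos[OF rootsI[OF ac x(2)]] by blast
      have negs: "height (\<rho> a (\<alpha> r)) < 0" "height (\<rho> a (\<alpha> t)) < 0"
        using neg neg' by (auto split: if_splits)
      have ra: "\<alpha> r \<notin> inv_set a" using az rz by blast
      have inva: "inv a = ?b (Suc l)" unfolding a_def using inv_inv[OF bc] .
      have "0 < height (\<rho> (inv a) (\<alpha> r))"
        using ra simple_in_pos[OF r] rs.root_neg_or_pos[OF rootsI[OF inv_closed[OF ac] r]]
        by (auto simp: rs.neg_set_def)
      then have ip: "\<rho> (inv a) (\<alpha> r) \<in> rs.pos" using rs.posI[OF rootsI[OF inv_closed[OF ac] r]] by blast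
      obtain p q where pq: "\<rho> (inv a) (\<alpha> r) = p *\<^sub>R \<alpha> r + q *\<^sub>R \<alpha> t"
      proof (cases "even (Suc l)")
        case True
        then show thesis using that rho_alternating[OF r t(1), of "Suc l"] unfolding inva by metis
      next
        case False
        then have "\<rho> (inv a) (\<alpha> r) = cheb (- B (\<alpha> r) (\<alpha> t)) (Suc (Suc l)) *\<^sub>R \<alpha> t
          + cheb (- B (\<alpha> r) (\<alpha> t)) (Suc l) *\<^sub>R \<alpha> r"
          using rho_alternating[OF r t(1), of "Suc l"] unfolding inva by simp
        then show thesis using that[of "cheb (- B (\<alpha> r) (\<alpha> t)) (Suc l)" "cheb (- B (\<alpha> r) (\<alpha> t)) (Suc (Suc l))"]
          by (simp only: add.commute)
      qed
      have pq0: "0 \<le> p" "0 \<le> q" using simple_pair_coeffs[OF r t(1) rt] ip pq by auto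
      have "\<alpha> r = \<rho> a (p *\<^sub>R \<alpha> r + q *\<^sub>R \<alpha> t)" using pq rho_inv(1)[OF ac] by metis
      also have "\<dots> = p *\<^sub>R \<rho> a (\<alpha> r) + q *\<^sub>R \<rho> a (\<alpha> t)"
        using rho_linear[OF ac] by (simp add: linear_add linear_scale)
      finally have "height (\<alpha> r) = p * height (\<rho> a (\<alpha> r)) + q * height (\<rho> a (\<alpha> t))"
        by (metis rs.ht_simps(1,3) real_scaleR_def)
      moreover have "p * height (\<rho> a (\<alpha> r)) \<le> 0" "q * height (\<rho> a (\<alpha> t)) \<le> 0"
        using pq0 negs by (simp_all add: mult_le_0_iff)
      ultimately show False using height_simple[OF r] by simp
    qed
    define U where "U = {\<gamma> \<in> rs.pos. \<rho> a \<gamma> \<in> T}"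
    have U: "closed_pair U" unfolding U_def by (rule closed_pair_shift[OF ac T])
    have x'U: "\<alpha> ?x' \<in> U"
    proof -
      obtain p q where pq: "\<rho> a (\<alpha> ?x') = p *\<^sub>R \<alpha> r + q *\<^sub>R \<alpha> t"
        using alternating_inv_span[OF r t(1), of "Suc l" 1 0] alternating_inv_span[OF r t(1), of "Suc l" 0 1]
        unfolding a_def by (cases "even (Suc l)") auto
      have rp: "\<rho> a (\<alpha> ?x') \<in> rs.pos" using rs.posI[OF rootsI[OF ac x(2)] pos] .
      have pq0: "0 \<le> p" "0 \<le> q" using simple_pair_coeffs[OF r t(1) rt] rp pq by auto
      have "p *\<^sub>R \<alpha> r + q *\<^sub>R \<alpha> t \<in> T"
        using closed_pairD(2)[OF T rT _ pq0] tz zT rs.posD(1)[OF rp] unfolding pq by blast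
      then show ?thesis unfolding U_def using pq simple_in_pos[OF x(2)] by simp
    qed
    have yU: "inv_set y \<subseteq> U"
    proof
      fix \<gamma> assume \<gamma>: "\<gamma> \<in> inv_set y"
      have "\<rho> a \<gamma> \<in> inv_set z"
        using inv_set_step[OF ac yc \<gamma>] az unfolding zay[symmetric] by (auto split: if_splits)
      then show "\<gamma> \<in> U" unfolding U_def using zT rs.neg_setD(1)[OF \<gamma>] by blast
    qed
    have "len y < len z" using ly by simp
    then obtain x\<^sub>0 where x0: "x\<^sub>0 \<in> S" "\<rho> y (\<alpha> x\<^sub>0) \<in> U" using less(1)[OF _ yc U yU x(2) x'U x'y] by blast
    then have "\<rho> z (\<alpha> x\<^sub>0) \<in> T" unfolding U_def using zay rho_mult[OF ac yc] by simp
    then show ?thesis using x0(1) by blast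
  qed
qed

text \<open>
  Inversion sets are cut out by two linear functionals, the height and the height of the image.
\<close>

lemma root_cone_subset_inv_set:
  assumes g: "g \<in> carrier W" and X: "X \<subseteq> inv_set g"
  shows "root_cone X \<subseteq> inv_set g"
proof
  fix \<beta> assume "\<beta> \<in> root_cone X"
  then have b: "\<beta> \<in> cone_of X" "\<beta> \<in> roots" by (auto simp: root_cone_def)
  have "0 \<le> height \<beta>" using cone_of_functional(1)[OF b(1) height_linear] X rs.neg_setD(3) by blast
  then have "0 < height \<beta>" using height_nonzero[OF b(2)] by simp
  moreover have "linear (\<lambda>v. - height (\<rho> (inv g) v))"
    using rs.ht_comp_linear[of "\<rho> (inv g)"] g linear_compose_neg by simp
  then have "0 \<le> - height (\<rho> (inv g) \<beta>)"
    by (rule cone_of_functional(1)[OF b(1)]) (use X rs.neg_setD(4) in force)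
  then have "height (\<rho> (inv g) \<beta>) < 0" using height_nonzero[OF rho_root[OF inv_closed[OF g] b(2)]] by simp
  ultimately show "\<beta> \<in> inv_set g" using b rs.neg_setI by blast
qed

lemma subset_root_cone:
  assumes "X \<subseteq> roots"
  shows "X \<subseteq> root_cone X"
proof
  fix x assume x: "x \<in> X"
  show "x \<in> root_cone X" unfolding root_cone_def using cone_of_incl[OF x] assms x by blast
qed

lemma inv_set_roots: "inv_set w \<subseteq> roots"
  using rs.neg_setD(2) by blast

text \<open>
  Let \<open>w\<close> have the largest inversion set inside the root cone \<open>?T\<close>.  Suppose that \<open>y\<close> is not below \<open>w\<close>, and let \<open>x\<close> be a
  common prefix of \<open>y\<close> and \<open>w\<close> of maximal length.  The generator \<open>t\<close> that follows \<open>x\<close> in \<open>y\<close> gives an inversion of \<open>y\<close>, hence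
  a root of \<open>?T\<close>, that is not an inversion of \<open>w\<close>.  After shifting by \<open>x\<close>, the lemma \<open>extend_in_closed\<close> yields a generator by
  which \<open>w\<close> can be extended inside \<open>?T\<close>, contrary to its choice.
\<close>

theorem join_inversions:
  assumes Y: "Y \<subseteq> carrier W" and g: "g \<in> carrier W" and bound: "\<And>y. y \<in> Y \<Longrightarrow> inv_set y \<subseteq> inv_set g"
  shows "\<exists>w\<in>carrier W. inv_set w = root_cone (\<Union>y\<in>Y. inv_set y)"
proof -
  let ?X = "\<Union>y\<in>Y. inv_set y"
  let ?T = "root_cone ?X"
  have Tg: "?T \<subseteq> inv_set g" using bound by (intro root_cone_subset_inv_set[OF g]) blast
  have fin: "finite (inv_set g)" using finite_inv_set[OF g] .
  have XT: "?X \<subseteq> ?T" using inv_set_roots by (intro subset_root_cone UN_least)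
  have T: "closed_pair ?T"
    unfolding closed_pair_def
  proof (intro conjI ballI allI impI)
    show "?T \<subseteq> rs.pos" using Tg rs.neg_setD(1) by blast
    fix \<beta> \<gamma> p q assume "\<beta> \<in> ?T" "\<gamma> \<in> ?T" "0 \<le> p" "0 \<le> q" "p *\<^sub>R \<beta> + q *\<^sub>R \<gamma> \<in> roots"
    then show "p *\<^sub>R \<beta> + q *\<^sub>R \<gamma> \<in> ?T" by (simp add: root_cone_def cone_of_add cone_of_scale)
  qed
  have largest: "\<exists>w. P w \<and> (\<forall>w'. P w' \<longrightarrow> card (inv_set w') \<le> card (inv_set w))"
    if P: "P w\<^sub>0" and le: "\<And>w. P w \<Longrightarrow> inv_set w \<subseteq> inv_set g" for P w\<^sub>0
    using ex_has_greatest_nat[of P w\<^sub>0 "\<lambda>w. card (inv_set w)" "Suc (card (inv_set g))"] P card_mono[OF fin le]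
    by (simp add: less_Suc_eq_le)
  have one: "inv_set \<one> = {}" by (auto simp: rs.neg_set_def rs.pos_def rho_one)
  obtain w where w: "w \<in> carrier W" "inv_set w \<subseteq> ?T"
    and max: "\<And>w'. w' \<in> carrier W \<Longrightarrow> inv_set w' \<subseteq> ?T \<Longrightarrow> card (inv_set w') \<le> card (inv_set w)"
    using largest[of "\<lambda>w. w \<in> carrier W \<and> inv_set w \<subseteq> ?T" \<one>] one Tg by blast
  have "inv_set y \<subseteq> inv_set w" if y: "y \<in> Y" for y
  proof (rule ccontr)
    assume ny: "\<not> ?thesis"
    have yc: "y \<in> carrier W" using y Y by blast
    let ?P = "\<lambda>x. x \<in> carrier W \<and> inv_set x \<subseteq> inv_set y \<and> inv_set x \<subseteq> inv_set w"
    have "\<exists>x. ?P x \<and> (\<forall>x'. ?P x' \<longrightarrow> card (inv_set x') \<le> card (inv_set x))"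
    proof (rule largest[of ?P \<one>])
      show "?P \<one>" using one by simp
      show "inv_set x \<subseteq> inv_set g" if "?P x" for x using that bound[OF y] by (meson order.trans)
    qed
    then obtain x where x: "x \<in> carrier W" "inv_set x \<subseteq> inv_set y" "inv_set x \<subseteq> inv_set w"
      and xmax: "\<And>x'. x' \<in> carrier W \<Longrightarrow> inv_set x' \<subseteq> inv_set y \<Longrightarrow> inv_set x' \<subseteq> inv_set w \<Longrightarrow> card (inv_set x') \<le> card (inv_set x)"
      by blast
    define u where "u = inv x \<otimes> y"
    have uc: "u \<in> carrier W" and xu: "y = x \<otimes> u" using x yc by (simp_all add: u_def flip: m_assoc)
    have "u \<noteq> \<one>" using x xu ny by auto
    then obtain t where t: "t \<in> S" "len (t \<otimes> u) < len u" using left_descent uc by blast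
    have tu: "\<alpha> t \<in> inv_set u"
      by (rule ccontr) (use len_left_up[OF uc t(1)] t(2) in simp)
    have xt: "\<rho> x (\<alpha> t) \<in> inv_set y"
      using inv_set_step[OF x(1) uc tu] x(2) unfolding xu[symmetric] by (auto split: if_splits)
    have xt_pos: "0 < height (\<rho> x (\<alpha> t))" using rs.neg_setD(3)[OF xt] .
    have right: "inv_set (x \<otimes> t) = insert (\<rho> x (\<alpha> t)) (inv_set x)" using inv_set_right[OF x(1) t(1) xt_pos] .
    have tc: "x \<otimes> t \<in> carrier W" using x gen_carrier[OF t(1)] by simp
    have "card (inv_set (x \<otimes> t)) = card (inv_set x) + 1"
      unfolding right using not_in_inv_set[OF x(1) t(1)] finite_inv_set[OF x(1)] by simp
    then have "\<not> inv_set (x \<otimes> t) \<subseteq> inv_set w" using xmax[OF tc] xt x(2) unfolding right by fastforce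
    then have xtw: "\<rho> x (\<alpha> t) \<notin> inv_set w" unfolding right using x(3) by blast
    define z where "z = inv x \<otimes> w"
    have zc: "z \<in> carrier W" and xz: "w = x \<otimes> z" using x w by (simp_all add: z_def flip: m_assoc)
    define U where "U = {\<gamma> \<in> rs.pos. \<rho> x \<gamma> \<in> ?T}"
    have zU: "inv_set z \<subseteq> U"
    proof
      fix \<gamma> assume \<gamma>: "\<gamma> \<in> inv_set z"
      have "\<rho> x \<gamma> \<in> inv_set w"
        using inv_set_step[OF x(1) zc \<gamma>] x(3) unfolding xz[symmetric] by (auto split: if_splits)
      then show "\<gamma> \<in> U" unfolding U_def using w(2) rs.neg_setD(1)[OF \<gamma>] by blast
    qed
    have tU: "\<alpha> t \<in> U" unfolding U_def using XT y xt simple_in_pos[OF t(1)] by blast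
    have tz: "\<alpha> t \<notin> inv_set z"
    proof
      assume "\<alpha> t \<in> inv_set z"
      then have "\<rho> x (\<alpha> t) \<in> inv_set w"
        using inv_set_step[OF x(1) zc] xt_pos unfolding xz[symmetric] by force
      then show False using xtw by blast
    qed
    have "closed_pair U" unfolding U_def by (rule closed_pair_shift[OF x(1) T])
    then obtain r where r: "r \<in> S" "\<rho> z (\<alpha> r) \<in> U"
      using extend_in_closed[OF zc _ zU t(1) tU tz] by blast
    have wr: "\<rho> w (\<alpha> r) \<in> ?T" using r(2) unfolding U_def xz rho_mult[OF x(1) zc] by simp
    then have "0 < height (\<rho> w (\<alpha> r))" using closed_pairD(1)[OF T] rs.posD(2) by blast
    then have right': "inv_set (w \<otimes> r) = insert (\<rho> w (\<alpha> r)) (inv_set w)" by (rule inv_set_right[OF w(1) r(1)])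
    have "card (inv_set (w \<otimes> r)) = card (inv_set w) + 1"
      unfolding right' using not_in_inv_set[OF w(1) r(1)] finite_inv_set[OF w(1)] by simp
    moreover have "card (inv_set (w \<otimes> r)) \<le> card (inv_set w)"
      using w(1) gen_carrier[OF r(1)] wr w(2) by (intro max) (simp_all add: right')
    ultimately show False by simp
  qed
  then have "?X \<subseteq> inv_set w" by blast
  then have "?T \<subseteq> inv_set w" by (rule root_cone_subset_inv_set[OF w(1)])
  then show ?thesis using w by blast
qed

section \<open>Low elements\<close>

text \<open>
  As \<open>N(w)\<close> is closed under root cones, only one inclusion matters.
\<close>

lemma low_iff:
  assumes "w \<in> carrier W"
  shows "w \<in> low_elements \<longleftrightarrow> (\<exists>A. A \<subseteq> rs.small \<and> A \<subseteq> inv_set w \<and> inv_set w \<subseteq> cone_of A)"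
proof
  assume "w \<in> low_elements"
  then obtain A where A: "A \<subseteq> rs.small" "inv_set w = root_cone A"
    using assms inversions_eq by (auto simp: low_elements_def small_roots_eq)
  have "rs.small \<subseteq> roots" by (auto simp: rs.small_def rs.pos_def)
  then have "A \<subseteq> root_cone A" using A(1) by (intro subset_root_cone) blast
  then show "\<exists>A. A \<subseteq> rs.small \<and> A \<subseteq> inv_set w \<and> inv_set w \<subseteq> cone_of A"
    using A unfolding root_cone_def by (intro exI[of _ A]) auto
next
  assume "\<exists>A. A \<subseteq> rs.small \<and> A \<subseteq> inv_set w \<and> inv_set w \<subseteq> cone_of A"
  then obtain A where A: "A \<subseteq> rs.small" "A \<subseteq> inv_set w" "inv_set w \<subseteq> cone_of A" by blast
  have "inv_set w \<subseteq> root_cone A" unfolding root_cone_def using A(3) rs.neg_setD(2) by blast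
  then have "inversions w = root_cone A"
    using root_cone_subset_inv_set[OF assms A(2)] inversions_eq[OF assms] by simp
  then show "w \<in> low_elements" using assms A(1) by (auto simp: low_elements_def small_roots_eq)
qed

lemma low_carrier: "low_elements \<subseteq> carrier W"
  by (auto simp: low_elements_def)

text \<open>
  The simple reflection makes no positive root negative but its own.
\<close>

lemma simple_small:
  assumes t: "t \<in> S"
  shows "\<alpha> t \<in> rs.small"
  unfolding rs.small_def
proof (intro CollectI conjI ballI impI)
  show "\<alpha> t \<in> rs.pos" using simple_in_pos[OF t] .
  fix \<gamma> assume \<gamma>: "\<gamma> \<in> rs.pos" "rs.dom (\<alpha> t) \<gamma>"
  have "height (\<rho> t (\<alpha> t)) < 0" using rho_gen_self[OF t] height_simple[OF t] by (simp add: height_uminus)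
  then have "height (\<rho> t \<gamma>) < 0" using \<gamma>(2) gen_carrier[OF t] by (simp add: rs.dom_def)
  then show "\<gamma> = \<alpha> t"
    using simple_reflection_permutes[OF t rs.posD[OF \<gamma>(1)]] rho_gen[OF t] by fastforce
qed

lemma gen_low:
  assumes t: "t \<in> S"
  shows "t \<in> low_elements"
proof -
  note tc = gen_carrier[OF t]
  have "0 < height (\<rho> \<one> (\<alpha> t))" using height_simple[OF t] by (simp add: rho_one)
  then have "inv_set (\<one> \<otimes> t) = insert (\<rho> \<one> (\<alpha> t)) (inv_set \<one>)" by (rule inv_set_right[OF one_closed t])
  moreover have "inv_set \<one> = {}" by (auto simp: rs.neg_set_def rs.pos_def rho_one)
  ultimately have "inv_set t = {\<alpha> t}" using tc by (simp add: rho_one)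
  then show ?thesis
    unfolding low_iff[OF tc] using simple_small[OF t] cone_of_incl[of "\<alpha> t" "{\<alpha> t}"] by (intro exI[of _ "{\<alpha> t}"]) simp
qed

lemma low_join:
  assumes Y: "Y \<subseteq> low_elements" and bd: "bounded_in_weak_order Y"
  shows "\<exists>w. is_join w Y \<and> w \<in> low_elements"
proof -
  have Yc: "Y \<subseteq> carrier W" using Y low_carrier by blast
  obtain g where g: "g \<in> carrier W" "\<And>y. y \<in> Y \<Longrightarrow> is_prefix y g" using bd by (auto simp: bounded_in_weak_order_def)
  have bound: "inv_set y \<subseteq> inv_set g" if "y \<in> Y" for y using g that Yc prefix_iff by blast
  obtain w where w: "w \<in> carrier W" "inv_set w = root_cone (\<Union>y\<in>Y. inv_set y)"
    using join_inversions[OF Yc g(1) bound] by blast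
  have "(\<Union>y\<in>Y. inv_set y) \<subseteq> inv_set w"
    unfolding w(2) using inv_set_roots by (intro subset_root_cone UN_least)
  then have sub: "inv_set y \<subseteq> inv_set w" if "y \<in> Y" for y using that by blast
  have "is_join w Y"
    unfolding is_join_def least_def
  proof (intro conjI ballI)
    show "Upper weak_order Y \<subseteq> carrier weak_order" by (auto simp: Upper_def)
    show "w \<in> Upper weak_order Y"
      using w(1) sub prefix_iff[OF _ w(1)] Yc by (auto simp: Upper_def weak_order_def)
    fix x assume "x \<in> Upper weak_order Y"
    then have x: "x \<in> carrier W" "\<And>y. y \<in> Y \<Longrightarrow> is_prefix y x" using Yc by (auto simp: Upper_def weak_order_def)
    have "(\<Union>y\<in>Y. inv_set y) \<subseteq> inv_set x" using x Yc prefix_iff by blast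
    then have "inv_set w \<subseteq> inv_set x" unfolding w(2) by (rule root_cone_subset_inv_set[OF x(1)])
    then show "w \<sqsubseteq>\<^bsub>weak_order\<^esub> x" using prefix_iff[OF w(1) x(1)] by (simp add: weak_order_def)
  qed
  moreover have "w \<in> low_elements"
  proof -
    have "\<forall>y\<in>Y. \<exists>A. A \<subseteq> rs.small \<and> A \<subseteq> inv_set y \<and> inv_set y \<subseteq> cone_of A"
      using Y Yc low_iff by blast
    then obtain A where A: "\<And>y. y \<in> Y \<Longrightarrow> A y \<subseteq> rs.small \<and> A y \<subseteq> inv_set y \<and> inv_set y \<subseteq> cone_of (A y)" by metis
    have "inv_set y \<subseteq> cone_of (\<Union>y\<in>Y. A y)" if "y \<in> Y" for y
      using A[OF that] cone_of_mono[of "A y" "\<Union>y\<in>Y. A y"] that by blast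
    then have "cone_of (\<Union>y\<in>Y. inv_set y) \<subseteq> cone_of (\<Union>y\<in>Y. A y)" by (intro cone_of_trans) blast
    then have "inv_set w \<subseteq> cone_of (\<Union>y\<in>Y. A y)" unfolding w(2) root_cone_def by blast
    moreover have "(\<Union>y\<in>Y. A y) \<subseteq> rs.small" "(\<Union>y\<in>Y. A y) \<subseteq> inv_set w" using A sub by blast+
    ultimately show ?thesis unfolding low_iff[OF w(1)] by blast
  qed
  ultimately show ?thesis by blast
qed

lemma low_cancel_left:
  assumes w: "w \<in> carrier W" and t: "t \<in> S" and up: "len w < len (t \<otimes> w)" and low: "t \<otimes> w \<in> low_elements"
  shows "w \<in> low_elements"
proof -
  note tc = gen_carrier[OF t]
  let ?g = "\<rho> (inv w)"
  have gG: "?g \<in> \<rho> ` carrier W" using w by simp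
  have nt: "\<alpha> t \<notin> inv_set w"
  proof
    assume "\<alpha> t \<in> inv_set w"
    then show False using len_left_down[OF w t] up by simp
  qed
  then have pos: "0 < height (?g (\<alpha> t))"
    using simple_in_pos[OF t] rs.root_neg_or_pos[OF rootsI[OF inv_closed[OF w] t]] by (auto simp: rs.neg_set_def)
  have e: "\<rho> (inv (t \<otimes> w)) = ?g \<circ> refl B (\<alpha> t)"
    using inv_mult_group[OF tc w] gen_inv[OF t] rho_mult[OF inv_closed[OF w] tc] rho_gen[OF t] by simp
  have twc: "t \<otimes> w \<in> carrier W" using tc w by simp
  obtain A where A: "A \<subseteq> rs.small" "A \<subseteq> inv_set (t \<otimes> w)" "inv_set (t \<otimes> w) \<subseteq> cone_of A"
    using low low_iff[OF twc] by blast
  have "inv_set w \<subseteq> cone_of (rs.small \<inter> inv_set w)"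
    using rs.low_suffix[OF gG imageI[OF t] pos A(1)] A(2,3) unfolding e by blast
  then show ?thesis unfolding low_iff[OF w] by (intro exI[of _ "rs.small \<inter> inv_set w"]) simp
qed

lemma low_suffix_closed:
  assumes "u \<in> carrier W" "v \<in> carrier W" "len (u \<otimes> v) = len u + len v" "u \<otimes> v \<in> low_elements"
  shows "v \<in> low_elements"
  using assms
proof (induction "len u" arbitrary: u rule: less_induct)
  case less
  show ?case
  proof (cases "u = \<one>")
    case True
    then show ?thesis using less by simp
  next
    case False
    then obtain t where t: "t \<in> S" "len (t \<otimes> u) < len u" using left_descent less(2) by blast
    note tc = gen_carrier[OF t(1)]
    let ?u = "t \<otimes> u"
    have uc: "?u \<in> carrier W" using tc less(2) by simp
    have e: "t \<otimes> (?u \<otimes> v) = u \<otimes> v" using gen_cancel(2)[OF t(1)] m_assoc[OF tc less(2,3)] less(2,3) by simp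
    have le: "len (?u \<otimes> v) \<le> len ?u + len v" using len_mult[OF uc less(3)] .
    have "len (u \<otimes> v) \<le> len t + len (?u \<otimes> v)" using len_mult[OF tc, of "?u \<otimes> v"] uc less(3) e by simp
    then have ge: "len u + len v \<le> 1 + len (?u \<otimes> v)" using less(4) len_gen[OF t(1)] by simp
    have add: "len (?u \<otimes> v) = len ?u + len v" using le ge t(2) by linarith
    have "?u \<otimes> v \<in> low_elements"
      using low_cancel_left[OF _ t(1), of "?u \<otimes> v"] uc less(3,4,5) e add t(2) by simp
    then show ?thesis using less(1)[OF t(2) uc less(3) add] by blast
  qed
qed

theorem low_garside_shadow: "garside_shadow low_elements"
  unfolding garside_shadow_def
proof (intro conjI allI impI)
  show "S \<subseteq> low_elements" using gen_low by blast
  show "low_elements \<subseteq> carrier W" by (rule low_carrier)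
  show "\<exists>g. is_join g Y \<and> g \<in> low_elements" if "Y \<subseteq> low_elements" "bounded_in_weak_order Y" for Y
    using low_join that by blast
  show "v \<in> low_elements" if "w \<in> low_elements" "is_suffix v w" for w v
    using that low_suffix_closed unfolding is_suffix_def reduced_prod_def by blast
qed

end

theorem theorem1p1:
  fixes W :: "('w, 'b) monoid_scheme" and S :: "'w set"
    and B :: "'v::real_vector \<Rightarrow> 'v \<Rightarrow> real"
    and \<alpha> :: "'w \<Rightarrow> 'v" and \<rho> :: "'w \<Rightarrow> 'v \<Rightarrow> 'v"
  assumes "coxeter_system W S"
    and "finite S"
    and "geometric_representation W S B \<alpha> \<rho>"
  shows "coxeter_system.garside_shadow W S
           (geometric_representation.low_elements W S \<alpha> \<rho>)"
  using geometric_representation.low_garside_shadow[OF assms(3)] .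

end
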